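(* Let $p \geq 3$ be a prime number and $k = \mathbb{F}_p(X_{1},X_{2}, \dots, X_{n}, \dots)$ the field of rational functions in indeterminates $\{X_{i}\}_{i \geq 1}$ over the finite field $\mathbb{F}_{p}$. Then $A_{(X_i)}$, $i \geq 1$, is an infinite family of (pairwise) non-isomorphic $4p$-dimensional Hopf algebras over $k$.
   Context: For $q\in k^*$, $A_{(q)}$ denotes the $4p$-dimensional Hopf algebra over $k$ generated as an algebra by $g$ and $x$ subject to the relations $g^2=1$, $x^{2p}=q^{p-1}x^2$, $xg=-gx$, with coalgebra structure given such that $g$ is group-like ($\Delta(g)=g\otimes g$) and $x$ is $(1,g)$-primitive ($\Delta(x)=x\otimes 1+g\otimes x$). *)

theory Defs
  imports
    "HOL-Algebra.QuotRing"
    "HOL-Computational_Algebra.Fraction_Field"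
    "HOL-Library.Poly_Mapping"
    "Jordan_Normal_Form.VS_Connect"
    "Berlekamp_Zassenhaus.Finite_Field"
begin

hide_const (open) Multiset.mult Polynomial.smult Modules.module

text \<open>
  Scalars form a field type \<open>'k\<close>, viewed as the ring record \<open>class_ring\<close>. Algebras are
  carrier-based \<open>module\<close> records, because the algebras below depend on term parameters.
  The library's locale \<open>algebra\<close> is not usable here: it requires commutativity.
\<close>

definition unital_algebra :: "('k::field, 'a, 'm) module_scheme \<Rightarrow> bool" where
  "unital_algebra A \<longleftrightarrow> ring A \<and> vectorspace class_ring A \<and>
     (\<forall>c. \<forall>a\<in>carrier A. \<forall>b\<in>carrier A.
        c \<odot>\<^bsub>A\<^esub> (a \<otimes>\<^bsub>A\<^esub> b) = (c \<odot>\<^bsub>A\<^esub> a) \<otimes>\<^bsub>A\<^esub> b \<and>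
        c \<odot>\<^bsub>A\<^esub> (a \<otimes>\<^bsub>A\<^esub> b) = a \<otimes>\<^bsub>A\<^esub> (c \<odot>\<^bsub>A\<^esub> b))"

definition algebra_hom ::
  "('k::field, 'a, 'm) module_scheme \<Rightarrow> ('k, 'b, 'n) module_scheme \<Rightarrow> ('a \<Rightarrow> 'b) set" where
  "algebra_hom A B = Ring.ring_hom A B \<inter> LinearCombinations.module_hom class_ring A B"

definition scalar_algebra :: "('k::field, 'k) module" where
  "scalar_algebra = ring.extend class_ring (module.fields (\<lambda>c a. c * a))"

definition quot_algebra :: "('k::field, 'a, 'm) module_scheme \<Rightarrow> 'a set \<Rightarrow> ('k, 'a set) module" where
  "quot_algebra A I =
     ring.extend (A Quot I) (module.fields (\<lambda>c U. \<Union>u\<in>U. I +>\<^bsub>A\<^esub> (c \<odot>\<^bsub>A\<^esub> u)))"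

definition monoid_algebra :: "('g, 'z) monoid_scheme \<Rightarrow> ('k::field, 'g \<Rightarrow>\<^sub>0 'k) module" where
  "monoid_algebra G =
     \<lparr>carrier = {f. Poly_Mapping.keys f \<subseteq> carrier G},
      mult = (\<lambda>f h. \<Sum>u\<in>Poly_Mapping.keys f. \<Sum>v\<in>Poly_Mapping.keys h.
        Poly_Mapping.single (u \<otimes>\<^bsub>G\<^esub> v) (Poly_Mapping.lookup f u * Poly_Mapping.lookup h v)),
      one = Poly_Mapping.single \<one>\<^bsub>G\<^esub> 1,
      zero = 0,
      add = (+),
      smult = (\<lambda>c. Poly_Mapping.map ((*) c))\<rparr>"


subsection \<open>Tensor products\<close>

text \<open>
  \<open>A \<otimes> B\<close> is the free vector space on \<open>carrier A \<times> carrier B\<close> modulo the subspace spanned by the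
  bilinearity relators. The free vector space is taken as the monoid algebra of the product of the
  multiplicative monoids, so that the quotient carries the multiplication
  \<open>(a \<otimes> b) (a' \<otimes> b') = a a' \<otimes> b b'\<close>.
\<close>

definition tensor_relators ::
  "('k::field, 'a, 'm) module_scheme \<Rightarrow> ('k, 'b, 'n) module_scheme \<Rightarrow> ('a \<times> 'b \<Rightarrow>\<^sub>0 'k) set" where
  "tensor_relators A B =
     {Poly_Mapping.single (a \<oplus>\<^bsub>A\<^esub> a', b) 1 - Poly_Mapping.single (a, b) 1 - Poly_Mapping.single (a', b) 1
       | a a' b. a \<in> carrier A \<and> a' \<in> carrier A \<and> b \<in> carrier B} \<union>
     {Poly_Mapping.single (a, b \<oplus>\<^bsub>B\<^esub> b') 1 - Poly_Mapping.single (a, b) 1 - Poly_Mapping.single (a, b') 1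
       | a b b'. a \<in> carrier A \<and> b \<in> carrier B \<and> b' \<in> carrier B} \<union>
     {Poly_Mapping.single (c \<odot>\<^bsub>A\<^esub> a, b) 1 - Poly_Mapping.single (a, b) c
       | c a b. a \<in> carrier A \<and> b \<in> carrier B} \<union>
     {Poly_Mapping.single (a, c \<odot>\<^bsub>B\<^esub> b) 1 - Poly_Mapping.single (a, b) c
       | c a b. a \<in> carrier A \<and> b \<in> carrier B}"

definition tensor_subspace ::
  "('k::field, 'a, 'm) module_scheme \<Rightarrow> ('k, 'b, 'n) module_scheme \<Rightarrow> ('a \<times> 'b \<Rightarrow>\<^sub>0 'k) set" where
  "tensor_subspace A B =
     LinearCombinations.module.span class_ring (monoid_algebra (A \<times>\<times> B)) (tensor_relators A B)"

definition tensor_algebra ::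
  "('k::field, 'a, 'm) module_scheme \<Rightarrow> ('k, 'b, 'n) module_scheme \<Rightarrow>
     ('k, ('a \<times> 'b \<Rightarrow>\<^sub>0 'k) set) module" where
  "tensor_algebra A B = quot_algebra (monoid_algebra (A \<times>\<times> B)) (tensor_subspace A B)"

definition pure_tensor ::
  "('k::field, 'a, 'm) module_scheme \<Rightarrow> ('k, 'b, 'n) module_scheme \<Rightarrow> 'a \<Rightarrow> 'b \<Rightarrow>
     ('a \<times> 'b \<Rightarrow>\<^sub>0 'k) set" where
  "pure_tensor A B a b =
     tensor_subspace A B +>\<^bsub>monoid_algebra (A \<times>\<times> B)\<^esub> Poly_Mapping.single (a, b) 1"

text \<open>
  The linear map \<open>a \<otimes> b \<mapsto> \<beta> a b\<close> into \<open>C\<close> induced by a bilinear \<open>\<beta>\<close>: for such \<open>\<beta>\<close> the linear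
  extension is constant on each class \<open>T\<close> of the quotient, and \<^const>\<open>the_elem\<close> picks that value.
\<close>

definition tensor_lift ::
  "('k::field, 'c, 'm) module_scheme \<Rightarrow> ('a \<Rightarrow> 'b \<Rightarrow> 'c) \<Rightarrow> ('a \<times> 'b \<Rightarrow>\<^sub>0 'k) set \<Rightarrow> 'c" where
  "tensor_lift C \<beta> T =
     the_elem ((\<lambda>f. \<Oplus>\<^bsub>C\<^esub>u\<in>Poly_Mapping.keys f. Poly_Mapping.lookup f u \<odot>\<^bsub>C\<^esub> \<beta> (fst u) (snd u)) ` T)"

definition tensor_map ::
  "('k::field, 'c, 'm) module_scheme \<Rightarrow> ('k, 'd, 'n) module_scheme \<Rightarrow> ('a \<Rightarrow> 'c) \<Rightarrow> ('b \<Rightarrow> 'd) \<Rightarrow>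
     ('a \<times> 'b \<Rightarrow>\<^sub>0 'k) set \<Rightarrow> ('c \<times> 'd \<Rightarrow>\<^sub>0 'k) set" where
  "tensor_map C D f h = tensor_lift (tensor_algebra C D) (\<lambda>a b. pure_tensor C D (f a) (h b))"

definition tensor_assoc ::
  "('k::field, 'a, 'l) module_scheme \<Rightarrow> ('k, 'b, 'm) module_scheme \<Rightarrow> ('k, 'c, 'n) module_scheme \<Rightarrow>
     ((('a \<times> 'b \<Rightarrow>\<^sub>0 'k) set) \<times> 'c \<Rightarrow>\<^sub>0 'k) set \<Rightarrow> ('a \<times> (('b \<times> 'c \<Rightarrow>\<^sub>0 'k) set) \<Rightarrow>\<^sub>0 'k) set" where
  "tensor_assoc A B C =
     (let BC = tensor_algebra B C; ABC = tensor_algebra A BC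
      in tensor_lift ABC (\<lambda>t c. tensor_lift ABC (\<lambda>a b. pure_tensor A BC a (pure_tensor B C b c)) t))"


subsection \<open>Hopf algebras\<close>

record (overloaded) ('k, 'a) coalgebra_module = "('k::zero, 'a) module" +
  comult :: "'a \<Rightarrow> ('a \<times> 'a \<Rightarrow>\<^sub>0 'k) set"
  counit :: "'a \<Rightarrow> 'k"

definition bialgebra :: "('k::field, 'a, 'm) coalgebra_module_scheme \<Rightarrow> bool" where
  "bialgebra H \<longleftrightarrow>
     unital_algebra H \<and>
     comult H \<in> algebra_hom H (tensor_algebra H H) \<and>
     counit H \<in> algebra_hom H scalar_algebra \<and>
     (\<forall>h\<in>carrier H.
        tensor_assoc H H H (tensor_map (tensor_algebra H H) H (comult H) id (comult H h)) =
          tensor_map H (tensor_algebra H H) id (comult H) (comult H h) \<and>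
        tensor_lift H (\<lambda>a b. counit H a \<odot>\<^bsub>H\<^esub> b) (comult H h) = h \<and>
        tensor_lift H (\<lambda>a b. counit H b \<odot>\<^bsub>H\<^esub> a) (comult H h) = h)"

definition is_antipode :: "('k::field, 'a, 'm) coalgebra_module_scheme \<Rightarrow> ('a \<Rightarrow> 'a) \<Rightarrow> bool" where
  "is_antipode H S \<longleftrightarrow>
     S \<in> LinearCombinations.module_hom class_ring H H \<and>
     (\<forall>h\<in>carrier H.
        tensor_lift H (\<lambda>a b. S a \<otimes>\<^bsub>H\<^esub> b) (comult H h) = counit H h \<odot>\<^bsub>H\<^esub> \<one>\<^bsub>H\<^esub> \<and>
        tensor_lift H (\<lambda>a b. a \<otimes>\<^bsub>H\<^esub> S b) (comult H h) = counit H h \<odot>\<^bsub>H\<^esub> \<one>\<^bsub>H\<^esub>)"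

definition hopf_algebra :: "('k::field, 'a, 'm) coalgebra_module_scheme \<Rightarrow> bool" where
  "hopf_algebra H \<longleftrightarrow> bialgebra H \<and> (\<exists>S. is_antipode H S)"

text \<open>Morphisms of Hopf algebras are the bialgebra maps; these automatically commute with the antipodes.\<close>

definition hopf_hom ::
  "('k::field, 'a, 'm) coalgebra_module_scheme \<Rightarrow> ('k, 'b, 'n) coalgebra_module_scheme \<Rightarrow> ('a \<Rightarrow> 'b) set" where
  "hopf_hom H K =
     {f \<in> algebra_hom H K. \<forall>h\<in>carrier H.
        comult K (f h) = tensor_map K K f f (comult H h) \<and> counit K (f h) = counit H h}"

definition hopf_isomorphic ::
  "('k::field, 'a, 'm) coalgebra_module_scheme \<Rightarrow> ('k, 'b, 'n) coalgebra_module_scheme \<Rightarrow> bool" where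
  "hopf_isomorphic H K \<longleftrightarrow> (\<exists>f\<in>hopf_hom H K. bij_betw f (carrier H) (carrier K))"


subsection \<open>The Hopf algebra \<open>A\<^sub>(\<^sub>q\<^sub>)\<close>\<close>

definition free_algebra :: "('k::field, 'g list \<Rightarrow>\<^sub>0 'k) module" where
  "free_algebra = monoid_algebra \<lparr>carrier = UNIV, mult = (@), one = []\<rparr>"

definition free_lift ::
  "('k::field, 'b, 'm) module_scheme \<Rightarrow> ('g \<Rightarrow> 'b) \<Rightarrow> ('g list \<Rightarrow>\<^sub>0 'k) \<Rightarrow> 'b" where
  "free_lift B \<phi> f = (\<Oplus>\<^bsub>B\<^esub>w\<in>Poly_Mapping.keys f.
     Poly_Mapping.lookup f w \<odot>\<^bsub>B\<^esub> foldr (\<lambda>s b. \<phi> s \<otimes>\<^bsub>B\<^esub> b) w \<one>\<^bsub>B\<^esub>)"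

datatype generator = Gen_g | Gen_x

text \<open>The relators of \<open>g\<^sup>2 = 1\<close>, \<open>x\<^sup>2\<^sup>p = q\<^sup>p\<^sup>-\<^sup>1 x\<^sup>2\<close> and \<open>x g = - g x\<close>; words are lists of generators.\<close>

definition A_ideal :: "nat \<Rightarrow> 'k::field \<Rightarrow> (generator list \<Rightarrow>\<^sub>0 'k) set" where
  "A_ideal p q = Idl\<^bsub>free_algebra\<^esub>
     {Poly_Mapping.single [Gen_g, Gen_g] 1 - Poly_Mapping.single [] 1,
      Poly_Mapping.single (replicate (2 * p) Gen_x) 1 - Poly_Mapping.single [Gen_x, Gen_x] (q ^ (p - 1)),
      Poly_Mapping.single [Gen_x, Gen_g] 1 + Poly_Mapping.single [Gen_g, Gen_x] 1}"

definition A_algebra :: "nat \<Rightarrow> 'k::field \<Rightarrow> ('k, (generator list \<Rightarrow>\<^sub>0 'k) set) module" where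
  "A_algebra p q = quot_algebra free_algebra (A_ideal p q)"

definition A_gen :: "nat \<Rightarrow> 'k::field \<Rightarrow> generator \<Rightarrow> (generator list \<Rightarrow>\<^sub>0 'k) set" where
  "A_gen p q s = A_ideal p q +>\<^bsub>free_algebra\<^esub> Poly_Mapping.single [s] 1"

text \<open>
  The comultiplication and counit are the algebra maps determined on the generators by
  \<open>\<Delta> g = g \<otimes> g\<close>, \<open>\<Delta> x = x \<otimes> 1 + g \<otimes> x\<close>, \<open>\<epsilon> g = 1\<close>, \<open>\<epsilon> x = 0\<close> (the values of \<open>\<epsilon>\<close> are forced by the
  counit axiom). They are evaluated on the representatives of a coset \<open>U\<close>, on which they are
  constant.
\<close>

fun A_comult_gen ::
  "nat \<Rightarrow> 'k::field \<Rightarrow> generator \<Rightarrow>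
     ((generator list \<Rightarrow>\<^sub>0 'k) set \<times> (generator list \<Rightarrow>\<^sub>0 'k) set \<Rightarrow>\<^sub>0 'k) set" where
  "A_comult_gen p q Gen_g =
     pure_tensor (A_algebra p q) (A_algebra p q) (A_gen p q Gen_g) (A_gen p q Gen_g)"
| "A_comult_gen p q Gen_x =
     pure_tensor (A_algebra p q) (A_algebra p q) (A_gen p q Gen_x) \<one>\<^bsub>A_algebra p q\<^esub>
       \<oplus>\<^bsub>tensor_algebra (A_algebra p q) (A_algebra p q)\<^esub>
     pure_tensor (A_algebra p q) (A_algebra p q) (A_gen p q Gen_g) (A_gen p q Gen_x)"

fun A_counit_gen :: "generator \<Rightarrow> 'k::field" where
  "A_counit_gen Gen_g = 1"
| "A_counit_gen Gen_x = 0"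

definition A_hopf :: "nat \<Rightarrow> 'k::field \<Rightarrow> ('k, (generator list \<Rightarrow>\<^sub>0 'k) set) coalgebra_module" where
  "A_hopf p q = module.extend (A_algebra p q) (coalgebra_module.fields
     (\<lambda>U. the_elem (free_lift (tensor_algebra (A_algebra p q) (A_algebra p q)) (A_comult_gen p q) ` U))
     (\<lambda>U. the_elem (free_lift scalar_algebra A_counit_gen ` U)))"


subsection \<open>The field of rational functions in countably many indeterminates\<close>

text \<open>
  Polynomials over \<open>\<F>\<^sub>p\<close> are finitely supported maps from monomials \<open>nat \<Rightarrow>\<^sub>0 nat\<close> to coefficients,
  where \<open>\<F>\<^sub>p\<close> is \<open>'p mod_ring\<close> with \<open>CARD('p) = p\<close>. The indeterminates \<open>X\<^sub>1, X\<^sub>2, \<dots>\<close> are stored at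
  the positions \<open>0, 1, \<dots>\<close>; \<open>indet i\<close> is meant for \<open>i \<ge> 1\<close> only.
\<close>

type_synonym 'p rat_funs = "((nat \<Rightarrow>\<^sub>0 nat) \<Rightarrow>\<^sub>0 'p mod_ring) fract"

definition indet :: "nat \<Rightarrow> 'p::prime_card rat_funs" where
  "indet i = Fract (Poly_Mapping.single (Poly_Mapping.single (i - 1) 1) 1) 1"

end

theory Submission
  imports Defs "HOL-Library.Product_Plus"
begin

text \<open>
  Write \<open>y = x\<^sup>2\<close>. The relation \<open>x g = - g x\<close> makes \<open>y\<close> commute with \<open>g\<close> and makes the mixed terms of
  \<open>\<Delta>(x)\<^sup>2\<close> cancel, so \<open>y\<close> is primitive. In characteristic \<open>p\<close> also \<open>y\<^sup>p\<close> is primitive, and therefore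
  \<open>y\<^sup>p = q\<^sup>p\<^sup>-\<^sup>1 y\<close> is compatible with \<open>\<Delta>\<close>. All structure maps of \<open>A\<^sub>(\<^sub>q\<^sub>)\<close> thus come from its universal property:
  \<open>\<Delta>\<close> and \<open>\<epsilon>\<close> as algebra maps, the antipode as an algebra map into the opposite algebra. The coalgebra
  axioms are equalities of algebra maps and are tested at \<open>g\<close> and \<open>x\<close>; the antipode law is propagated along words
  (\<open>conv_left_mult\<close>, \<open>conv_right_mult\<close>). This requires the universal property of tensor products of algebras
  (\<open>tensor_lift_lin\<close>, \<open>tensor_lift_pure\<close>, \<open>tensor_lift_algebra_hom\<close>).

  The monomials \<open>g\<^sup>k x\<^sup>j\<close> with \<open>k < 2\<close> and \<open>j < 2 p\<close> span because the relations rewrite every word (\<open>e_span\<close>), and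
  they are independent because \<open>A\<^sub>(\<^sub>q\<^sub>)\<close> acts on \<open>k[X]\<^sup>2\<close> in such a way that they move the vector \<open>(1, 0)\<close> to distinct
  basis vectors (\<open>coord_e\<close>). So the dimension is \<open>4 p\<close>.

  The \<open>A\<^sub>(\<^sub>q\<^sub>)\<close> are distinguished by means of their coalgebra structure. Contracting one leg of \<open>\<Delta>\<close> with the coefficient functionals of \<open>x\<close> and \<open>x\<^sup>2\<close> gives two nilpotent operators. They show that
  the only group-like elements with square \<open>1\<close> are \<open>1\<close> and \<open>g\<close> (\<open>grouplike_cases\<close>) and that the skew-primitive
  elements anticommuting with \<open>g\<close> are the multiples of \<open>x\<close> (\<open>anticommuting_skew_primitive\<close>). An isomorphism from
  \<open>A\<^sub>(\<^sub>q\<^sub>)\<close> to \<open>A\<^sub>(\<^sub>r\<^sub>)\<close> therefore sends \<open>x\<close> to \<open>s x\<close> for some \<open>s \<noteq> 0\<close>, and the relation for \<open>x\<^sup>2\<^sup>p\<close> forces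
  \<open>(s\<^sup>2 r)\<^sup>p\<^sup>-\<^sup>1 = q\<^sup>p\<^sup>-\<^sup>1\<close>. For \<open>q = X\<^sub>i\<close> and \<open>r = X\<^sub>j\<close> with \<open>i \<noteq> j\<close> this is impossible: comparing the exponents
  of \<open>X\<^sub>j\<close> in the leading monomials, the left-hand side has an odd multiple of \<open>p - 1\<close> and the right-hand side an
  even one (\<open>indet_not_power_square_multiple\<close>).
\<close>

section \<open>Unital algebras and linear maps\<close>

locale unital_alg =
  fixes A :: "('k::field, 'a, 'm) module_scheme" (structure)
  assumes unital_algebra: "unital_algebra A"
begin

sublocale ring A
  using unital_algebra by (simp add: unital_algebra_def)

sublocale vs: vectorspace class_ring A
  using unital_algebra by (simp add: unital_algebra_def)

lemma smult_in [simp, intro]: "a \<in> carrier A \<Longrightarrow> c \<odot> a \<in> carrier A"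
  using vs.smult_closed[of c a] by simp

lemma smult_add_scalar: "a \<in> carrier A \<Longrightarrow> (c + d) \<odot> a = c \<odot> a \<oplus> d \<odot> a"
  using vs.smult_l_distr[of c d a] by simp

lemma smult_add: "a \<in> carrier A \<Longrightarrow> b \<in> carrier A \<Longrightarrow> c \<odot> (a \<oplus> b) = c \<odot> a \<oplus> c \<odot> b"
  using vs.smult_r_distr[of c a b] by simp

lemma smult_smult: "a \<in> carrier A \<Longrightarrow> c \<odot> (d \<odot> a) = (c * d) \<odot> a"
  using vs.smult_assoc1[of c d a] by simp

lemma smult_1 [simp]: "a \<in> carrier A \<Longrightarrow> 1 \<odot> a = a"
  using vs.smult_one[of a] by simp

lemma smult_0 [simp]: "a \<in> carrier A \<Longrightarrow> 0 \<odot> a = \<zero>"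
  using vs.smult_l_null[of a] by simp

lemma smult_zero [simp]: "c \<odot> \<zero> = \<zero>"
  using vs.smult_r_null[of c] by simp

lemma smult_mult_left: "a \<in> carrier A \<Longrightarrow> b \<in> carrier A \<Longrightarrow> (c \<odot> a) \<otimes> b = c \<odot> (a \<otimes> b)"
  using unital_algebra by (simp add: unital_algebra_def)

lemma smult_mult_right: "a \<in> carrier A \<Longrightarrow> b \<in> carrier A \<Longrightarrow> a \<otimes> (c \<odot> b) = c \<odot> (a \<otimes> b)"
  using unital_algebra unfolding unital_algebra_def by metis

lemma smult_m1: "a \<in> carrier A \<Longrightarrow> (- 1) \<odot> a = \<ominus> a"
  using smult_add_scalar[of a 1 "- 1"] by (metis add.right_inverse minus_equality smult_0 smult_1 smult_in add.m_comm)

lemma smult_minus: "a \<in> carrier A \<Longrightarrow> c \<odot> (\<ominus> a) = \<ominus> (c \<odot> a)"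
  by (simp add: smult_smult mult.commute flip: smult_m1)

lemma neg_smult: "a \<in> carrier A \<Longrightarrow> (- c) \<odot> a = \<ominus> (c \<odot> a)"
  by (simp add: smult_smult flip: smult_m1)

lemma smult_pow: "a \<in> carrier A \<Longrightarrow> (c \<odot> a) [^] (n::nat) = c ^ n \<odot> a [^] n"
  by (induction n) (simp_all add: smult_mult_left smult_mult_right smult_smult mult.commute)

text \<open>Ideals of the underlying ring are automatically subspaces: scalars act through \<open>c \<odot> \<one>\<close>.\<close>

lemma ideal_smult_closed:
  assumes "ideal I A" "a \<in> I"
  shows "c \<odot> a \<in> I"
proof -
  have "a \<in> carrier A" using assms by (meson additive_subgroup.a_Hcarr ideal.axioms(1))
  then have "c \<odot> a = (c \<odot> \<one>) \<otimes> a" by (simp add: smult_mult_left)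
  then show ?thesis using assms by (simp add: ideal.I_l_closed)
qed

end

lemma unital_algebraI:
  fixes A :: "('k::field, 'a, 'm) module_scheme" (structure)
  assumes "ring A"
    and "\<And>c a. a \<in> carrier A \<Longrightarrow> c \<odot> a \<in> carrier A"
    and "\<And>c d a. a \<in> carrier A \<Longrightarrow> (c + d) \<odot> a = c \<odot> a \<oplus> d \<odot> a"
    and "\<And>c a b. a \<in> carrier A \<Longrightarrow> b \<in> carrier A \<Longrightarrow> c \<odot> (a \<oplus> b) = c \<odot> a \<oplus> c \<odot> b"
    and "\<And>c d a. a \<in> carrier A \<Longrightarrow> (c * d) \<odot> a = c \<odot> (d \<odot> a)"
    and "\<And>a. a \<in> carrier A \<Longrightarrow> 1 \<odot> a = a"
    and "\<And>c a b. a \<in> carrier A \<Longrightarrow> b \<in> carrier A \<Longrightarrow> c \<odot> (a \<otimes> b) = (c \<odot> a) \<otimes> b"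
    and "\<And>c a b. a \<in> carrier A \<Longrightarrow> b \<in> carrier A \<Longrightarrow> c \<odot> (a \<otimes> b) = a \<otimes> (c \<odot> b)"
  shows "unital_algebra A"
proof -
  interpret ring A by fact
  have "cring (class_ring :: 'k ring)" by (rule class_cring.is_cring)
  moreover have "abelian_group A" by (rule is_abelian_group)
  ultimately have "module class_ring A"
    using assms(2-6) by (intro moduleI) auto
  moreover have "Ring.field (class_ring :: 'k ring)" by (rule class_field.field_axioms)
  ultimately show ?thesis
    using assms(1,7,8) unfolding unital_algebra_def vectorspace_def by blast
qed

abbreviation lin where
  "lin A B \<equiv> LinearCombinations.module_hom class_ring A B"

abbreviation lspan where
  "lspan A \<equiv> LinearCombinations.module.span class_ring A"

lemma linI:
  assumes "\<And>a. a \<in> carrier A \<Longrightarrow> f a \<in> carrier B"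
    and "\<And>a b. a \<in> carrier A \<Longrightarrow> b \<in> carrier A \<Longrightarrow> f (a \<oplus>\<^bsub>A\<^esub> b) = f a \<oplus>\<^bsub>B\<^esub> f b"
    and "\<And>c a. a \<in> carrier A \<Longrightarrow> f (c \<odot>\<^bsub>A\<^esub> a) = c \<odot>\<^bsub>B\<^esub> f a"
  shows "f \<in> lin A B"
  using assms by (simp add: LinearCombinations.module_hom_def)

lemma
  assumes "f \<in> lin A B"
  shows lin_closed: "a \<in> carrier A \<Longrightarrow> f a \<in> carrier B"
    and lin_add: "a \<in> carrier A \<Longrightarrow> b \<in> carrier A \<Longrightarrow> f (a \<oplus>\<^bsub>A\<^esub> b) = f a \<oplus>\<^bsub>B\<^esub> f b"
    and lin_smult: "a \<in> carrier A \<Longrightarrow> f (c \<odot>\<^bsub>A\<^esub> a) = c \<odot>\<^bsub>B\<^esub> f a"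
  using assms by (auto simp: LinearCombinations.module_hom_def)

lemma lin_zero:
  assumes "f \<in> lin A B" "unital_algebra A" "unital_algebra B"
  shows "f \<zero>\<^bsub>A\<^esub> = \<zero>\<^bsub>B\<^esub>"
proof -
  interpret A: unital_alg A by (rule unital_alg.intro) fact
  interpret B: unital_alg B by (rule unital_alg.intro) fact
  have "f (0 \<odot>\<^bsub>A\<^esub> \<zero>\<^bsub>A\<^esub>) = 0 \<odot>\<^bsub>B\<^esub> f \<zero>\<^bsub>A\<^esub>" by (rule lin_smult[OF assms(1)]) simp
  then show ?thesis using lin_closed[OF assms(1)] by simp
qed

lemma lin_neg:
  assumes "f \<in> lin A B" "unital_algebra A" "unital_algebra B" "a \<in> carrier A"
  shows "f (\<ominus>\<^bsub>A\<^esub> a) = \<ominus>\<^bsub>B\<^esub> f a"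
proof -
  interpret A: unital_alg A by (rule unital_alg.intro) fact
  interpret B: unital_alg B by (rule unital_alg.intro) fact
  show ?thesis
    using lin_smult[OF assms(1,4), of "- 1"] lin_closed[OF assms(1,4)] assms(4)
    by (simp add: A.smult_m1 B.smult_m1)
qed

lemma lin_comp: "f \<in> lin A B \<Longrightarrow> h \<in> lin B C \<Longrightarrow> (\<lambda>a. h (f a)) \<in> lin A C"
  by (rule linI) (simp_all add: lin_closed lin_add lin_smult)

lemma lin_id: "(\<lambda>a. a) \<in> lin A A"
  by (rule linI) simp_all

lemma lin_mult_right:
  assumes "unital_algebra B" "f \<in> lin A B" "b \<in> carrier B"
  shows "(\<lambda>a. f a \<otimes>\<^bsub>B\<^esub> b) \<in> lin A B"
proof -
  interpret B: unital_alg B by (rule unital_alg.intro) fact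
  show ?thesis
    by (rule linI) (simp_all add: assms(3) lin_closed[OF assms(2)] lin_add[OF assms(2)]
        lin_smult[OF assms(2)] B.l_distr B.smult_mult_left)
qed

lemma lin_mult_left:
  assumes "unital_algebra B" "f \<in> lin A B" "b \<in> carrier B"
  shows "(\<lambda>a. b \<otimes>\<^bsub>B\<^esub> f a) \<in> lin A B"
proof -
  interpret B: unital_alg B by (rule unital_alg.intro) fact
  show ?thesis
    by (rule linI) (simp_all add: assms(3) lin_closed[OF assms(2)] lin_add[OF assms(2)]
        lin_smult[OF assms(2)] B.r_distr B.smult_mult_right)
qed

lemma lin_smult_const:
  assumes "unital_algebra B" "f \<in> lin A B"
  shows "(\<lambda>a. c \<odot>\<^bsub>B\<^esub> f a) \<in> lin A B"
proof -
  interpret B: unital_alg B by (rule unital_alg.intro) fact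
  show ?thesis
    by (rule linI) (simp_all add: lin_closed[OF assms(2)] lin_add[OF assms(2)]
        lin_smult[OF assms(2)] B.smult_add B.smult_smult mult.commute)
qed

lemma lin_add_fun:
  assumes "unital_algebra B" "f \<in> lin A B" "h \<in> lin A B"
  shows "(\<lambda>a. f a \<oplus>\<^bsub>B\<^esub> h a) \<in> lin A B"
proof -
  interpret B: unital_alg B by (rule unital_alg.intro) fact
  show ?thesis
    by (rule linI) (simp_all add: lin_closed[OF assms(2)] lin_add[OF assms(2)]
        lin_smult[OF assms(2)] lin_closed[OF assms(3)] lin_add[OF assms(3)]
        lin_smult[OF assms(3)] B.smult_add B.add.m_ac)
qed

context unital_alg
begin

lemma lspan_induct [consumes 2, case_names zero add smult gen]:
  assumes "x \<in> lspan A S" "S \<subseteq> carrier A"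
    and "P \<zero>"
    and "\<And>a b. a \<in> carrier A \<Longrightarrow> b \<in> carrier A \<Longrightarrow> P a \<Longrightarrow> P b \<Longrightarrow> P (a \<oplus> b)"
    and "\<And>c a. a \<in> carrier A \<Longrightarrow> P a \<Longrightarrow> P (c \<odot> a)"
    and "\<And>s. s \<in> S \<Longrightarrow> P s"
  shows "P x"
proof -
  have "LinearCombinations.submodule class_ring {a \<in> carrier A. P a} A"
    by (rule LinearCombinations.submodule.intro) (auto intro: assms(3-5) vs.module_axioms)
  then have "lspan A S \<subseteq> {a \<in> carrier A. P a}"
    using assms(2,6) by (intro vs.span_is_subset) auto
  then show ?thesis using assms(1) by blast
qed

lemma lspan_closed: "S \<subseteq> carrier A \<Longrightarrow> lspan A S \<subseteq> carrier A"
  by (rule vs.span_is_subset2)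

lemma lspan_gen: "S \<subseteq> carrier A \<Longrightarrow> s \<in> S \<Longrightarrow> s \<in> lspan A S"
  using vs.in_own_span by blast

lemma
  assumes "S \<subseteq> carrier A"
  shows lspan_zero: "\<zero> \<in> lspan A S"
    and lspan_add: "a \<in> lspan A S \<Longrightarrow> b \<in> lspan A S \<Longrightarrow> a \<oplus> b \<in> lspan A S"
    and lspan_smult: "a \<in> lspan A S \<Longrightarrow> c \<odot> a \<in> lspan A S"
proof -
  interpret s: LinearCombinations.submodule class_ring "lspan A S" A
    by (rule vs.span_is_submodule[OF assms])
  show "\<zero> \<in> lspan A S"
    using s.smult_closed s.m_closed s.zero_closed by blast
  show "a \<oplus> b \<in> lspan A S" if "a \<in> lspan A S" "b \<in> lspan A S" using that by (rule s.m_closed)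
  show "c \<odot> a \<in> lspan A S" if "a \<in> lspan A S" using that by (intro s.smult_closed) auto
qed

end

lemma lin_eqI:
  assumes "f \<in> lin A B" "h \<in> lin A B" "unital_algebra A" "unital_algebra B"
    and "S \<subseteq> carrier A" "x \<in> lspan A S" "\<And>s. s \<in> S \<Longrightarrow> f s = h s"
  shows "f x = h x"
proof -
  interpret A: unital_alg A by (rule unital_alg.intro) fact
  show ?thesis
    using assms(6,5)
    by (induction rule: A.lspan_induct)
      (simp_all add: lin_zero[OF _ assms(3,4)] assms(1,2,7) lin_add[OF assms(1)] lin_add[OF assms(2)]
        lin_smult[OF assms(1)] lin_smult[OF assms(2)])
qed

lemma lin_image_lspan:
  assumes "f \<in> lin A B" "unital_algebra A" "unital_algebra B" "S \<subseteq> carrier A" "x \<in> lspan A S"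
  shows "f x \<in> lspan B (f ` S)"
proof -
  interpret A: unital_alg A by (rule unital_alg.intro) fact
  interpret B: unital_alg B by (rule unital_alg.intro) fact
  have S: "f ` S \<subseteq> carrier B" using assms(4) lin_closed[OF assms(1)] by blast
  show ?thesis
    using assms(5,4)
    by (induction rule: A.lspan_induct)
      (simp_all add: lin_zero[OF assms(1-3)] lin_add[OF assms(1)] lin_smult[OF assms(1)]
        B.lspan_zero[OF S] B.lspan_add[OF S] B.lspan_smult[OF S] B.lspan_gen[OF S])
qed

lemma algebra_homI:
  assumes "f \<in> lin A B" "f \<one>\<^bsub>A\<^esub> = \<one>\<^bsub>B\<^esub>"
    and "\<And>a b. a \<in> carrier A \<Longrightarrow> b \<in> carrier A \<Longrightarrow> f (a \<otimes>\<^bsub>A\<^esub> b) = f a \<otimes>\<^bsub>B\<^esub> f b"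
  shows "f \<in> algebra_hom A B"
  unfolding algebra_hom_def using assms
  by (auto intro!: ring_hom_memI simp: lin_closed[OF assms(1)] lin_add[OF assms(1)])

lemma
  assumes "f \<in> algebra_hom A B"
  shows algebra_hom_lin: "f \<in> lin A B"
    and algebra_hom_one: "f \<one>\<^bsub>A\<^esub> = \<one>\<^bsub>B\<^esub>"
    and algebra_hom_mult:
      "a \<in> carrier A \<Longrightarrow> b \<in> carrier A \<Longrightarrow> f (a \<otimes>\<^bsub>A\<^esub> b) = f a \<otimes>\<^bsub>B\<^esub> f b"
    and algebra_hom_closed: "a \<in> carrier A \<Longrightarrow> f a \<in> carrier B"
  using assms by (auto simp: algebra_hom_def LinearCombinations.module_hom_def
      dest: Ring.ring_hom_one Ring.ring_hom_mult)

lemma algebra_hom_pow: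
  assumes "f \<in> algebra_hom A B" "unital_algebra A" "a \<in> carrier A"
  shows "f (a [^]\<^bsub>A\<^esub> (n::nat)) = f a [^]\<^bsub>B\<^esub> n"
proof -
  interpret A: unital_alg A by (rule unital_alg.intro) fact
  show ?thesis
    by (induction n) (simp_all add: algebra_hom_one[OF assms(1)] algebra_hom_mult[OF assms(1)] assms(3))
qed

text \<open>Multiplicativity is a bilinear identity, so a spanning set suffices to test it.\<close>

lemma algebra_homI_lspan:
  assumes f: "f \<in> lin A B" and A: "unital_algebra A" and B: "unital_algebra B"
    and S: "S \<subseteq> carrier A" "lspan A S = carrier A"
    and one: "f \<one>\<^bsub>A\<^esub> = \<one>\<^bsub>B\<^esub>"
    and mult: "\<And>s t. s \<in> S \<Longrightarrow> t \<in> S \<Longrightarrow> f (s \<otimes>\<^bsub>A\<^esub> t) = f s \<otimes>\<^bsub>B\<^esub> f t"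
  shows "f \<in> algebra_hom A B"
proof (rule algebra_homI[OF f one])
  interpret A: unital_alg A by (rule unital_alg.intro) fact
  have *: "f (s \<otimes>\<^bsub>A\<^esub> b) = f s \<otimes>\<^bsub>B\<^esub> f b" if "s \<in> S" "b \<in> carrier A" for s b
  proof (rule lin_eqI[OF _ _ A B S(1)])
    show "(\<lambda>b. f (s \<otimes>\<^bsub>A\<^esub> b)) \<in> lin A B"
      using that S by (intro lin_comp[OF lin_mult_left[OF A lin_id] f]) auto
    show "(\<lambda>b. f s \<otimes>\<^bsub>B\<^esub> f b) \<in> lin A B"
      using that S by (intro lin_mult_left[OF B f] lin_closed[OF f]) auto
  qed (use that S mult in auto)
  show "f (a \<otimes>\<^bsub>A\<^esub> b) = f a \<otimes>\<^bsub>B\<^esub> f b" if "a \<in> carrier A" "b \<in> carrier A" for a b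
  proof (rule lin_eqI[OF _ _ A B S(1), of "\<lambda>a. f (a \<otimes>\<^bsub>A\<^esub> b)"])
    show "(\<lambda>a. f (a \<otimes>\<^bsub>A\<^esub> b)) \<in> lin A B"
      using that by (intro lin_comp[OF lin_mult_right[OF A lin_id] f]) auto
    show "(\<lambda>a. f a \<otimes>\<^bsub>B\<^esub> f b) \<in> lin A B"
      using that by (intro lin_mult_right[OF B f] lin_closed[OF f]) auto
  qed (use that S * in auto)
qed

lemma algebra_hom_comp:
  "f \<in> algebra_hom A B \<Longrightarrow> h \<in> algebra_hom B C \<Longrightarrow> (\<lambda>a. h (f a)) \<in> algebra_hom A C"
  by (rule algebra_homI)
    (simp_all add: lin_comp[of f A B] algebra_hom_lin algebra_hom_one algebra_hom_mult algebra_hom_closed)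

lemma algebra_hom_id: "(\<lambda>a. a) \<in> algebra_hom A A"
  by (rule algebra_homI) (simp_all add: lin_id)

lemma scalar_algebra_simps [simp]:
  "carrier scalar_algebra = UNIV" "a \<otimes>\<^bsub>scalar_algebra\<^esub> b = a * b" "\<one>\<^bsub>scalar_algebra\<^esub> = 1"
  "\<zero>\<^bsub>scalar_algebra\<^esub> = 0" "a \<oplus>\<^bsub>scalar_algebra\<^esub> b = a + b" "c \<odot>\<^bsub>scalar_algebra\<^esub> a = c * a"
  by (simp_all add: scalar_algebra_def ring.extend_def module.fields_def)

lemma unital_algebra_scalar: "unital_algebra scalar_algebra"
proof (rule unital_algebraI)
  show "ring (scalar_algebra :: ('a, 'a) module)"
  proof (rule ringI)
    show "abelian_group (scalar_algebra :: ('a, 'a) module)"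
      by (rule abelian_groupI) (auto simp: algebra_simps intro: exI[of _ "- _"])
    show "Group.monoid (scalar_algebra :: ('a, 'a) module)"
      by (rule monoidI) (auto simp: algebra_simps)
  qed (auto simp: algebra_simps)
qed (auto simp: algebra_simps)

section \<open>Quotient algebras\<close>

lemma quot_algebra_simps [simp]:
  "carrier (quot_algebra A I) = a_rcosets\<^bsub>A\<^esub> I"
  "U \<otimes>\<^bsub>quot_algebra A I\<^esub> V = rcoset_mult A I U V"
  "\<one>\<^bsub>quot_algebra A I\<^esub> = I +>\<^bsub>A\<^esub> \<one>\<^bsub>A\<^esub>"
  "\<zero>\<^bsub>quot_algebra A I\<^esub> = I"
  "U \<oplus>\<^bsub>quot_algebra A I\<^esub> V = U <+>\<^bsub>A\<^esub> V"
  "c \<odot>\<^bsub>quot_algebra A I\<^esub> U = (\<Union>u\<in>U. I +>\<^bsub>A\<^esub> (c \<odot>\<^bsub>A\<^esub> u))"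
  by (simp_all add: quot_algebra_def FactRing_def ring.extend_def module.fields_def)

text \<open>\<open>quot_algebra A I\<close> is a larger record than \<open>A Quot I\<close>, so that the ring axioms are carried over
  one by one.\<close>

lemma ring_quot_algebra:
  assumes "ideal I A"
  shows "ring (quot_algebra A I)"
proof -
  interpret Q: ring "A Quot I" by (rule ideal.quotient_is_ring[OF assms])
  show ?thesis
  proof (rule ringI)
    show "abelian_group (quot_algebra A I)"
      by (rule abelian_groupI)
        (use Q.a_closed Q.a_assoc Q.a_comm Q.zero_closed Q.l_zero Q.add.l_inv_ex in \<open>simp_all add: FactRing_def\<close>)
    show "Group.monoid (quot_algebra A I)"
      by (rule monoidI)
        (use Q.m_closed Q.one_closed Q.m_assoc Q.l_one Q.r_one in \<open>simp_all add: FactRing_def\<close>)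
  qed (use Q.l_distr Q.r_distr in \<open>simp_all add: FactRing_def\<close>)
qed

context
  fixes A :: "('k::field, 'a, 'm) module_scheme" and I
  assumes A: "unital_algebra A" and I: "ideal I A"
begin

interpretation A: unital_alg A by (rule unital_alg.intro) (rule A)
interpretation I: ideal I A by (rule I)

private abbreviation "Q \<equiv> quot_algebra A I"

text \<open>The scalar action on a coset is a union over all its representatives; since \<open>I\<close> is a subspace, all
  members of that union are the same coset.\<close>

lemma coset_smult:
  assumes "a \<in> carrier A"
  shows "c \<odot>\<^bsub>Q\<^esub> (I +>\<^bsub>A\<^esub> a) = I +>\<^bsub>A\<^esub> (c \<odot>\<^bsub>A\<^esub> a)"
proof -
  have "I +>\<^bsub>A\<^esub> (c \<odot>\<^bsub>A\<^esub> u) = I +>\<^bsub>A\<^esub> (c \<odot>\<^bsub>A\<^esub> a)" if u: "u \<in> I +>\<^bsub>A\<^esub> a" for u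
  proof -
    obtain i where i: "i \<in> I" "u = i \<oplus>\<^bsub>A\<^esub> a" using u by (auto simp: a_r_coset_def')
    have "c \<odot>\<^bsub>A\<^esub> u = c \<odot>\<^bsub>A\<^esub> i \<oplus>\<^bsub>A\<^esub> c \<odot>\<^bsub>A\<^esub> a"
      using i assms by (simp add: A.smult_add)
    moreover have "c \<odot>\<^bsub>A\<^esub> i \<in> I" using A.ideal_smult_closed[OF I i(1)] .
    ultimately have "c \<odot>\<^bsub>A\<^esub> u \<in> I +>\<^bsub>A\<^esub> (c \<odot>\<^bsub>A\<^esub> a)" by (auto simp: a_r_coset_def r_coset_def)
    then show ?thesis using I.a_repr_independence' assms by (metis A.smult_in)
  qed
  moreover have "I +>\<^bsub>A\<^esub> a \<noteq> {}" using I.a_rcos_self[OF assms] by blast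
  ultimately have "(\<Union>u\<in>I +>\<^bsub>A\<^esub> a. I +>\<^bsub>A\<^esub> (c \<odot>\<^bsub>A\<^esub> u)) = I +>\<^bsub>A\<^esub> (c \<odot>\<^bsub>A\<^esub> a)"
    by (intro SUP_eq_const)
  then show ?thesis by simp
qed

lemma coset_add:
  "a \<in> carrier A \<Longrightarrow> b \<in> carrier A \<Longrightarrow>
    (I +>\<^bsub>A\<^esub> a) \<oplus>\<^bsub>Q\<^esub> (I +>\<^bsub>A\<^esub> b) = I +>\<^bsub>A\<^esub> (a \<oplus>\<^bsub>A\<^esub> b)"
  by (simp add: I.a_rcos_sum)

lemma coset_mult:
  "a \<in> carrier A \<Longrightarrow> b \<in> carrier A \<Longrightarrow>
    (I +>\<^bsub>A\<^esub> a) \<otimes>\<^bsub>Q\<^esub> (I +>\<^bsub>A\<^esub> b) = I +>\<^bsub>A\<^esub> (a \<otimes>\<^bsub>A\<^esub> b)"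
  by (simp add: I.rcoset_mult_add)

lemma coset_in: "a \<in> carrier A \<Longrightarrow> I +>\<^bsub>A\<^esub> a \<in> carrier (Q)"
  by (simp add: A_RCOSETS_defs a_r_coset_def r_coset_def) blast

lemma coset_cases:
  assumes "U \<in> carrier (Q)"
  obtains a where "a \<in> carrier A" "U = I +>\<^bsub>A\<^esub> a"
  using assms by (auto simp: A_RCOSETS_defs a_r_coset_def r_coset_def)

lemma unital_algebra_quot: "unital_algebra (Q)"
proof (rule unital_algebraI)
  interpret R: ring "Q" by (rule ring_quot_algebra) (rule I)
  show "ring (Q)" by (rule R.ring_axioms)
  note simps = coset_smult coset_add coset_mult coset_in A.smult_add_scalar A.smult_add
    A.smult_smult A.smult_mult_left A.smult_mult_right
  fix c d U V
  assume U: "U \<in> carrier (Q)"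
  obtain a where a: "a \<in> carrier A" "U = I +>\<^bsub>A\<^esub> a" by (rule coset_cases[OF U])
  show "c \<odot>\<^bsub>Q\<^esub> U \<in> carrier (Q)"
    "(c + d) \<odot>\<^bsub>Q\<^esub> U = c \<odot>\<^bsub>Q\<^esub> U \<oplus>\<^bsub>Q\<^esub> d \<odot>\<^bsub>Q\<^esub> U"
    "(c * d) \<odot>\<^bsub>Q\<^esub> U = c \<odot>\<^bsub>Q\<^esub> (d \<odot>\<^bsub>Q\<^esub> U)"
    "1 \<odot>\<^bsub>Q\<^esub> U = U"
    using a by (simp_all add: simps del: quot_algebra_simps)
  assume V: "V \<in> carrier (Q)"
  obtain b where b: "b \<in> carrier A" "V = I +>\<^bsub>A\<^esub> b" by (rule coset_cases[OF V])
  show "c \<odot>\<^bsub>Q\<^esub> (U \<oplus>\<^bsub>Q\<^esub> V) =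
      c \<odot>\<^bsub>Q\<^esub> U \<oplus>\<^bsub>Q\<^esub> c \<odot>\<^bsub>Q\<^esub> V"
    "c \<odot>\<^bsub>Q\<^esub> (U \<otimes>\<^bsub>Q\<^esub> V) = c \<odot>\<^bsub>Q\<^esub> U \<otimes>\<^bsub>Q\<^esub> V"
    "c \<odot>\<^bsub>Q\<^esub> (U \<otimes>\<^bsub>Q\<^esub> V) = U \<otimes>\<^bsub>Q\<^esub> (c \<odot>\<^bsub>Q\<^esub> V)"
    using a b by (simp_all add: simps del: quot_algebra_simps)
qed

lemma coset_algebra_hom: "(\<lambda>a. I +>\<^bsub>A\<^esub> a) \<in> algebra_hom A (Q)"
  by (intro algebra_homI linI)
    (simp_all add: coset_in coset_add coset_smult coset_mult del: quot_algebra_simps(1,2,4-6))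

lemma coset_eq_zero_iff: "a \<in> carrier A \<Longrightarrow> I +>\<^bsub>A\<^esub> a = \<zero>\<^bsub>Q\<^esub> \<longleftrightarrow> a \<in> I"
  using I.a_rcos_const I.a_rcos_self by auto

lemma coset_lspan:
  assumes S: "S \<subseteq> carrier A" "lspan A S = carrier A"
  shows "lspan (Q) ((\<lambda>a. I +>\<^bsub>A\<^esub> a) ` S) = carrier (Q)"
proof
  interpret R: unital_alg "Q" by (rule unital_alg.intro) (rule unital_algebra_quot)
  show "lspan (Q) ((\<lambda>a. I +>\<^bsub>A\<^esub> a) ` S) \<subseteq> carrier (Q)"
    using S by (intro R.lspan_closed) (use coset_in in blast)
  show "carrier (Q) \<subseteq> lspan (Q) ((\<lambda>a. I +>\<^bsub>A\<^esub> a) ` S)"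
    using lin_image_lspan[OF algebra_hom_lin[OF coset_algebra_hom] A unital_algebra_quot S(1)] S(2)
    by (auto elim!: coset_cases simp del: quot_algebra_simps)
qed

context
  fixes B :: "('k, 'b, 'n) module_scheme" and h
  assumes B: "unital_algebra B" and h: "h \<in> lin A B" and hI: "\<And>i. i \<in> I \<Longrightarrow> h i = \<zero>\<^bsub>B\<^esub>"
begin

interpretation B: unital_alg B by (rule unital_alg.intro) (rule B)

text \<open>A map that kills \<open>I\<close> is constant on each coset, so \<open>the_elem\<close> of the image of a coset is the value at
  any representative. This is the form in which the lifts of the tensor product and of \<open>A\<^sub>(\<^sub>q\<^sub>)\<close> are given.\<close>

lemma quot_lift:
  assumes "a \<in> carrier A"
  shows "the_elem (h ` (I +>\<^bsub>A\<^esub> a)) = h a"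
proof -
  have "h u = h a" if u: "u \<in> I +>\<^bsub>A\<^esub> a" for u
  proof -
    obtain i where i: "i \<in> I" "u = i \<oplus>\<^bsub>A\<^esub> a" using u by (auto simp: a_r_coset_def')
    then show ?thesis using assms by (simp add: lin_add[OF h] hI lin_closed[OF h])
  qed
  moreover have "a \<in> I +>\<^bsub>A\<^esub> a" using assms by (rule I.a_rcos_self)
  ultimately have "h ` (I +>\<^bsub>A\<^esub> a) = {h a}" by blast
  then show ?thesis by simp
qed

lemma quot_lift_lin: "(\<lambda>U. the_elem (h ` U)) \<in> lin (Q) B"
proof (rule linI)
  fix c U V
  assume U: "U \<in> carrier (Q)"
  obtain a where a: "a \<in> carrier A" "U = I +>\<^bsub>A\<^esub> a" by (rule coset_cases[OF U])
  show "the_elem (h ` U) \<in> carrier B"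
    "the_elem (h ` (c \<odot>\<^bsub>Q\<^esub> U)) = c \<odot>\<^bsub>B\<^esub> the_elem (h ` U)"
    using a by (simp_all add: quot_lift lin_closed[OF h] lin_smult[OF h] coset_smult del: quot_algebra_simps)
  assume V: "V \<in> carrier (Q)"
  obtain b where b: "b \<in> carrier A" "V = I +>\<^bsub>A\<^esub> b" by (rule coset_cases[OF V])
  show "the_elem (h ` (U \<oplus>\<^bsub>Q\<^esub> V)) = the_elem (h ` U) \<oplus>\<^bsub>B\<^esub> the_elem (h ` V)"
    using a b by (simp add: quot_lift lin_add[OF h] coset_add del: quot_algebra_simps)
qed

lemma quot_lift_algebra_hom:
  assumes "h \<in> algebra_hom A B"
  shows "(\<lambda>U. the_elem (h ` U)) \<in> algebra_hom (Q) B"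
proof (rule algebra_homI[OF quot_lift_lin])
  show "the_elem (h ` \<one>\<^bsub>Q\<^esub>) = \<one>\<^bsub>B\<^esub>"
    by (simp add: quot_lift algebra_hom_one[OF assms])
  fix U V
  assume "U \<in> carrier (Q)" "V \<in> carrier (Q)"
  then show "the_elem (h ` (U \<otimes>\<^bsub>Q\<^esub> V)) = the_elem (h ` U) \<otimes>\<^bsub>B\<^esub> the_elem (h ` V)"
    by (elim coset_cases) (simp add: quot_lift algebra_hom_mult[OF assms] coset_mult del: quot_algebra_simps)
qed

end

end

section \<open>Monoid algebras\<close>

abbreviation msingle :: "'x \<Rightarrow> 'k \<Rightarrow> ('x \<Rightarrow>\<^sub>0 'k::zero)" where
  "msingle \<equiv> Poly_Mapping.single"

abbreviation msupp :: "('x \<Rightarrow>\<^sub>0 'k::zero) \<Rightarrow> 'x set" where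
  "msupp \<equiv> Poly_Mapping.keys"

abbreviation mcoeff :: "('x \<Rightarrow>\<^sub>0 'k::zero) \<Rightarrow> 'x \<Rightarrow> 'k" where
  "mcoeff \<equiv> Poly_Mapping.lookup"

lemma lookup_map_times [simp]:
  "mcoeff (Poly_Mapping.map ((*) (c::'k::mult_zero)) f) u = c * mcoeff f u"
  by (simp add: Poly_Mapping.map.rep_eq when_def)

lemma keys_map_times: "msupp (Poly_Mapping.map ((*) (c::'k::mult_zero)) f) \<subseteq> msupp f"
  by (auto simp: in_keys_iff)

lemma monoid_algebra_simps [simp]:
  "carrier (monoid_algebra G) = {f. msupp f \<subseteq> carrier G}"
  "\<one>\<^bsub>monoid_algebra G\<^esub> = msingle \<one>\<^bsub>G\<^esub> 1"
  "\<zero>\<^bsub>monoid_algebra G\<^esub> = 0"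
  "f \<oplus>\<^bsub>monoid_algebra G\<^esub> h = f + h"
  "c \<odot>\<^bsub>monoid_algebra G\<^esub> f = Poly_Mapping.map ((*) c) f"
  by (simp_all add: monoid_algebra_def)

lemma poly_mapping_restricted_induct [consumes 1, case_names zero add]:
  fixes f :: "'x \<Rightarrow>\<^sub>0 'k::comm_monoid_add"
  assumes "msupp f \<subseteq> X"
    and "P 0"
    and "\<And>u c h. u \<in> X \<Longrightarrow> msupp h \<subseteq> X \<Longrightarrow> P h \<Longrightarrow> P (msingle u c + h)"
  shows "P f"
proof -
  have *: "P (\<Sum>u\<in>F. msingle u (g u)) \<and> msupp (\<Sum>u\<in>F. msingle u (g u)) \<subseteq> X"
    if "finite F" "F \<subseteq> X" for F and g :: "'x \<Rightarrow> 'k"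
    using that
  proof (induction F rule: finite_induct)
    case (insert u F)
    have "msupp (msingle u (g u) + (\<Sum>u\<in>F. msingle u (g u))) \<subseteq> X"
      using insert Poly_Mapping.keys_add[of "msingle u (g u)" "\<Sum>u\<in>F. msingle u (g u)"] by (auto split: if_splits)
    then show ?case using insert assms(3) by simp
  qed (simp add: assms(2))
  have "f = (\<Sum>u\<in>msupp f. msingle u (mcoeff f u))"
    by (rule poly_mapping_eqI)
      (simp add: lookup_sum lookup_single when_def in_keys_iff)
  with *[of "msupp f" "mcoeff f"] assms(1) show ?thesis by simp
qed

text \<open>Products are convolutions over the exact supports, and the support of a sum is not the union of the
  supports. Allowing larger finite index sets makes distributivity a rearrangement of finite sums.\<close>

lemma monoid_algebra_mult_superset:
  assumes "finite S" "msupp f \<subseteq> S" "finite T" "msupp h \<subseteq> T"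
  shows "f \<otimes>\<^bsub>monoid_algebra G\<^esub> h =
    (\<Sum>u\<in>S. \<Sum>v\<in>T. msingle (u \<otimes>\<^bsub>G\<^esub> v) (mcoeff f u * mcoeff h v))"
proof -
  have "f \<otimes>\<^bsub>monoid_algebra G\<^esub> h = (\<Sum>u\<in>msupp f. \<Sum>v\<in>msupp h.
      msingle (u \<otimes>\<^bsub>G\<^esub> v) (mcoeff f u * mcoeff h v))"
    by (simp add: monoid_algebra_def)
  also have "\<dots> = (\<Sum>u\<in>S. \<Sum>v\<in>msupp h.
      msingle (u \<otimes>\<^bsub>G\<^esub> v) (mcoeff f u * mcoeff h v))"
    by (rule sum.mono_neutral_left) (use assms in \<open>auto simp: in_keys_iff\<close>)
  also have "\<dots> = (\<Sum>u\<in>S. \<Sum>v\<in>T. msingle (u \<otimes>\<^bsub>G\<^esub> v) (mcoeff f u * mcoeff h v))"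
    by (intro sum.cong refl sum.mono_neutral_left) (use assms in \<open>auto simp: in_keys_iff\<close>)
  finally show ?thesis .
qed

lemma monoid_algebra_mult_single:
  "msingle u c \<otimes>\<^bsub>monoid_algebra G\<^esub> msingle v d = msingle (u \<otimes>\<^bsub>G\<^esub> v) (c * d)"
  using monoid_algebra_mult_superset[of "{u}" "msingle u c" "{v}" "msingle v d" G] by simp

lemma
  shows monoid_algebra_mult_0_left: "0 \<otimes>\<^bsub>monoid_algebra G\<^esub> h = 0"
    and monoid_algebra_mult_0_right: "h \<otimes>\<^bsub>monoid_algebra G\<^esub> 0 = 0"
  by (simp_all add: monoid_algebra_def)

lemma monoid_algebra_add_mult:
  "(f + f') \<otimes>\<^bsub>monoid_algebra G\<^esub> h = f \<otimes>\<^bsub>monoid_algebra G\<^esub> h + f' \<otimes>\<^bsub>monoid_algebra G\<^esub> h"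
proof -
  let ?S = "msupp f \<union> msupp f'" and ?T = "msupp h"
  show ?thesis
    using Poly_Mapping.keys_add[of f f']
    by (subst (1 2 3) monoid_algebra_mult_superset[of ?S _ ?T])
      (simp_all add: lookup_add distrib_right single_add sum.distrib)
qed

lemma monoid_algebra_mult_add:
  "h \<otimes>\<^bsub>monoid_algebra G\<^esub> (f + f') = h \<otimes>\<^bsub>monoid_algebra G\<^esub> f + h \<otimes>\<^bsub>monoid_algebra G\<^esub> f'"
proof -
  let ?S = "msupp f \<union> msupp f'" and ?T = "msupp h"
  show ?thesis
    using Poly_Mapping.keys_add[of f f']
    by (subst (1 2 3) monoid_algebra_mult_superset[of ?T _ ?S])
      (simp_all add: lookup_add distrib_left single_add sum.distrib)
qed

lemma map_times_add: "Poly_Mapping.map ((*) (c::'k::field)) (f + h) =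
    Poly_Mapping.map ((*) c) f + Poly_Mapping.map ((*) c) h"
  by (rule poly_mapping_eqI) (simp add: lookup_add distrib_left)

lemma map_times_single: "Poly_Mapping.map ((*) (c::'k::field)) (msingle u d) = msingle u (c * d)"
  by (rule poly_mapping_eqI) (simp add: lookup_single when_def)

lemma keys_single_add: "u \<in> X \<Longrightarrow> msupp h \<subseteq> X \<Longrightarrow> msupp (msingle u c + h) \<subseteq> X"
  using Poly_Mapping.keys_add[of "msingle u c" h] by (auto split: if_splits)

context
  fixes G :: "('g, 'z) monoid_scheme"
  assumes G: "Group.monoid G"
begin

interpretation G: Group.monoid G by (rule G)

private abbreviation "MA \<equiv> monoid_algebra G :: ('k::field, 'g \<Rightarrow>\<^sub>0 'k) module"

lemma monoid_algebra_mult_closed: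
  assumes "msupp (f :: 'g \<Rightarrow>\<^sub>0 'k::field) \<subseteq> carrier G" "msupp h \<subseteq> carrier G"
  shows "msupp (f \<otimes>\<^bsub>MA\<^esub> h) \<subseteq> carrier G"
proof -
  have "msupp (msingle u c \<otimes>\<^bsub>MA\<^esub> h) \<subseteq> carrier G" if "u \<in> carrier G" for u c
    using assms(2)
  proof (induction rule: poly_mapping_restricted_induct)
    case (add v d h)
    then show ?case using that
      by (simp add: monoid_algebra_mult_add monoid_algebra_mult_single keys_single_add)
  qed (simp add: monoid_algebra_mult_0_right)
  note * = this
  show ?thesis
    using assms(1)
  proof (induction rule: poly_mapping_restricted_induct)
    case (add u c f)
    then show ?case using *[OF add(1), of c] Poly_Mapping.keys_add[of "msingle u c \<otimes>\<^bsub>MA\<^esub> h" "f \<otimes>\<^bsub>MA\<^esub> h"]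
      by (auto simp add: monoid_algebra_add_mult)
  qed (simp add: monoid_algebra_mult_0_left)
qed

lemma monoid_algebra_mult_assoc:
  assumes "msupp (f1 :: 'g \<Rightarrow>\<^sub>0 'k::field) \<subseteq> carrier G"
    "msupp f2 \<subseteq> carrier G" "msupp f3 \<subseteq> carrier G"
  shows "(f1 \<otimes>\<^bsub>MA\<^esub> f2) \<otimes>\<^bsub>MA\<^esub> f3 = f1 \<otimes>\<^bsub>MA\<^esub> (f2 \<otimes>\<^bsub>MA\<^esub> f3)"
proof -
  note simps = monoid_algebra_mult_add monoid_algebra_add_mult monoid_algebra_mult_single
    monoid_algebra_mult_0_right monoid_algebra_mult_0_left
  have 1: "(msingle u c \<otimes>\<^bsub>MA\<^esub> msingle v d) \<otimes>\<^bsub>MA\<^esub> f3 = msingle u c \<otimes>\<^bsub>MA\<^esub> (msingle v d \<otimes>\<^bsub>MA\<^esub> f3)"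
    if "u \<in> carrier G" "v \<in> carrier G" for u v c d
    using assms(3)
    by (induction rule: poly_mapping_restricted_induct) (use that in \<open>simp_all add: simps G.m_assoc mult.assoc\<close>)
  have 2: "(msingle u c \<otimes>\<^bsub>MA\<^esub> f2) \<otimes>\<^bsub>MA\<^esub> f3 = msingle u c \<otimes>\<^bsub>MA\<^esub> (f2 \<otimes>\<^bsub>MA\<^esub> f3)" if "u \<in> carrier G" for u c
    using assms(2)
    by (induction rule: poly_mapping_restricted_induct) (use that 1 in \<open>simp_all add: simps\<close>)
  show ?thesis
    using assms(1)
    by (induction rule: poly_mapping_restricted_induct) (use 2 in \<open>simp_all add: simps\<close>)
qed

lemma monoid_algebra_smult_mult:
  assumes "msupp (f :: 'g \<Rightarrow>\<^sub>0 'k::field) \<subseteq> carrier G" "msupp h \<subseteq> carrier G"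
  shows "Poly_Mapping.map ((*) c) (f \<otimes>\<^bsub>MA\<^esub> h) = Poly_Mapping.map ((*) c) f \<otimes>\<^bsub>MA\<^esub> h"
    and "Poly_Mapping.map ((*) c) (f \<otimes>\<^bsub>MA\<^esub> h) = f \<otimes>\<^bsub>MA\<^esub> Poly_Mapping.map ((*) c) h"
proof -
  have m0: "Poly_Mapping.map ((*) c) 0 = (0 :: 'g \<Rightarrow>\<^sub>0 'k)" for c
    by (rule poly_mapping_eqI) simp
  note simps = monoid_algebra_mult_add monoid_algebra_add_mult monoid_algebra_mult_single
    monoid_algebra_mult_0_right monoid_algebra_mult_0_left map_times_add map_times_single m0
  have 1: "Poly_Mapping.map ((*) c) (msingle u d \<otimes>\<^bsub>MA\<^esub> h) = msingle u (c * d) \<otimes>\<^bsub>MA\<^esub> h"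
    "Poly_Mapping.map ((*) c) (msingle u d \<otimes>\<^bsub>MA\<^esub> h) = msingle u d \<otimes>\<^bsub>MA\<^esub> Poly_Mapping.map ((*) c) h" for u d
    using assms(2)
    by (induction rule: poly_mapping_restricted_induct) (simp_all add: simps mult_ac)
  show "Poly_Mapping.map ((*) c) (f \<otimes>\<^bsub>MA\<^esub> h) = Poly_Mapping.map ((*) c) f \<otimes>\<^bsub>MA\<^esub> h"
    using assms(1)
    by (induction rule: poly_mapping_restricted_induct) (simp_all add: simps 1(1))
  show "Poly_Mapping.map ((*) c) (f \<otimes>\<^bsub>MA\<^esub> h) = f \<otimes>\<^bsub>MA\<^esub> Poly_Mapping.map ((*) c) h"
    using assms(1)
    by (induction rule: poly_mapping_restricted_induct) (simp_all add: simps 1(2))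
qed

lemma unital_algebra_monoid_algebra: "unital_algebra (monoid_algebra G :: ('k::field, 'g \<Rightarrow>\<^sub>0 'k) module)"
proof (rule unital_algebraI)
  note simps = monoid_algebra_mult_add monoid_algebra_add_mult monoid_algebra_mult_single
    monoid_algebra_mult_0_right monoid_algebra_mult_0_left
  show "ring (MA :: ('k::field, 'g \<Rightarrow>\<^sub>0 'k) module)"
  proof (rule ringI)
    show "abelian_group (MA :: ('k::field, 'g \<Rightarrow>\<^sub>0 'k) module)"
    proof (rule abelian_groupI)
      fix f :: "'g \<Rightarrow>\<^sub>0 'k" assume "f \<in> carrier MA"
      then show "\<exists>h\<in>carrier MA. h \<oplus>\<^bsub>MA\<^esub> f = \<zero>\<^bsub>MA\<^esub>"
        by (intro bexI[of _ "- f"]) auto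
    qed (use Poly_Mapping.keys_add in \<open>fastforce simp: algebra_simps\<close>)+
    show "Group.monoid (MA :: ('k::field, 'g \<Rightarrow>\<^sub>0 'k) module)"
    proof (rule monoidI)
      fix f :: "'g \<Rightarrow>\<^sub>0 'k" assume "f \<in> carrier MA"
      then have f: "msupp f \<subseteq> carrier G" by simp
      then show "\<one>\<^bsub>MA\<^esub> \<otimes>\<^bsub>MA\<^esub> f = f"
        by (induction rule: poly_mapping_restricted_induct) (simp_all add: simps)
      show "f \<otimes>\<^bsub>MA\<^esub> \<one>\<^bsub>MA\<^esub> = f"
        using f by (induction rule: poly_mapping_restricted_induct) (simp_all add: simps)
    qed (auto simp: monoid_algebra_mult_closed monoid_algebra_mult_assoc dest: monoid_algebra_mult_closed[THEN subsetD, rotated 2])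
  qed (simp_all add: simps)
  show "c \<odot>\<^bsub>MA\<^esub> f \<in> carrier MA" if "f \<in> carrier MA" for c :: 'k and f
    using that keys_map_times[of c f] by auto
qed (auto simp: monoid_algebra_smult_mult(1) monoid_algebra_smult_mult(2)[symmetric]
    intro!: poly_mapping_eqI simp: lookup_add algebra_simps)

lemma single_in_monoid_algebra: "u \<in> carrier G \<Longrightarrow> msingle u c \<in> carrier MA"
  by (auto split: if_splits)

lemma monoid_algebra_lspan:
  "lspan MA ((\<lambda>u. msingle u 1) ` carrier G) = carrier (MA :: ('k::field, 'g \<Rightarrow>\<^sub>0 'k) module)"
proof
  interpret M: unital_alg "MA :: ('k::field, 'g \<Rightarrow>\<^sub>0 'k) module"
    by (rule unital_alg.intro) (rule unital_algebra_monoid_algebra)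
  let ?S = "(\<lambda>u. msingle u 1) ` carrier G :: ('g \<Rightarrow>\<^sub>0 'k) set"
  have S: "?S \<subseteq> carrier MA" by auto
  show "lspan MA ?S \<subseteq> carrier MA" by (rule M.lspan_closed) (rule S)
  show "carrier MA \<subseteq> lspan MA ?S"
  proof
    fix f assume "f \<in> carrier (MA :: ('k::field, 'g \<Rightarrow>\<^sub>0 'k) module)"
    then have "msupp f \<subseteq> carrier G" by simp
    then show "f \<in> lspan MA ?S"
    proof (induction rule: poly_mapping_restricted_induct)
      case zero
      show ?case using M.lspan_zero[OF S] by simp
    next
      case (add u c h)
      have "msingle u 1 \<in> lspan MA ?S" using add by (intro M.lspan_gen[OF S]) auto
      from M.lspan_add[OF S M.lspan_smult[OF S this, of c] add(3)]
      show ?case by (simp add: map_times_single)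
    qed
  qed
qed

end

subsection \<open>Linear extension from a basis\<close>

text \<open>Both the lift of a bilinear map to a tensor product and the lift from a free algebra are instances of
  this linear extension.\<close>

definition linext :: "('k::field, 'c, 'm) module_scheme \<Rightarrow> ('x \<Rightarrow> 'c) \<Rightarrow> ('x \<Rightarrow>\<^sub>0 'k) \<Rightarrow> 'c" where
  "linext C \<beta> f = (\<Oplus>\<^bsub>C\<^esub>u\<in>msupp f. mcoeff f u \<odot>\<^bsub>C\<^esub> \<beta> u)"

context
  fixes C :: "('k::field, 'c, 'm) module_scheme" and \<beta> :: "'x \<Rightarrow> 'c" and X :: "'x set"
  assumes C: "unital_algebra C" and \<beta>: "\<And>u. u \<in> X \<Longrightarrow> \<beta> u \<in> carrier C"
begin

interpretation C: unital_alg C by (rule unital_alg.intro) (rule C)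

lemma linext_superset:
  assumes "finite S" "msupp f \<subseteq> S" "S \<subseteq> X"
  shows "linext C \<beta> f = (\<Oplus>\<^bsub>C\<^esub>u\<in>S. mcoeff f u \<odot>\<^bsub>C\<^esub> \<beta> u)"
  unfolding linext_def
  by (rule C.add.finprod_mono_neutral_cong_left) (use assms \<beta> in \<open>auto simp: in_keys_iff\<close>)

lemma linext_closed: "msupp f \<subseteq> X \<Longrightarrow> linext C \<beta> f \<in> carrier C"
  unfolding linext_def by (intro C.finsum_closed) (use \<beta> in auto)

lemma linext_add:
  assumes "msupp f \<subseteq> X" "msupp h \<subseteq> X"
  shows "linext C \<beta> (f + h) = linext C \<beta> f \<oplus>\<^bsub>C\<^esub> linext C \<beta> h"
proof -
  let ?S = "msupp f \<union> msupp h"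
  have "linext C \<beta> (f + h) = (\<Oplus>\<^bsub>C\<^esub>u\<in>?S. mcoeff (f + h) u \<odot>\<^bsub>C\<^esub> \<beta> u)"
    using assms Poly_Mapping.keys_add[of f h] by (intro linext_superset) auto
  also have "\<dots> = (\<Oplus>\<^bsub>C\<^esub>u\<in>?S. mcoeff f u \<odot>\<^bsub>C\<^esub> \<beta> u \<oplus>\<^bsub>C\<^esub> mcoeff h u \<odot>\<^bsub>C\<^esub> \<beta> u)"
    by (rule C.add.finprod_cong') (use assms \<beta> in \<open>auto simp: lookup_add C.smult_add_scalar\<close>)
  also have "\<dots> = (\<Oplus>\<^bsub>C\<^esub>u\<in>?S. mcoeff f u \<odot>\<^bsub>C\<^esub> \<beta> u) \<oplus>\<^bsub>C\<^esub> (\<Oplus>\<^bsub>C\<^esub>u\<in>?S. mcoeff h u \<odot>\<^bsub>C\<^esub> \<beta> u)"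
    by (rule C.finsum_addf) (use assms \<beta> in auto)
  also have "\<dots> = linext C \<beta> f \<oplus>\<^bsub>C\<^esub> linext C \<beta> h"
    using assms by (simp add: linext_superset[of ?S])
  finally show ?thesis .
qed

lemma linext_single: "u \<in> X \<Longrightarrow> linext C \<beta> (msingle u c) = c \<odot>\<^bsub>C\<^esub> \<beta> u"
  using linext_superset[of "{u}" "msingle u c"] \<beta>[of u] by (simp split: if_splits)

lemma linext_smult:
  assumes "msupp f \<subseteq> X"
  shows "linext C \<beta> (Poly_Mapping.map ((*) c) f) = c \<odot>\<^bsub>C\<^esub> linext C \<beta> f"
  using assms
proof (induction rule: poly_mapping_restricted_induct)
  case zero
  have "Poly_Mapping.map ((*) c) 0 = (0 :: 'x \<Rightarrow>\<^sub>0 'k)" by (rule poly_mapping_eqI) simp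
  then show ?case by (simp add: linext_def)
next
  case (add u d h)
  have k: "msupp (msingle u e) \<subseteq> X" for e :: 'k using add by auto
  have "msupp (Poly_Mapping.map ((*) c) h) \<subseteq> X" using keys_map_times[of c h] add by blast
  then show ?case using add \<beta>
    by (simp add: map_times_add map_times_single linext_add k linext_single linext_closed
        C.smult_add C.smult_smult)
qed

end

lemma linext_lin:
  assumes "unital_algebra C" "\<And>u. u \<in> carrier G \<Longrightarrow> \<beta> u \<in> carrier C"
  shows "linext C \<beta> \<in> lin (monoid_algebra G) C"
  by (rule linI) (simp_all add: linext_closed[of C "carrier G"] linext_add[of C "carrier G"]
      linext_smult[of C "carrier G"] assms)

lemma linext_algebra_hom:
  assumes G: "Group.monoid G" and C: "unital_algebra C" and \<beta>: "\<And>u. u \<in> carrier G \<Longrightarrow> \<beta> u \<in> carrier C"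
    and "\<beta> \<one>\<^bsub>G\<^esub> = \<one>\<^bsub>C\<^esub>"
    and "\<And>u v. u \<in> carrier G \<Longrightarrow> v \<in> carrier G \<Longrightarrow> \<beta> (u \<otimes>\<^bsub>G\<^esub> v) = \<beta> u \<otimes>\<^bsub>C\<^esub> \<beta> v"
  shows "linext C \<beta> \<in> algebra_hom (monoid_algebra G) C"
proof (rule algebra_homI_lspan[OF linext_lin[OF C \<beta>] unital_algebra_monoid_algebra[OF G] C
      _ monoid_algebra_lspan[OF G]])
  interpret G: Group.monoid G by (rule G)
  interpret C: unital_alg C by (rule unital_alg.intro) (rule C)
  note single = linext_single[of C "carrier G" \<beta>, OF C \<beta>]
  show "linext C \<beta> \<one>\<^bsub>monoid_algebra G\<^esub> = \<one>\<^bsub>C\<^esub>" by (simp add: single assms(4))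
  show "linext C \<beta> (s \<otimes>\<^bsub>monoid_algebra G\<^esub> t) = linext C \<beta> s \<otimes>\<^bsub>C\<^esub> linext C \<beta> t"
    if "s \<in> (\<lambda>u. msingle u 1) ` carrier G" "t \<in> (\<lambda>u. msingle u 1) ` carrier G" for s t
    using that by (auto simp: monoid_algebra_mult_single single \<beta> assms(5))
qed auto

lemma lin_monoid_algebra_diff:
  assumes "unital_algebra C" "F \<in> lin (monoid_algebra G) C"
    and f: "f \<in> carrier (monoid_algebra G)" and h: "h \<in> carrier (monoid_algebra G)"
  shows "F (f - h) = F f \<ominus>\<^bsub>C\<^esub> F h"
proof -
  interpret C: unital_alg C by (rule unital_alg.intro) fact
  have d: "f - h \<in> carrier (monoid_algebra G)"
    using f h by (auto dest: subsetD[OF Poly_Mapping.keys_diff])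
  have "F f = F (f - h) \<oplus>\<^bsub>C\<^esub> F h" using lin_add[OF assms(2) d h] by simp
  then show ?thesis
    using lin_closed[OF assms(2) d] lin_closed[OF assms(2) h] by (simp add: a_minus_def C.a_assoc C.r_neg)
qed

section \<open>Tensor products of algebras\<close>

text \<open>Stability of a span under multiplication is a bilinear condition, so it may be tested on generators
  of the span and of the algebra.\<close>

lemma (in unital_alg) ideal_lspan:
  assumes S: "S \<subseteq> carrier A" and T: "T \<subseteq> carrier A" "lspan A T = carrier A"
    and left: "\<And>s t. s \<in> S \<Longrightarrow> t \<in> T \<Longrightarrow> t \<otimes> s \<in> lspan A S"
    and right: "\<And>s t. s \<in> S \<Longrightarrow> t \<in> T \<Longrightarrow> s \<otimes> t \<in> lspan A S"
  shows "ideal (lspan A S) A"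
proof (rule idealI)
  show "ring A" by (rule ring_axioms)
  note lspan = lspan_zero[OF S] lspan_add[OF S] lspan_smult[OF S]
  note closed = subsetD[OF lspan_closed[OF S]]
  show "subgroup (lspan A S) (add_monoid A)"
  proof (rule add.subgroupI)
    show "lspan A S \<subseteq> carrier A" by (rule lspan_closed[OF S])
    show "lspan A S \<noteq> {}" using lspan(1) by blast
    show "\<ominus> a \<in> lspan A S" if "a \<in> lspan A S" for a
      using lspan(3)[OF that, of "- 1"] closed[OF that] by (simp add: smult_m1)
  qed (rule lspan(2))
  have 1: "t \<otimes> a \<in> lspan A S" "a \<otimes> t \<in> lspan A S" if "a \<in> lspan A S" "t \<in> T" for a t
  proof -
    have t: "t \<in> carrier A" using that T by blast
    show "t \<otimes> a \<in> lspan A S"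
      using that(1) S
      by (induction rule: lspan_induct) (simp_all add: lspan r_distr smult_mult_right left t that(2))
    show "a \<otimes> t \<in> lspan A S"
      using that(1) S
      by (induction rule: lspan_induct) (simp_all add: lspan l_distr smult_mult_left right t that(2))
  qed
  fix a x
  assume a: "a \<in> lspan A S" and "x \<in> carrier A"
  then have x: "x \<in> lspan A T" using T by simp
  show "x \<otimes> a \<in> lspan A S"
    using x T(1) by (induction rule: lspan_induct) (simp_all add: lspan l_distr smult_mult_left closed a 1)
  show "a \<otimes> x \<in> lspan A S"
    using x T(1) by (induction rule: lspan_induct) (simp_all add: lspan r_distr smult_mult_right closed a 1)
qed

definition bilin ::
  "('k::field, 'a, 'm) module_scheme \<Rightarrow> ('k, 'b, 'n) module_scheme \<Rightarrow> ('k, 'c, 'l) module_scheme \<Rightarrow>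
    ('a \<Rightarrow> 'b \<Rightarrow> 'c) \<Rightarrow> bool" where
  "bilin A B C \<beta> \<longleftrightarrow>
    (\<forall>b\<in>carrier B. (\<lambda>a. \<beta> a b) \<in> lin A C) \<and> (\<forall>a\<in>carrier A. (\<lambda>b. \<beta> a b) \<in> lin B C)"

lemma bilinI:
  assumes "\<And>b. b \<in> carrier B \<Longrightarrow> (\<lambda>a. \<beta> a b) \<in> lin A C"
    and "\<And>a. a \<in> carrier A \<Longrightarrow> (\<lambda>b. \<beta> a b) \<in> lin B C"
  shows "bilin A B C \<beta>"
  using assms by (simp add: bilin_def)

lemma
  assumes "bilin A B C \<beta>"
  shows bilin_left: "b \<in> carrier B \<Longrightarrow> (\<lambda>a. \<beta> a b) \<in> lin A C"
    and bilin_right: "a \<in> carrier A \<Longrightarrow> (\<lambda>b. \<beta> a b) \<in> lin B C"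
  using assms by (simp_all add: bilin_def)

lemma bilin_closed: "bilin A B C \<beta> \<Longrightarrow> a \<in> carrier A \<Longrightarrow> b \<in> carrier B \<Longrightarrow> \<beta> a b \<in> carrier C"
  using lin_closed bilin_left by fast

lemma bilin_comp:
  assumes "bilin A' B' C \<beta>" "f \<in> lin A A'" "h \<in> lin B B'"
  shows "bilin A B C (\<lambda>a b. \<beta> (f a) (h b))"
  by (rule bilinI)
    (use lin_comp[OF assms(2) bilin_left[OF assms(1)]] lin_comp[OF assms(3) bilin_right[OF assms(1)]]
      lin_closed[OF assms(2)] lin_closed[OF assms(3)] in auto)

lemma bilin_mult: "unital_algebra A \<Longrightarrow> bilin A A A (\<lambda>a b. a \<otimes>\<^bsub>A\<^esub> b)"
  by (intro bilinI lin_mult_left lin_mult_right lin_id)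

context
  fixes A :: "('k::field, 'a, 'm) module_scheme" and B :: "('k, 'b, 'n) module_scheme"
  assumes A: "unital_algebra A" and B: "unital_algebra B"
begin

interpretation A: unital_alg A by (rule unital_alg.intro) (rule A)
interpretation B: unital_alg B by (rule unital_alg.intro) (rule B)

private abbreviation "AB \<equiv> A \<times>\<times> B"
private abbreviation "MAB \<equiv> monoid_algebra AB :: ('k, 'a \<times> 'b \<Rightarrow>\<^sub>0 'k) module"
private abbreviation "T \<equiv> tensor_algebra A B"

lemma monoid_AB: "Group.monoid AB"
  by (rule DirProd_monoid[OF A.monoid_axioms B.monoid_axioms])

interpretation M: unital_alg MAB
  by (rule unital_alg.intro) (rule unital_algebra_monoid_algebra[OF monoid_AB])

lemma single_pair_in: "a \<in> carrier A \<Longrightarrow> b \<in> carrier B \<Longrightarrow> msingle (a, b) c \<in> carrier MAB"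
  by (rule single_in_monoid_algebra[OF monoid_AB]) simp

lemma monoid_algebra_minus: "f \<in> carrier MAB \<Longrightarrow> h \<in> carrier MAB \<Longrightarrow> f - h \<in> carrier MAB"
  by (auto dest: subsetD[OF Poly_Mapping.keys_diff])

lemma tensor_relators_in: "tensor_relators A B \<subseteq> carrier MAB"
  unfolding tensor_relators_def
  by (auto simp del: monoid_algebra_simps(1) intro!: monoid_algebra_minus single_pair_in)

lemma
  shows monoid_algebra_diff_mult:
      "(f - f') \<otimes>\<^bsub>monoid_algebra G\<^esub> h = f \<otimes>\<^bsub>monoid_algebra G\<^esub> h - f' \<otimes>\<^bsub>monoid_algebra G\<^esub> h"
    and monoid_algebra_mult_diff:
      "h \<otimes>\<^bsub>monoid_algebra G\<^esub> (f - f') = h \<otimes>\<^bsub>monoid_algebra G\<^esub> f - h \<otimes>\<^bsub>monoid_algebra G\<^esub> f'"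
  using monoid_algebra_add_mult[where f = "f - f'" and f' = f' and h = h and G = G]
    monoid_algebra_mult_add[where f = "f - f'" and f' = f' and h = h and G = G]
  by (simp_all add: algebra_simps)

text \<open>Each family of bilinearity relators is stable under multiplication by a pair \<open>(s, t)\<close>, by
  distributivity in \<open>A\<close> and \<open>B\<close>. Hence the subspace that they span is a two-sided ideal and the
  quotient inherits the product \<open>(a \<otimes> b) (a' \<otimes> b') = a a' \<otimes> b b'\<close>.\<close>

lemma tensor_relators_mult:
  assumes "r \<in> tensor_relators A B" "s \<in> carrier A" "t \<in> carrier B"
  shows "r \<otimes>\<^bsub>MAB\<^esub> msingle (s, t) 1 \<in> tensor_relators A B"
    and "msingle (s, t) 1 \<otimes>\<^bsub>MAB\<^esub> r \<in> tensor_relators A B"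
proof -
  note simps = monoid_algebra_diff_mult monoid_algebra_mult_diff monoid_algebra_mult_single
    A.l_distr B.l_distr A.r_distr B.r_distr A.smult_mult_left B.smult_mult_left
    A.smult_mult_right B.smult_mult_right
  show "r \<otimes>\<^bsub>MAB\<^esub> msingle (s, t) 1 \<in> tensor_relators A B"
    using assms unfolding tensor_relators_def
    by (elim UnE CollectE exE conjE; simp add: simps; blast intro: A.m_closed B.m_closed)
  show "msingle (s, t) 1 \<otimes>\<^bsub>MAB\<^esub> r \<in> tensor_relators A B"
    using assms unfolding tensor_relators_def
    by (elim UnE CollectE exE conjE; simp add: simps; blast intro: A.m_closed B.m_closed)
qed

lemma ideal_tensor_subspace: "ideal (tensor_subspace A B) MAB"
  unfolding tensor_subspace_def
proof (rule M.ideal_lspan[OF tensor_relators_in _ monoid_algebra_lspan[OF monoid_AB]])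
  show "(\<lambda>u. msingle u (1::'k)) ` carrier AB \<subseteq> carrier MAB"
    using single_pair_in by auto
  fix s t
  assume s: "s \<in> tensor_relators A B" and "t \<in> (\<lambda>u. msingle u (1::'k)) ` carrier AB"
  then obtain a b where "a \<in> carrier A" "b \<in> carrier B" "t = msingle (a, b) 1" by auto
  then show "t \<otimes>\<^bsub>MAB\<^esub> s \<in> lspan MAB (tensor_relators A B)" "s \<otimes>\<^bsub>MAB\<^esub> t \<in> lspan MAB (tensor_relators A B)"
    using tensor_relators_mult[OF s] by (auto intro: M.lspan_gen[OF tensor_relators_in])
qed

private lemmas MAB = unital_algebra_monoid_algebra[OF monoid_AB, where 'k = 'k]
private lemmas coset_tensor = coset_algebra_hom[OF MAB ideal_tensor_subspace, folded tensor_algebra_def]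

lemma unital_algebra_tensor: "unital_algebra T"
  unfolding tensor_algebra_def by (rule unital_algebra_quot[OF MAB ideal_tensor_subspace])

interpretation T: unital_alg T by (rule unital_alg.intro) (rule unital_algebra_tensor)

lemma pure_tensor_in: "a \<in> carrier A \<Longrightarrow> b \<in> carrier B \<Longrightarrow> pure_tensor A B a b \<in> carrier T"
  unfolding pure_tensor_def by (rule algebra_hom_closed[OF coset_tensor]) (rule single_pair_in)

lemma pure_tensor_mult:
  assumes "a \<in> carrier A" "b \<in> carrier B" "a' \<in> carrier A" "b' \<in> carrier B"
  shows "pure_tensor A B a b \<otimes>\<^bsub>T\<^esub> pure_tensor A B a' b' = pure_tensor A B (a \<otimes>\<^bsub>A\<^esub> a') (b \<otimes>\<^bsub>B\<^esub> b')"
  unfolding pure_tensor_def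
  by (subst algebra_hom_mult[OF coset_tensor, symmetric])
    (simp_all add: assms single_pair_in monoid_algebra_mult_single del: monoid_algebra_simps(1))

lemma pure_tensor_one: "pure_tensor A B \<one>\<^bsub>A\<^esub> \<one>\<^bsub>B\<^esub> = \<one>\<^bsub>T\<^esub>"
  unfolding pure_tensor_def using algebra_hom_one[OF coset_tensor] by simp

lemma tensor_lspan: "lspan T ((\<lambda>u. pure_tensor A B (fst u) (snd u)) ` (carrier A \<times> carrier B)) = carrier T"
proof -
  have "lspan T ((\<lambda>f. tensor_subspace A B +>\<^bsub>MAB\<^esub> f) ` ((\<lambda>u. msingle u 1) ` carrier AB)) = carrier T"
    unfolding tensor_algebra_def
    by (rule coset_lspan[OF MAB ideal_tensor_subspace _ monoid_algebra_lspan[OF monoid_AB]])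
      (use single_pair_in in auto)
  then show ?thesis by (simp add: image_image pure_tensor_def)
qed

lemma tensor_eq_if_diff:
  assumes f: "f \<in> carrier MAB" and h: "h \<in> carrier MAB" and "f - h \<in> tensor_subspace A B"
  shows "tensor_subspace A B +>\<^bsub>MAB\<^esub> f = tensor_subspace A B +>\<^bsub>MAB\<^esub> h"
proof -
  have "tensor_subspace A B +>\<^bsub>MAB\<^esub> (f - h) = \<zero>\<^bsub>T\<^esub>"
    using coset_eq_zero_iff[OF MAB ideal_tensor_subspace, of "f - h"] assms monoid_algebra_minus[OF f h]
    by (simp add: tensor_algebra_def)
  then have "tensor_subspace A B +>\<^bsub>MAB\<^esub> ((f - h) \<oplus>\<^bsub>MAB\<^esub> h) = \<zero>\<^bsub>T\<^esub> \<oplus>\<^bsub>T\<^esub> (tensor_subspace A B +>\<^bsub>MAB\<^esub> h)"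
    by (simp only: lin_add[OF algebra_hom_lin[OF coset_tensor] monoid_algebra_minus[OF f h] h])
  then show ?thesis
    using T.l_zero[OF algebra_hom_closed[OF coset_tensor h]] by simp
qed

lemma bilin_pure_tensor: "bilin A B T (pure_tensor A B)"
proof -
  note gen = M.lspan_gen[OF tensor_relators_in, folded tensor_subspace_def]
  have eq: "pure_tensor A B a b = tensor_subspace A B +>\<^bsub>MAB\<^esub> h"
    if "msingle (a, b) 1 - h \<in> tensor_relators A B" "h \<in> carrier MAB" "a \<in> carrier A" "b \<in> carrier B" for a b h
    unfolding pure_tensor_def using that by (intro tensor_eq_if_diff gen single_pair_in)
  have add: "pure_tensor A B a b \<oplus>\<^bsub>T\<^esub> pure_tensor A B a' b' =
      tensor_subspace A B +>\<^bsub>MAB\<^esub> (msingle (a, b) 1 + msingle (a', b') 1)"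
    and sc: "c \<odot>\<^bsub>T\<^esub> pure_tensor A B a b = tensor_subspace A B +>\<^bsub>MAB\<^esub> msingle (a, b) c"
    and in_add: "msingle (a, b) 1 + msingle (a', b') 1 \<in> carrier MAB"
    if "a \<in> carrier A" "b \<in> carrier B" "a' \<in> carrier A" "b' \<in> carrier B" for a b a' b' c
    unfolding pure_tensor_def
    using lin_add[OF algebra_hom_lin[OF coset_tensor] single_pair_in[of a b 1] single_pair_in[of a' b' 1]]
      lin_smult[OF algebra_hom_lin[OF coset_tensor] single_pair_in[of a b 1], of c]
      M.a_closed[OF single_pair_in[of a b 1] single_pair_in[of a' b' 1]] that
    by (simp_all add: map_times_single)
  show ?thesis
  proof (intro bilinI linI)
    show "pure_tensor A B (a \<oplus>\<^bsub>A\<^esub> a') b = pure_tensor A B a b \<oplus>\<^bsub>T\<^esub> pure_tensor A B a' b"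
      if "a \<in> carrier A" "a' \<in> carrier A" "b \<in> carrier B" for a a' b
      using that
      by (simp only: add, intro eq in_add A.a_closed, simp only: diff_diff_eq[symmetric])
        (auto simp: tensor_relators_def)
    show "pure_tensor A B a (b \<oplus>\<^bsub>B\<^esub> b') = pure_tensor A B a b \<oplus>\<^bsub>T\<^esub> pure_tensor A B a b'"
      if "b \<in> carrier B" "b' \<in> carrier B" "a \<in> carrier A" for a b b'
      using that
      by (simp only: add, intro eq in_add B.a_closed, simp only: diff_diff_eq[symmetric])
        (auto simp: tensor_relators_def)
    show "pure_tensor A B (c \<odot>\<^bsub>A\<^esub> a) b = c \<odot>\<^bsub>T\<^esub> pure_tensor A B a b"
      if "a \<in> carrier A" "b \<in> carrier B" for a b c
      using that by (simp only: sc, intro eq single_pair_in A.smult_in) (auto simp: tensor_relators_def)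
    show "pure_tensor A B a (c \<odot>\<^bsub>B\<^esub> b) = c \<odot>\<^bsub>T\<^esub> pure_tensor A B a b"
      if "b \<in> carrier B" "a \<in> carrier A" for a b c
      using that by (simp only: sc, intro eq single_pair_in B.smult_in) (auto simp: tensor_relators_def)
  qed (use pure_tensor_in in auto)
qed

lemma tensor_eqI:
  assumes "f \<in> lin T C" "h \<in> lin T C" "unital_algebra C" "t \<in> carrier T"
    and "\<And>a b. a \<in> carrier A \<Longrightarrow> b \<in> carrier B \<Longrightarrow> f (pure_tensor A B a b) = h (pure_tensor A B a b)"
  shows "f t = h t"
  by (rule lin_eqI[OF assms(1,2) unital_algebra_tensor assms(3)
        _ assms(4)[folded tensor_lspan]]) (use assms(5) pure_tensor_in in auto)

context
  fixes C :: "('k, 'c, 'l) module_scheme" and \<beta>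
  assumes C: "unital_algebra C" and \<beta>: "bilin A B C \<beta>"
begin

interpretation C: unital_alg C by (rule unital_alg.intro) (rule C)

lemma linext_bilin_lin: "linext C (\<lambda>u. \<beta> (fst u) (snd u)) \<in> lin MAB C"
  by (rule linext_lin[OF C]) (use bilin_closed[OF \<beta>] in auto)

lemma linext_bilin_single:
  "a \<in> carrier A \<Longrightarrow> b \<in> carrier B \<Longrightarrow> linext C (\<lambda>u. \<beta> (fst u) (snd u)) (msingle (a, b) c) = c \<odot>\<^bsub>C\<^esub> \<beta> a b"
  by (subst linext_single[OF C, where X = "carrier A \<times> carrier B"]) (use bilin_closed[OF \<beta>] in auto)

text \<open>The four families of relators express exactly the bilinearity of \<open>\<beta>\<close>, so its linear extension
  descends to the tensor product. The next lemmas are the resulting universal property.\<close>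

lemma linext_tensor_subspace:
  assumes "f \<in> tensor_subspace A B"
  shows "linext C (\<lambda>u. \<beta> (fst u) (snd u)) f = \<zero>\<^bsub>C\<^esub>"
proof -
  let ?h = "linext C (\<lambda>u. \<beta> (fst u) (snd u))"
  note diff = lin_monoid_algebra_diff[OF C linext_bilin_lin]
  note simps = diff monoid_algebra_minus single_pair_in linext_bilin_single
    lin_add[OF bilin_left[OF \<beta>]] lin_add[OF bilin_right[OF \<beta>]]
    lin_smult[OF bilin_left[OF \<beta>]] lin_smult[OF bilin_right[OF \<beta>]] bilin_closed[OF \<beta>]
  have cancel: "x \<oplus>\<^bsub>C\<^esub> y \<ominus>\<^bsub>C\<^esub> x \<ominus>\<^bsub>C\<^esub> y = \<zero>\<^bsub>C\<^esub>" "x \<ominus>\<^bsub>C\<^esub> x = \<zero>\<^bsub>C\<^esub>"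
    if "x \<in> carrier C" "y \<in> carrier C" for x y
    using that C.a_comm[of x y] by (simp_all add: a_minus_def C.a_assoc C.r_neg)
  have rel: "?h r = \<zero>\<^bsub>C\<^esub>" if "r \<in> tensor_relators A B" for r
    using that unfolding tensor_relators_def
    by (elim UnE CollectE exE conjE)
      (simp_all add: simps cancel del: monoid_algebra_simps(1))
  from assms tensor_relators_in show ?thesis
    unfolding tensor_subspace_def
    by (induction rule: M.lspan_induct)
      (use lin_zero[OF linext_bilin_lin MAB C] lin_add[OF linext_bilin_lin] lin_smult[OF linext_bilin_lin] rel in auto)
qed

lemma tensor_lift_conv: "tensor_lift C \<beta> = (\<lambda>U. the_elem (linext C (\<lambda>u. \<beta> (fst u) (snd u)) ` U))"
  by (rule ext) (simp add: tensor_lift_def linext_def[abs_def])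

lemma tensor_lift_lin: "tensor_lift C \<beta> \<in> lin T C"
  unfolding tensor_lift_conv tensor_algebra_def
  by (rule quot_lift_lin[OF MAB ideal_tensor_subspace C linext_bilin_lin linext_tensor_subspace])

lemma tensor_lift_pure:
  "a \<in> carrier A \<Longrightarrow> b \<in> carrier B \<Longrightarrow> tensor_lift C \<beta> (pure_tensor A B a b) = \<beta> a b"
  unfolding tensor_lift_conv pure_tensor_def
  by (subst quot_lift[OF MAB ideal_tensor_subspace C linext_bilin_lin linext_tensor_subspace])
    (simp_all add: single_pair_in linext_bilin_single bilin_closed[OF \<beta>] del: monoid_algebra_simps(1))

lemma tensor_lift_algebra_hom:
  assumes "\<beta> \<one>\<^bsub>A\<^esub> \<one>\<^bsub>B\<^esub> = \<one>\<^bsub>C\<^esub>"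
    and "\<And>a b a' b'. a \<in> carrier A \<Longrightarrow> b \<in> carrier B \<Longrightarrow> a' \<in> carrier A \<Longrightarrow> b' \<in> carrier B \<Longrightarrow>
      \<beta> (a \<otimes>\<^bsub>A\<^esub> a') (b \<otimes>\<^bsub>B\<^esub> b') = \<beta> a b \<otimes>\<^bsub>C\<^esub> \<beta> a' b'"
  shows "tensor_lift C \<beta> \<in> algebra_hom T C"
proof (rule algebra_homI_lspan[OF tensor_lift_lin unital_algebra_tensor C _ tensor_lspan])
  show "tensor_lift C \<beta> \<one>\<^bsub>T\<^esub> = \<one>\<^bsub>C\<^esub>"
    by (simp add: tensor_lift_pure assms(1) flip: pure_tensor_one)
qed (use pure_tensor_in in \<open>auto simp: pure_tensor_mult tensor_lift_pure assms(2)\<close>)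

end

end

subsection \<open>Functoriality and associativity\<close>

context
  fixes A :: "('k::field, 'a, 'm) module_scheme" and B :: "('k, 'b, 'n) module_scheme"
    and C :: "('k, 'c, 'l) module_scheme" and D :: "('k, 'd, 'o) module_scheme"
  assumes A: "unital_algebra A" and B: "unital_algebra B"
    and C: "unital_algebra C" and D: "unital_algebra D"
begin

context
  fixes f h
  assumes f: "f \<in> lin A C" and h: "h \<in> lin B D"
begin

lemma bilin_tensor_map: "bilin A B (tensor_algebra C D) (\<lambda>a b. pure_tensor C D (f a) (h b))"
  by (rule bilin_comp[OF bilin_pure_tensor[OF C D] f h])

lemma tensor_map_lin: "tensor_map C D f h \<in> lin (tensor_algebra A B) (tensor_algebra C D)"
  unfolding tensor_map_def by (rule tensor_lift_lin[OF A B unital_algebra_tensor[OF C D] bilin_tensor_map])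

lemma tensor_map_pure:
  "a \<in> carrier A \<Longrightarrow> b \<in> carrier B \<Longrightarrow>
    tensor_map C D f h (pure_tensor A B a b) = pure_tensor C D (f a) (h b)"
  unfolding tensor_map_def by (rule tensor_lift_pure[OF A B unital_algebra_tensor[OF C D] bilin_tensor_map])

end

lemma tensor_map_algebra_hom:
  assumes f: "f \<in> algebra_hom A C" and h: "h \<in> algebra_hom B D"
  shows "tensor_map C D f h \<in> algebra_hom (tensor_algebra A B) (tensor_algebra C D)"
  unfolding tensor_map_def
proof (rule tensor_lift_algebra_hom[OF A B unital_algebra_tensor[OF C D]
      bilin_tensor_map[OF algebra_hom_lin[OF f] algebra_hom_lin[OF h]]])
  show "pure_tensor C D (f \<one>\<^bsub>A\<^esub>) (h \<one>\<^bsub>B\<^esub>) = \<one>\<^bsub>tensor_algebra C D\<^esub>"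
    by (simp add: algebra_hom_one[OF f] algebra_hom_one[OF h] pure_tensor_one[OF C D])
qed (simp add: algebra_hom_mult[OF f] algebra_hom_mult[OF h] pure_tensor_mult[OF C D]
    algebra_hom_closed[OF f] algebra_hom_closed[OF h])

end

context
  fixes A :: "('k::field, 'a, 'm) module_scheme" and B :: "('k, 'b, 'n) module_scheme"
    and C :: "('k, 'c, 'l) module_scheme"
  assumes A: "unital_algebra A" and B: "unital_algebra B" and C: "unital_algebra C"
begin

private abbreviation "TBC \<equiv> tensor_algebra B C"
private abbreviation "TABC \<equiv> tensor_algebra A TBC"

private lemmas TBC = unital_algebra_tensor[OF B C]
private lemmas TABC = unital_algebra_tensor[OF A TBC]
private lemmas TAB = unital_algebra_tensor[OF A B]

lemma bilin_assoc_inner: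
  assumes "c \<in> carrier C"
  shows "bilin A B TABC (\<lambda>a b. pure_tensor A TBC a (pure_tensor B C b c))"
  by (rule bilin_comp[OF bilin_pure_tensor[OF A TBC] lin_id bilin_left[OF bilin_pure_tensor[OF B C] assms]])

text \<open>The associator is a lift of a family of lifts. Linearity in \<open>t\<close> is the universal property for
  \<open>A \<otimes> B\<close>; linearity in \<open>c\<close> for fixed \<open>t\<close> is an identity between linear maps of \<open>t\<close> and is
  therefore checked on pure tensors.\<close>

lemma bilin_assoc:
  "bilin (tensor_algebra A B) C TABC
    (\<lambda>t c. tensor_lift TABC (\<lambda>a b. pure_tensor A TBC a (pure_tensor B C b c)) t)"
proof (rule bilinI)
  show "(\<lambda>t. tensor_lift TABC (\<lambda>a b. pure_tensor A TBC a (pure_tensor B C b c)) t) \<in> lin (tensor_algebra A B) TABC"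
    if "c \<in> carrier C" for c
    using tensor_lift_lin[OF A B TABC bilin_assoc_inner[OF that]] .
  fix t assume t: "t \<in> carrier (tensor_algebra A B)"
  interpret C: unital_alg C by (rule unital_alg.intro) (rule C)
  interpret T: unital_alg TABC by (rule unital_alg.intro) (rule TABC)
  let ?F = "\<lambda>c. tensor_lift TABC (\<lambda>a b. pure_tensor A TBC a (pure_tensor B C b c))"
  note F_lin = tensor_lift_lin[OF A B TABC bilin_assoc_inner]
  note F_pure = tensor_lift_pure[OF A B TABC bilin_assoc_inner]
  show "(\<lambda>c. ?F c t) \<in> lin C TABC"
  proof (rule linI)
    show "?F c t \<in> carrier TABC" if "c \<in> carrier C" for c
      using lin_closed[OF F_lin[OF that] t] .
    fix c d assume c: "c \<in> carrier C" and d: "d \<in> carrier C"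
    show "?F (c \<oplus>\<^bsub>C\<^esub> d) t = ?F c t \<oplus>\<^bsub>TABC\<^esub> ?F d t"
    proof (rule tensor_eqI[OF A B F_lin lin_add_fun[OF TABC F_lin F_lin] TABC t])
      fix a b assume a: "a \<in> carrier A" and b: "b \<in> carrier B"
      have "pure_tensor A TBC a (pure_tensor B C b (c \<oplus>\<^bsub>C\<^esub> d)) =
          pure_tensor A TBC a (pure_tensor B C b c) \<oplus>\<^bsub>TABC\<^esub> pure_tensor A TBC a (pure_tensor B C b d)"
        by (simp add: lin_add[OF bilin_right[OF bilin_pure_tensor[OF B C] b] c d]
            lin_add[OF bilin_right[OF bilin_pure_tensor[OF A TBC] a]] pure_tensor_in[OF B C] b c d)
      then show "?F (c \<oplus>\<^bsub>C\<^esub> d) (pure_tensor A B a b) =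
          ?F c (pure_tensor A B a b) \<oplus>\<^bsub>TABC\<^esub> ?F d (pure_tensor A B a b)"
        by (simp add: F_pure a b c d)
    qed (use c d in auto)
  next
    fix k c assume c: "c \<in> carrier C"
    show "?F (k \<odot>\<^bsub>C\<^esub> c) t = k \<odot>\<^bsub>TABC\<^esub> ?F c t"
    proof (rule tensor_eqI[OF A B F_lin lin_smult_const[OF TABC F_lin] TABC t])
      fix a b assume a: "a \<in> carrier A" and b: "b \<in> carrier B"
      have "pure_tensor A TBC a (pure_tensor B C b (k \<odot>\<^bsub>C\<^esub> c)) =
          k \<odot>\<^bsub>TABC\<^esub> pure_tensor A TBC a (pure_tensor B C b c)"
        by (simp add: lin_smult[OF bilin_right[OF bilin_pure_tensor[OF B C] b] c]
            lin_smult[OF bilin_right[OF bilin_pure_tensor[OF A TBC] a]] pure_tensor_in[OF B C] b c)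
      then show "?F (k \<odot>\<^bsub>C\<^esub> c) (pure_tensor A B a b) = k \<odot>\<^bsub>TABC\<^esub> ?F c (pure_tensor A B a b)"
        by (simp add: F_pure a b c)
    qed (use c in auto)
  qed
qed

lemma tensor_assoc_pure:
  assumes "a \<in> carrier A" "b \<in> carrier B" "c \<in> carrier C"
  shows "tensor_assoc A B C (pure_tensor (tensor_algebra A B) C (pure_tensor A B a b) c) =
    pure_tensor A TBC a (pure_tensor B C b c)"
  unfolding tensor_assoc_def Let_def
  by (simp add: tensor_lift_pure[OF TAB C TABC bilin_assoc] tensor_lift_pure[OF A B TABC bilin_assoc_inner]
      pure_tensor_in[OF A B] assms)

lemma tensor_assoc_algebra_hom:
  "tensor_assoc A B C \<in> algebra_hom (tensor_algebra (tensor_algebra A B) C) TABC"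
  unfolding tensor_assoc_def Let_def
proof (rule tensor_lift_algebra_hom[OF TAB C TABC bilin_assoc])
  interpret A: unital_alg A by (rule unital_alg.intro) (rule A)
  interpret B: unital_alg B by (rule unital_alg.intro) (rule B)
  interpret C: unital_alg C by (rule unital_alg.intro) (rule C)
  interpret T: unital_alg TABC by (rule unital_alg.intro) (rule TABC)
  interpret T2: unital_alg "tensor_algebra A B" by (rule unital_alg.intro) (rule TAB)
  let ?F = "\<lambda>c. tensor_lift TABC (\<lambda>a b. pure_tensor A TBC a (pure_tensor B C b c))"
  note F_lin = tensor_lift_lin[OF A B TABC bilin_assoc_inner]
  note F_pure = tensor_lift_pure[OF A B TABC bilin_assoc_inner]
  show "?F \<one>\<^bsub>C\<^esub> \<one>\<^bsub>tensor_algebra A B\<^esub> = \<one>\<^bsub>TABC\<^esub>"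
    by (simp add: F_pure pure_tensor_one[OF B C] pure_tensor_one[OF A TBC] flip: pure_tensor_one[OF A B])
  fix t c t' c'
  assume t: "t \<in> carrier (tensor_algebra A B)" and t': "t' \<in> carrier (tensor_algebra A B)"
    and c: "c \<in> carrier C" and c': "c' \<in> carrier C"
  have 1: "?F (c \<otimes>\<^bsub>C\<^esub> c') (pure_tensor A B a b \<otimes>\<^bsub>tensor_algebra A B\<^esub> t') =
      ?F c (pure_tensor A B a b) \<otimes>\<^bsub>TABC\<^esub> ?F c' t'" if a: "a \<in> carrier A" and b: "b \<in> carrier B" for a b
  proof (rule tensor_eqI[OF A B _ _ TABC t', of "\<lambda>t'. ?F (c \<otimes>\<^bsub>C\<^esub> c') (pure_tensor A B a b \<otimes>\<^bsub>tensor_algebra A B\<^esub> t')"])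
    show "(\<lambda>t'. ?F (c \<otimes>\<^bsub>C\<^esub> c') (pure_tensor A B a b \<otimes>\<^bsub>tensor_algebra A B\<^esub> t')) \<in> lin (tensor_algebra A B) TABC"
      using a b c c' by (intro lin_comp[OF lin_mult_left[OF TAB lin_id] F_lin] pure_tensor_in[OF A B]) auto
    show "(\<lambda>t'. ?F c (pure_tensor A B a b) \<otimes>\<^bsub>TABC\<^esub> ?F c' t') \<in> lin (tensor_algebra A B) TABC"
      using a b c c' by (intro lin_mult_left[OF TABC F_lin] lin_closed[OF F_lin] pure_tensor_in[OF A B]) auto
  qed (simp add: pure_tensor_mult[OF A B] F_pure pure_tensor_mult[OF A TBC] pure_tensor_mult[OF B C]
      pure_tensor_in[OF B C] a b c c')
  show "?F (c \<otimes>\<^bsub>C\<^esub> c') (t \<otimes>\<^bsub>tensor_algebra A B\<^esub> t') = ?F c t \<otimes>\<^bsub>TABC\<^esub> ?F c' t'"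
  proof (rule tensor_eqI[OF A B _ _ TABC t, of "\<lambda>t. ?F (c \<otimes>\<^bsub>C\<^esub> c') (t \<otimes>\<^bsub>tensor_algebra A B\<^esub> t')"])
    show "(\<lambda>t. ?F (c \<otimes>\<^bsub>C\<^esub> c') (t \<otimes>\<^bsub>tensor_algebra A B\<^esub> t')) \<in> lin (tensor_algebra A B) TABC"
      using t' c c' by (intro lin_comp[OF lin_mult_right[OF TAB lin_id] F_lin]) auto
    show "(\<lambda>t. ?F c t \<otimes>\<^bsub>TABC\<^esub> ?F c' t') \<in> lin (tensor_algebra A B) TABC"
      using t' c c' by (intro lin_mult_right[OF TABC F_lin] lin_closed[OF F_lin]) auto
  qed (rule 1)
qed

end

section \<open>Free algebras and opposite algebras\<close>

definition word_prod :: "('k::field, 'b, 'm) module_scheme \<Rightarrow> ('g \<Rightarrow> 'b) \<Rightarrow> 'g list \<Rightarrow> 'b" where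
  "word_prod B \<phi> w = foldr (\<lambda>s b. \<phi> s \<otimes>\<^bsub>B\<^esub> b) w \<one>\<^bsub>B\<^esub>"

lemma word_prod_simps [simp]:
  "word_prod B \<phi> [] = \<one>\<^bsub>B\<^esub>"
  "word_prod B \<phi> (s # w) = \<phi> s \<otimes>\<^bsub>B\<^esub> word_prod B \<phi> w"
  by (simp_all add: word_prod_def)

lemma free_lift_conv: "free_lift B \<phi> = linext B (word_prod B \<phi>)"
  by (rule ext) (simp add: free_lift_def linext_def word_prod_def)

lemma monoid_words: "Group.monoid \<lparr>carrier = UNIV, mult = (@), one = []\<rparr>"
  by (rule monoidI) simp_all

lemma unital_algebra_free: "unital_algebra free_algebra"
  unfolding free_algebra_def by (rule unital_algebra_monoid_algebra[OF monoid_words])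

lemma carrier_free_algebra [simp]: "carrier free_algebra = UNIV"
  by (simp add: free_algebra_def)

lemma free_algebra_one: "\<one>\<^bsub>free_algebra\<^esub> = msingle [] 1"
  by (simp add: free_algebra_def)

lemma free_algebra_mult_single:
  "msingle u c \<otimes>\<^bsub>free_algebra\<^esub> msingle v d = msingle (u @ v) (c * d)"
  by (simp add: free_algebra_def monoid_algebra_mult_single)

lemma free_algebra_lspan: "lspan free_algebra (range (\<lambda>w. msingle w 1)) = UNIV"
  using monoid_algebra_lspan[OF monoid_words] by (simp add: free_algebra_def)

context
  fixes B :: "('k::field, 'b, 'm) module_scheme" and \<phi> :: "'g \<Rightarrow> 'b"
  assumes B: "unital_algebra B" and \<phi>: "\<And>s. \<phi> s \<in> carrier B"
begin

interpretation B: unital_alg B by (rule unital_alg.intro) (rule B)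

lemma word_prod_closed: "word_prod B \<phi> w \<in> carrier B"
  by (induction w) (simp_all add: \<phi>)

lemma word_prod_append: "word_prod B \<phi> (u @ v) = word_prod B \<phi> u \<otimes>\<^bsub>B\<^esub> word_prod B \<phi> v"
  by (induction u) (simp_all add: \<phi> word_prod_closed B.m_assoc)

lemma word_prod_replicate: "word_prod B \<phi> (replicate n s) = \<phi> s [^]\<^bsub>B\<^esub> n"
proof (induction n)
  case (Suc n)
  then show ?case using B.nat_pow_Suc2[OF \<phi>, of s n] by simp
qed simp

lemma free_lift_algebra_hom: "free_lift B \<phi> \<in> algebra_hom free_algebra B"
  unfolding free_lift_conv free_algebra_def
  by (rule linext_algebra_hom[OF monoid_words B]) (simp_all add: word_prod_closed word_prod_append)

lemma free_lift_single: "free_lift B \<phi> (msingle w c) = c \<odot>\<^bsub>B\<^esub> word_prod B \<phi> w"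
  unfolding free_lift_conv by (rule linext_single[OF B, of UNIV]) (simp_all add: word_prod_closed)

lemma free_lift_diff: "free_lift B \<phi> (f - h) = free_lift B \<phi> f \<ominus>\<^bsub>B\<^esub> free_lift B \<phi> h"
  using lin_monoid_algebra_diff[OF B algebra_hom_lin[OF free_lift_algebra_hom[unfolded free_algebra_def]]]
  by simp

lemma free_lift_add: "free_lift B \<phi> (f + h) = free_lift B \<phi> f \<oplus>\<^bsub>B\<^esub> free_lift B \<phi> h"
  using lin_add[OF algebra_hom_lin[OF free_lift_algebra_hom[unfolded free_algebra_def]], of f h] by simp

end

lemma algebra_hom_word_prod:
  assumes "f \<in> algebra_hom A B" "unital_algebra A" "\<And>s. \<phi> s \<in> carrier A"
  shows "f (word_prod A \<phi> w) = word_prod B (\<lambda>s. f (\<phi> s)) w"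
  by (induction w)
    (simp_all add: algebra_hom_one[OF assms(1)] algebra_hom_mult[OF assms(1)] assms(3) word_prod_closed[OF assms(2,3)])

lemma ideal_algebra_hom_kernel:
  assumes "f \<in> algebra_hom A B" "unital_algebra A" "unital_algebra B"
  shows "ideal {a \<in> carrier A. f a = \<zero>\<^bsub>B\<^esub>} A"
proof -
  interpret A: unital_alg A by (rule unital_alg.intro) fact
  interpret B: unital_alg B by (rule unital_alg.intro) fact
  have "f \<in> Ring.ring_hom A B" using assms(1) by (simp add: algebra_hom_def)
  then interpret ring_hom_ring A B f
    by (rule ring_hom_ringI2[OF A.ring_axioms B.ring_axioms])
  show ?thesis using kernel_is_ideal unfolding a_kernel_def' .
qed

text \<open>An antipode reverses products; as a homomorphism into the opposite algebra it can be obtained from a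
  universal property.\<close>

definition op_algebra :: "('k::field, 'a, 'm) module_scheme \<Rightarrow> ('k, 'a) module" where
  "op_algebra A = \<lparr>carrier = carrier A, mult = (\<lambda>a b. b \<otimes>\<^bsub>A\<^esub> a), one = \<one>\<^bsub>A\<^esub>, zero = \<zero>\<^bsub>A\<^esub>,
    add = (\<oplus>\<^bsub>A\<^esub>), smult = (\<odot>\<^bsub>A\<^esub>)\<rparr>"

lemma op_algebra_simps [simp]:
  "carrier (op_algebra A) = carrier A" "a \<otimes>\<^bsub>op_algebra A\<^esub> b = b \<otimes>\<^bsub>A\<^esub> a" "\<one>\<^bsub>op_algebra A\<^esub> = \<one>\<^bsub>A\<^esub>"
  "\<zero>\<^bsub>op_algebra A\<^esub> = \<zero>\<^bsub>A\<^esub>" "a \<oplus>\<^bsub>op_algebra A\<^esub> b = a \<oplus>\<^bsub>A\<^esub> b" "c \<odot>\<^bsub>op_algebra A\<^esub> a = c \<odot>\<^bsub>A\<^esub> a"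
  by (simp_all add: op_algebra_def)

lemma lin_op_algebra: "lin A (op_algebra B) = lin A B"
  by (simp add: LinearCombinations.module_hom_def)

context unital_alg
begin

lemma unital_algebra_op: "unital_algebra (op_algebra A)"
proof (rule unital_algebraI)
  show "ring (op_algebra A)"
  proof (rule ringI)
    show "abelian_group (op_algebra A)"
      by (rule abelian_groupI) (auto simp: a_assoc intro: a_comm add.l_inv_ex)
    show "Group.monoid (op_algebra A)"
      by (rule monoidI) (auto simp: m_assoc)
  qed (auto simp: l_distr r_distr)
qed (auto simp: smult_add smult_add_scalar smult_smult smult_mult_left smult_mult_right)

lemma pow_op_algebra: "a \<in> carrier A \<Longrightarrow> a [^]\<^bsub>op_algebra A\<^esub> (n::nat) = a [^] n"
proof (induction n)
  case (Suc n)
  interpret op: unital_alg "op_algebra A" by (rule unital_alg.intro) (rule unital_algebra_op)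
  show ?case using Suc op.nat_pow_Suc[of a n] nat_pow_Suc2[of a n] by simp
qed (simp add: nat_pow_def)

end

section \<open>The universal property of \<open>A\<^sub>(\<^sub>q\<^sub>)\<close>\<close>

context
  fixes p :: nat and q :: "'k::field"
begin

private abbreviation "H \<equiv> A_algebra p q"

definition A_relators :: "(generator list \<Rightarrow>\<^sub>0 'k) set" where
  "A_relators =
     {msingle [Gen_g, Gen_g] 1 - msingle [] 1,
      msingle (replicate (2 * p) Gen_x) 1 - msingle [Gen_x, Gen_x] (q ^ (p - 1)),
      msingle [Gen_x, Gen_g] 1 + msingle [Gen_g, Gen_x] 1}"

lemma A_ideal_conv: "A_ideal p q = genideal free_algebra A_relators"
  by (simp add: A_ideal_def A_relators_def)

interpretation F: unital_alg "free_algebra :: ('k, generator list \<Rightarrow>\<^sub>0 'k) module"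
  by (rule unital_alg.intro) (rule unital_algebra_free)

lemma ideal_A_ideal: "ideal (A_ideal p q) free_algebra"
  unfolding A_ideal_conv by (rule F.genideal_ideal) simp

lemma unital_algebra_A: "unital_algebra H"
  unfolding A_algebra_def by (rule unital_algebra_quot[OF unital_algebra_free ideal_A_ideal])

interpretation H: unital_alg H by (rule unital_alg.intro) (rule unital_algebra_A)

lemma A_coset_hom: "(\<lambda>f. A_ideal p q +>\<^bsub>free_algebra\<^esub> f) \<in> algebra_hom free_algebra H"
  unfolding A_algebra_def by (rule coset_algebra_hom[OF unital_algebra_free ideal_A_ideal])

lemma A_gen_in [simp]: "A_gen p q s \<in> carrier H"
  unfolding A_gen_def by (rule algebra_hom_closed[OF A_coset_hom]) simp

text \<open>The classes of words are the products of the classes of their letters. As words span the free algebra,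
  linear maps on \<open>A\<^sub>(\<^sub>q\<^sub>)\<close> are determined by products of generators.\<close>

lemma A_coset_single: "A_ideal p q +>\<^bsub>free_algebra\<^esub> msingle w c = c \<odot>\<^bsub>H\<^esub> word_prod H (A_gen p q) w"
proof -
  have 1: "A_ideal p q +>\<^bsub>free_algebra\<^esub> msingle w 1 = word_prod H (A_gen p q) w"
  proof (induction w)
    case Nil
    show ?case using algebra_hom_one[OF A_coset_hom] by (simp add: free_algebra_one)
  next
    case (Cons s w)
    have "msingle (s # w) 1 = msingle [s] 1 \<otimes>\<^bsub>free_algebra\<^esub> msingle w (1::'k)"
      by (simp add: free_algebra_mult_single)
    then show ?case using Cons algebra_hom_mult[OF A_coset_hom] by (simp add: A_gen_def)
  qed
  have "msingle w c = c \<odot>\<^bsub>free_algebra\<^esub> msingle w 1"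
    by (simp add: free_algebra_def map_times_single)
  then show ?thesis using lin_smult[OF algebra_hom_lin[OF A_coset_hom], of "msingle w 1" c] 1 by simp
qed

lemma A_lspan_words: "lspan H (range (word_prod H (A_gen p q))) = carrier H"
proof -
  have "lspan H ((\<lambda>f. A_ideal p q +>\<^bsub>free_algebra\<^esub> f) ` range (\<lambda>w. msingle w 1)) = carrier H"
    unfolding A_algebra_def
    by (rule coset_lspan[OF unital_algebra_free ideal_A_ideal]) (simp_all add: free_algebra_lspan)
  then show ?thesis
    by (simp add: image_image A_coset_single word_prod_closed[OF unital_algebra_A])
qed

lemma A_lin_eqI:
  assumes "f \<in> lin H B" "h \<in> lin H B" "unital_algebra B" "a \<in> carrier H"
    and "\<And>w. f (word_prod H (A_gen p q) w) = h (word_prod H (A_gen p q) w)"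
  shows "f a = h a"
  by (rule lin_eqI[OF assms(1,2) unital_algebra_A assms(3) _ assms(4)[folded A_lspan_words]])
    (use assms(5) word_prod_closed[OF unital_algebra_A A_gen_in] in auto)

lemma A_hom_eqI:
  assumes f: "f \<in> algebra_hom H B" and h: "h \<in> algebra_hom H B" and B: "unital_algebra B"
    and a: "a \<in> carrier H"
    and "f (A_gen p q Gen_g) = h (A_gen p q Gen_g)" "f (A_gen p q Gen_x) = h (A_gen p q Gen_x)"
  shows "f a = h a"
proof (rule A_lin_eqI[OF algebra_hom_lin[OF f] algebra_hom_lin[OF h] B a])
  have "f (A_gen p q s) = h (A_gen p q s)" for s using assms(5,6) by (cases s) auto
  then show "f (word_prod H (A_gen p q) w) = h (word_prod H (A_gen p q) w)" for w
    by (simp add: algebra_hom_word_prod[OF f unital_algebra_A] algebra_hom_word_prod[OF h unital_algebra_A])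
qed

lemma A_coset_relator:
  assumes "r \<in> A_relators"
  shows "A_ideal p q +>\<^bsub>free_algebra\<^esub> r = \<zero>\<^bsub>H\<^esub>"
proof -
  have "r \<in> A_ideal p q" unfolding A_ideal_conv using F.genideal_self[of A_relators] assms by auto
  then show ?thesis
    unfolding A_algebra_def using coset_eq_zero_iff[OF unital_algebra_free ideal_A_ideal, of r] by simp
qed

lemma A_coset_diff: "A_ideal p q +>\<^bsub>free_algebra\<^esub> (f - h) =
    (A_ideal p q +>\<^bsub>free_algebra\<^esub> f) \<ominus>\<^bsub>H\<^esub> (A_ideal p q +>\<^bsub>free_algebra\<^esub> h)"
  using lin_monoid_algebra_diff[OF unital_algebra_A algebra_hom_lin[OF A_coset_hom[unfolded free_algebra_def]]]
  by (simp add: free_algebra_def)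

lemma A_coset_add: "A_ideal p q +>\<^bsub>free_algebra\<^esub> (f + h) =
    (A_ideal p q +>\<^bsub>free_algebra\<^esub> f) \<oplus>\<^bsub>H\<^esub> (A_ideal p q +>\<^bsub>free_algebra\<^esub> h)"
  using lin_add[OF algebra_hom_lin[OF A_coset_hom], of f h] by (simp add: free_algebra_def)

lemma
  shows A_rel_g: "A_gen p q Gen_g \<otimes>\<^bsub>H\<^esub> A_gen p q Gen_g = \<one>\<^bsub>H\<^esub>"
    and A_rel_x: "A_gen p q Gen_x [^]\<^bsub>H\<^esub> (2 * p) = q ^ (p - 1) \<odot>\<^bsub>H\<^esub> (A_gen p q Gen_x \<otimes>\<^bsub>H\<^esub> A_gen p q Gen_x)"
    and A_rel_xg: "A_gen p q Gen_x \<otimes>\<^bsub>H\<^esub> A_gen p q Gen_g = \<ominus>\<^bsub>H\<^esub> (A_gen p q Gen_g \<otimes>\<^bsub>H\<^esub> A_gen p q Gen_x)"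
proof -
  note simps = A_coset_diff A_coset_add A_coset_single word_prod_replicate[OF unital_algebra_A]
  have minus: "a = b" if "a \<ominus>\<^bsub>H\<^esub> b = \<zero>\<^bsub>H\<^esub>" "a \<in> carrier H" "b \<in> carrier H" for a b
    using that by simp
  show "A_gen p q Gen_g \<otimes>\<^bsub>H\<^esub> A_gen p q Gen_g = \<one>\<^bsub>H\<^esub>"
    using A_coset_relator[of "msingle [Gen_g, Gen_g] 1 - msingle [] 1"]
    by - (rule minus, simp_all add: A_relators_def simps)
  show "A_gen p q Gen_x [^]\<^bsub>H\<^esub> (2 * p) = q ^ (p - 1) \<odot>\<^bsub>H\<^esub> (A_gen p q Gen_x \<otimes>\<^bsub>H\<^esub> A_gen p q Gen_x)"
    using A_coset_relator[of "msingle (replicate (2 * p) Gen_x) 1 - msingle [Gen_x, Gen_x] (q ^ (p - 1))"]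
    by - (rule minus, simp_all add: A_relators_def simps)
  show "A_gen p q Gen_x \<otimes>\<^bsub>H\<^esub> A_gen p q Gen_g = \<ominus>\<^bsub>H\<^esub> (A_gen p q Gen_g \<otimes>\<^bsub>H\<^esub> A_gen p q Gen_x)"
    using A_coset_relator[of "msingle [Gen_x, Gen_g] 1 + msingle [Gen_g, Gen_x] 1"]
    by - (rule H.minus_equality[symmetric], simp_all add: A_relators_def simps)
qed

context
  fixes B :: "('k, 'b, 'm) module_scheme" and \<phi> :: "generator \<Rightarrow> 'b"
  assumes B: "unital_algebra B" and \<phi>: "\<And>s. \<phi> s \<in> carrier B"
    and rel_g: "\<phi> Gen_g \<otimes>\<^bsub>B\<^esub> \<phi> Gen_g = \<one>\<^bsub>B\<^esub>"
    and rel_x: "\<phi> Gen_x [^]\<^bsub>B\<^esub> (2 * p) = q ^ (p - 1) \<odot>\<^bsub>B\<^esub> (\<phi> Gen_x \<otimes>\<^bsub>B\<^esub> \<phi> Gen_x)"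
    and rel_xg: "\<phi> Gen_x \<otimes>\<^bsub>B\<^esub> \<phi> Gen_g \<oplus>\<^bsub>B\<^esub> \<phi> Gen_g \<otimes>\<^bsub>B\<^esub> \<phi> Gen_x = \<zero>\<^bsub>B\<^esub>"
begin

interpretation B: unital_alg B by (rule unital_alg.intro) (rule B)

text \<open>The kernel of the lift is an ideal that contains the three relators, and \<open>A_ideal\<close> is the least such
  ideal. So three identities in \<open>B\<close> suffice to define an algebra map on \<open>A\<^sub>(\<^sub>q\<^sub>)\<close>.\<close>

lemma free_lift_A_ideal:
  assumes "f \<in> A_ideal p q"
  shows "free_lift B \<phi> f = \<zero>\<^bsub>B\<^esub>"
proof -
  let ?K = "{a \<in> carrier free_algebra. free_lift B \<phi> a = \<zero>\<^bsub>B\<^esub>}"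
  have "A_relators \<subseteq> ?K"
    by (auto simp: A_relators_def free_lift_diff[OF B \<phi>] free_lift_add[OF B \<phi>] free_lift_single[OF B \<phi>]
        word_prod_replicate[OF B \<phi>] rel_g rel_x rel_xg \<phi> a_minus_def B.r_neg)
  then have "A_ideal p q \<subseteq> ?K" unfolding A_ideal_conv
    by (intro F.genideal_minimal ideal_algebra_hom_kernel free_lift_algebra_hom unital_algebra_free B \<phi>)
  then show ?thesis using assms by auto
qed

lemma A_lift_algebra_hom: "(\<lambda>U. the_elem (free_lift B \<phi> ` U)) \<in> algebra_hom H B"
  unfolding A_algebra_def
  by (rule quot_lift_algebra_hom[OF unital_algebra_free ideal_A_ideal B
        algebra_hom_lin[OF free_lift_algebra_hom[OF B \<phi>]] free_lift_A_ideal free_lift_algebra_hom[OF B \<phi>]])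

lemma A_lift_gen: "the_elem (free_lift B \<phi> ` A_gen p q s) = \<phi> s"
  unfolding A_gen_def
  by (subst quot_lift[OF unital_algebra_free ideal_A_ideal B
        algebra_hom_lin[OF free_lift_algebra_hom[OF B \<phi>]] free_lift_A_ideal])
    (simp_all add: free_lift_single[OF B \<phi>] \<phi>)

end

end

section \<open>The binomial theorem for commuting elements\<close>

context unital_alg
begin

lemma binomial_commuting:
  assumes a: "a \<in> carrier A" and b: "b \<in> carrier A" and ab: "a \<otimes> b = b \<otimes> a"
  shows "(a \<oplus> b) [^] n = (\<Oplus>i\<in>{..n}. of_nat (n choose i) \<odot> (a [^] i \<otimes> b [^] (n - i)))"
proof (induction n)
  case (Suc n)
  let ?t = "\<lambda>c (i::nat) (j::nat). of_nat c \<odot> (a [^] i \<otimes> b [^] j) :: 'a"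
  note a [simp] b [simp]
  have pow_comm: "b [^] j \<otimes> a = a \<otimes> b [^] j" for j :: nat
  proof (induction j)
    case (Suc j)
    have "b [^] Suc j \<otimes> a = b [^] j \<otimes> a \<otimes> b" using a b ab by (simp add: m_assoc)
    then show ?case using a b Suc by (simp add: m_assoc)
  qed (use a in simp)
  have ta: "?t c i j \<otimes> a = ?t c (Suc i) j" for c and i j :: nat
    using a b by (simp add: smult_mult_left m_assoc pow_comm)
  have tb: "?t c i j \<otimes> b = ?t c i (Suc j)" for c and i j :: nat
    using a b by (simp add: smult_mult_left m_assoc)
  have tsum: "?t c i j \<oplus> ?t d i j = ?t (c + d) i j" for c d and i j :: nat
    using a b by (simp add: smult_add_scalar)
  have "(a \<oplus> b) [^] Suc n = (\<Oplus>i\<in>{..n}. ?t (n choose i) i (n - i)) \<otimes> a \<oplus> (\<Oplus>i\<in>{..n}. ?t (n choose i) i (n - i)) \<otimes> b"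
    using a b Suc.IH by (simp add: r_distr)
  also have "(\<Oplus>i\<in>{..n}. ?t (n choose i) i (n - i)) \<otimes> a = (\<Oplus>i\<in>{..n}. ?t (n choose i) (Suc i) (n - i))"
    using a b by (subst finsum_ldistr) (simp_all add: ta)
  also have "(\<Oplus>i\<in>{..n}. ?t (n choose i) i (n - i)) \<otimes> b = (\<Oplus>i\<in>{..n}. ?t (n choose i) i (Suc (n - i)))"
    using a b by (subst finsum_ldistr) (simp_all add: tb)
  also have "\<dots> = (\<Oplus>i\<in>{..n}. ?t (n choose i) i (Suc n - i))"
    using a b by (intro add.finprod_cong') (auto simp: Suc_diff_le)
  \<comment> \<open>The term added at \<open>i = Suc n\<close> has the coefficient \<open>n choose Suc n = 0\<close>.\<close>
  also have "\<dots> = (\<Oplus>i\<in>{..Suc n}. ?t (n choose i) i (Suc n - i))"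
    using a b by (subst finsum_Suc) (simp_all add: Pi_def binomial_eq_0)
  also have "\<dots> = (\<Oplus>i\<in>{..n}. ?t (n choose Suc i) (Suc i) (n - i)) \<oplus> ?t 1 0 (Suc n)"
    by (subst finsum_Suc2) (simp_all add: Pi_def)
  also have "(\<Oplus>i\<in>{..n}. ?t (n choose i) (Suc i) (n - i)) \<oplus>
      ((\<Oplus>i\<in>{..n}. ?t (n choose Suc i) (Suc i) (n - i)) \<oplus> ?t 1 0 (Suc n)) =
      (\<Oplus>i\<in>{..n}. ?t (n choose i) (Suc i) (n - i) \<oplus> ?t (n choose Suc i) (Suc i) (n - i)) \<oplus> ?t 1 0 (Suc n)"
    by (subst finsum_addf) (simp_all add: a_assoc Pi_def)
  also have "\<dots> = (\<Oplus>i\<in>{..n}. ?t (Suc n choose Suc i) (Suc i) (Suc n - Suc i)) \<oplus> ?t 1 0 (Suc n)"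
    by (simp only: tsum) simp
  also have "\<dots> = (\<Oplus>i\<in>{..Suc n}. ?t (Suc n choose i) i (Suc n - i))"
    by (subst finsum_Suc2) (simp_all add: Pi_def)
  finally show ?case .
qed simp

text \<open>The intermediate binomial coefficients are divisible by \<open>p\<close>.\<close>

lemma freshman_dream:
  assumes "prime p" "of_nat p = (0::'k)"
    and a: "a \<in> carrier A" and b: "b \<in> carrier A" and ab: "a \<otimes> b = b \<otimes> a"
  shows "(a \<oplus> b) [^] p = a [^] p \<oplus> b [^] p"
proof -
  let ?t = "\<lambda>i. of_nat (p choose i) \<odot> (a [^] i \<otimes> b [^] (p - i))"
  have p: "p > 0" using assms(1) by (simp add: prime_gt_0_nat)
  have "?t i = \<zero>" if "0 < i" "i < p" for i
  proof -
    have "p dvd (p choose i)" using assms(1) that by (intro dvd_choose_prime) auto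
    then obtain m where "p choose i = p * m" by (rule dvdE)
    then show ?thesis using a b assms(2) by simp
  qed
  then have "(\<Oplus>i\<in>{..p}. ?t i) = (\<Oplus>i\<in>{0, p}. ?t i)"
    using a b p by (intro add.finprod_mono_neutral_cong_right) auto
  also have "\<dots> = a [^] p \<oplus> b [^] p" using a b p by (simp add: a_comm)
  finally show ?thesis using binomial_commuting[OF a b ab] by simp
qed

end

section \<open>The Hopf algebra structure of \<open>A\<^sub>(\<^sub>q\<^sub>)\<close>\<close>

locale hopf_datum =
  fixes p :: nat and q :: "'k::field"
  assumes prime_p: "prime p" and odd_p: "odd p" and char_p: "of_nat p = (0::'k)"
begin

abbreviation "H \<equiv> A_algebra p q"
abbreviation mult_H (infixl \<open>\<star>\<close> 70) where "a \<star> b \<equiv> a \<otimes>\<^bsub>H\<^esub> b"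
abbreviation smult_H (infixl \<open>\<cdot>\<close> 70) where "c \<cdot> a \<equiv> c \<odot>\<^bsub>H\<^esub> a"
abbreviation "g \<equiv> A_gen p q Gen_g"
abbreviation "x \<equiv> A_gen p q Gen_x"
abbreviation "HH \<equiv> tensor_algebra H H"
abbreviation mult_HH (infixl \<open>\<star>\<star>\<close> 70) where "s \<star>\<star> t \<equiv> s \<otimes>\<^bsub>HH\<^esub> t"
abbreviation "HHH \<equiv> tensor_algebra H HH"
abbreviation "pure \<equiv> pure_tensor H H"

lemmas UH = unital_algebra_A[of p q]
lemmas UHH = unital_algebra_tensor[OF UH UH]
lemmas UHHH = unital_algebra_tensor[OF UH UHH]

sublocale H: unital_alg H by (rule unital_alg.intro) (rule UH)
sublocale HH: unital_alg HH by (rule unital_alg.intro) (rule UHH)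
sublocale HHH: unital_alg HHH by (rule unital_alg.intro) (rule UHHH)

lemmas gg = A_rel_g[of p q]
lemmas x_pow = A_rel_x[of p q]
lemmas xg = A_rel_xg[of p q]

lemma p_pos: "p > 0"
  using prime_p by (rule prime_gt_0_nat)

lemma pure_in [simp]: "a \<in> carrier H \<Longrightarrow> b \<in> carrier H \<Longrightarrow> pure a b \<in> carrier HH"
  by (rule pure_tensor_in[OF UH UH])

lemmas pure_mult = pure_tensor_mult[OF UH UH]
lemmas pure_one = pure_tensor_one[OF UH UH]
lemmas pure_bilin = bilin_pure_tensor[OF UH UH]

lemma pure_neg_left: "a \<in> carrier H \<Longrightarrow> b \<in> carrier H \<Longrightarrow> pure (\<ominus>\<^bsub>H\<^esub> a) b = \<ominus>\<^bsub>HH\<^esub> pure a b"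
  by (rule lin_neg[OF bilin_left[OF pure_bilin] UH UHH])

lemma pure_smult_left: "a \<in> carrier H \<Longrightarrow> b \<in> carrier H \<Longrightarrow> pure (c \<cdot> a) b = c \<odot>\<^bsub>HH\<^esub> pure a b"
  by (rule lin_smult[OF bilin_left[OF pure_bilin]])

lemma pure_smult_right: "a \<in> carrier H \<Longrightarrow> b \<in> carrier H \<Longrightarrow> pure a (c \<cdot> b) = c \<odot>\<^bsub>HH\<^esub> pure a b"
  by (rule lin_smult[OF bilin_right[OF pure_bilin]])

lemma pure_neg_right: "a \<in> carrier H \<Longrightarrow> b \<in> carrier H \<Longrightarrow> pure a (\<ominus>\<^bsub>H\<^esub> b) = \<ominus>\<^bsub>HH\<^esub> pure a b"
  by (rule lin_neg[OF bilin_right[OF pure_bilin] UH UHH])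

lemma pure_pow: "a \<in> carrier H \<Longrightarrow> b \<in> carrier H \<Longrightarrow> pure a b [^]\<^bsub>HH\<^esub> (n::nat) = pure (a [^]\<^bsub>H\<^esub> n) (b [^]\<^bsub>H\<^esub> n)"
  by (induction n) (simp_all add: pure_one pure_mult)

lemma A_comult_gen_in: "A_comult_gen p q s \<in> carrier HH"
  by (cases s) simp_all

lemma square_x_central: "x \<star> x \<star> g = g \<star> (x \<star> x)"
proof -
  have "x \<star> x \<star> g = \<ominus>\<^bsub>H\<^esub> (x \<star> (g \<star> x))"
    by (simp add: H.m_assoc xg H.r_minus)
  also have "\<dots> = \<ominus>\<^bsub>H\<^esub> (x \<star> g \<star> x)"
    by (simp add: H.m_assoc)
  also have "\<dots> = g \<star> (x \<star> x)"
    by (simp add: xg H.l_minus H.m_assoc)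
  finally show ?thesis .
qed

text \<open>The mixed terms of \<open>\<Delta>(x)\<^sup>2\<close> cancel because \<open>x g = - g x\<close>, so \<open>x\<^sup>2\<close> is primitive.\<close>

lemma A_comult_gen_x_square:
  "A_comult_gen p q Gen_x \<star>\<star> A_comult_gen p q Gen_x =
    pure (x \<star> x) \<one>\<^bsub>H\<^esub> \<oplus>\<^bsub>HH\<^esub> pure \<one>\<^bsub>H\<^esub> (x \<star> x)"
proof -
  have "A_comult_gen p q Gen_x \<star>\<star> A_comult_gen p q Gen_x =
      (pure (x \<star> x) \<one>\<^bsub>H\<^esub> \<oplus>\<^bsub>HH\<^esub> pure (g \<star> x) x) \<oplus>\<^bsub>HH\<^esub>
      (\<ominus>\<^bsub>HH\<^esub> pure (g \<star> x) x \<oplus>\<^bsub>HH\<^esub> pure \<one>\<^bsub>H\<^esub> (x \<star> x))"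
    by (simp add: HH.l_distr HH.r_distr pure_mult gg xg pure_neg_left)
  also have "\<dots> = pure (x \<star> x) \<one>\<^bsub>H\<^esub> \<oplus>\<^bsub>HH\<^esub> pure \<one>\<^bsub>H\<^esub> (x \<star> x)"
    by (simp add: HH.a_assoc HH.r_neg2)
  finally show ?thesis .
qed

text \<open>Since \<open>x\<^sup>2 \<otimes> 1\<close> and \<open>1 \<otimes> x\<^sup>2\<close> commute, the \<open>p\<close>-th power of their sum is computed termwise in
  characteristic \<open>p\<close>; this is what makes \<open>\<Delta>\<close> compatible with \<open>x\<^sup>2\<^sup>p = q\<^sup>p\<^sup>-\<^sup>1 x\<^sup>2\<close>.\<close>

lemma A_comult_gen_rel_x:
  "A_comult_gen p q Gen_x [^]\<^bsub>HH\<^esub> (2 * p) =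
    q ^ (p - 1) \<odot>\<^bsub>HH\<^esub> (A_comult_gen p q Gen_x \<star>\<star> A_comult_gen p q Gen_x)"
proof -
  let ?D = "A_comult_gen p q Gen_x" and ?y = "x \<star> x"
  have y: "?y [^]\<^bsub>H\<^esub> p = q ^ (p - 1) \<cdot> ?y"
    using H.nat_pow_pow[of x 2 p] x_pow by (simp add: numeral_2_eq_2)
  have "?D [^]\<^bsub>HH\<^esub> (2 * p) = (?D \<star>\<star> ?D) [^]\<^bsub>HH\<^esub> p"
    using HH.nat_pow_pow[OF A_comult_gen_in, of Gen_x 2 p] A_comult_gen_in[of Gen_x]
    by (simp add: numeral_2_eq_2 del: A_comult_gen.simps)
  also have "\<dots> = pure ?y \<one>\<^bsub>H\<^esub> [^]\<^bsub>HH\<^esub> p \<oplus>\<^bsub>HH\<^esub> pure \<one>\<^bsub>H\<^esub> ?y [^]\<^bsub>HH\<^esub> p"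
    unfolding A_comult_gen_x_square
    by (rule HH.freshman_dream[OF prime_p char_p]) (simp_all add: pure_mult)
  also have "\<dots> = q ^ (p - 1) \<odot>\<^bsub>HH\<^esub> (?D \<star>\<star> ?D)"
    unfolding A_comult_gen_x_square by (simp add: pure_pow y pure_smult_left pure_smult_right HH.smult_add)
  finally show ?thesis .
qed

definition \<Delta> where "\<Delta> = (\<lambda>U. the_elem (free_lift HH (A_comult_gen p q) ` U))"

lemma A_comult_gen_rels:
  "A_comult_gen p q Gen_g \<star>\<star> A_comult_gen p q Gen_g = \<one>\<^bsub>HH\<^esub>"
  "A_comult_gen p q Gen_x \<star>\<star> A_comult_gen p q Gen_g \<oplus>\<^bsub>HH\<^esub>
    A_comult_gen p q Gen_g \<star>\<star> A_comult_gen p q Gen_x = \<zero>\<^bsub>HH\<^esub>"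
proof -
  show "A_comult_gen p q Gen_g \<star>\<star> A_comult_gen p q Gen_g = \<one>\<^bsub>HH\<^esub>"
    by (simp add: pure_mult gg pure_one)
  let ?a = "pure (g \<star> x) g" and ?b = "pure \<one>\<^bsub>H\<^esub> (g \<star> x)"
  have ab: "?a \<in> carrier HH" "?b \<in> carrier HH" by simp_all
  have "A_comult_gen p q Gen_x \<star>\<star> A_comult_gen p q Gen_g = \<ominus>\<^bsub>HH\<^esub> (?a \<oplus>\<^bsub>HH\<^esub> ?b)"
    by (simp add: HH.l_distr pure_mult gg xg pure_neg_left pure_neg_right HH.minus_add)
  moreover have "A_comult_gen p q Gen_g \<star>\<star> A_comult_gen p q Gen_x = ?a \<oplus>\<^bsub>HH\<^esub> ?b"
    by (simp add: HH.r_distr pure_mult gg)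
  ultimately show "A_comult_gen p q Gen_x \<star>\<star> A_comult_gen p q Gen_g \<oplus>\<^bsub>HH\<^esub>
    A_comult_gen p q Gen_g \<star>\<star> A_comult_gen p q Gen_x = \<zero>\<^bsub>HH\<^esub>"
    using ab by (simp add: HH.l_neg)
qed

lemma comult_hom: "\<Delta> \<in> algebra_hom H HH"
  unfolding \<Delta>_def
  by (rule A_lift_algebra_hom[OF UHH A_comult_gen_in])
    (rule A_comult_gen_rels A_comult_gen_rel_x)+

lemma comult_gen: "\<Delta> (A_gen p q s) = A_comult_gen p q s"
  unfolding \<Delta>_def
  by (rule A_lift_gen[OF UHH A_comult_gen_in]) (rule A_comult_gen_rels A_comult_gen_rel_x)+

lemma comult_g: "\<Delta> g = pure g g"
  and comult_x: "\<Delta> x = pure x \<one>\<^bsub>H\<^esub> \<oplus>\<^bsub>HH\<^esub> pure g x"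
  by (simp_all add: comult_gen)

definition \<epsilon> :: "_ \<Rightarrow> 'k" where "\<epsilon> = (\<lambda>U. the_elem (free_lift scalar_algebra A_counit_gen ` U))"

lemma
  shows counit_hom: "\<epsilon> \<in> algebra_hom H scalar_algebra"
    and counit_gen: "\<epsilon> (A_gen p q s) = A_counit_gen s"
proof -
  interpret S: unital_alg "scalar_algebra :: ('k, 'k) module"
    by (rule unital_alg.intro) (rule unital_algebra_scalar)
  have pow: "(0::'k) [^]\<^bsub>scalar_algebra\<^esub> (2 * p) = 0" using p_pos S.nat_pow_zero[of "2 * p"] by simp
  show "\<epsilon> \<in> algebra_hom H scalar_algebra"
    unfolding \<epsilon>_def by (rule A_lift_algebra_hom[OF unital_algebra_scalar]) (simp_all add: pow)
  show "\<epsilon> (A_gen p q s) = A_counit_gen s"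
    unfolding \<epsilon>_def by (rule A_lift_gen[OF unital_algebra_scalar]) (simp_all add: pow)
qed

subsection \<open>Coassociativity and counit\<close>

text \<open>Both sides are composites of algebra maps, so it suffices to compare them at \<open>g\<close> and \<open>x\<close>. The same
  argument gives the counit laws.\<close>

lemma coassociative:
  assumes "a \<in> carrier H"
  shows "tensor_assoc H H H (tensor_map HH H \<Delta> id (\<Delta> a)) = tensor_map H HH id \<Delta> (\<Delta> a)"
proof -
  have id: "id \<in> algebra_hom H H" using algebra_hom_id[of H] by (simp add: id_def)
  note l = tensor_map_algebra_hom[OF UH UH UHH UH comult_hom id]
    and r = tensor_map_algebra_hom[OF UH UH UH UHH id comult_hom]
    and as = tensor_assoc_algebra_hom[OF UH UH UH]
  note L = algebra_hom_comp[OF algebra_hom_comp[OF comult_hom l] as]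
    and R = algebra_hom_comp[OF comult_hom r]
  note lp = tensor_map_pure[OF UH UH UHH UH algebra_hom_lin[OF comult_hom] algebra_hom_lin[OF id]]
    and rp = tensor_map_pure[OF UH UH UH UHH algebra_hom_lin[OF id] algebra_hom_lin[OF comult_hom]]
    and ap = tensor_assoc_pure[OF UH UH UH]
  note lin = lin_add[OF algebra_hom_lin[OF l]] lin_add[OF algebra_hom_lin[OF r]] lin_add[OF algebra_hom_lin[OF as]]
    lin_add[OF bilin_left[OF bilin_pure_tensor[OF UHH UH]]]
    lin_add[OF bilin_right[OF bilin_pure_tensor[OF UH UHH]]]
  note one = algebra_hom_one[OF comult_hom]
  note in' = pure_tensor_in[OF UHH UH] pure_tensor_in[OF UH UHH]
  show ?thesis
  proof (rule A_hom_eqI[OF L R UHHH assms])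
    show "tensor_assoc H H H (tensor_map HH H \<Delta> id (\<Delta> g)) = tensor_map H HH id \<Delta> (\<Delta> g)"
      by (simp add: comult_g lp rp ap)
    have "tensor_assoc H H H (tensor_map HH H \<Delta> id (\<Delta> x)) =
        tensor_assoc H H H (pure_tensor HH H (pure x \<one>\<^bsub>H\<^esub>) \<one>\<^bsub>H\<^esub> \<oplus>\<^bsub>tensor_algebra HH H\<^esub>
          pure_tensor HH H (pure g x) \<one>\<^bsub>H\<^esub> \<oplus>\<^bsub>tensor_algebra HH H\<^esub> pure_tensor HH H (pure g g) x)"
      by (simp add: comult_x comult_g lp lin)
    also have "\<dots> = pure_tensor H HH x (pure \<one>\<^bsub>H\<^esub> \<one>\<^bsub>H\<^esub>) \<oplus>\<^bsub>HHH\<^esub> pure_tensor H HH g (pure x \<one>\<^bsub>H\<^esub>) \<oplus>\<^bsub>HHH\<^esub>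
        pure_tensor H HH g (pure g x)"
    proof -
      interpret T3: unital_alg "tensor_algebra HH H"
        by (rule unital_alg.intro) (rule unital_algebra_tensor[OF UHH UH])
      show ?thesis by (simp add: lin in' ap)
    qed
    also have "\<dots> = tensor_map H HH id \<Delta> (\<Delta> x)"
      by (simp add: comult_x rp lin one pure_one HHH.a_assoc in')
    finally show "tensor_assoc H H H (tensor_map HH H \<Delta> id (\<Delta> x)) = tensor_map H HH id \<Delta> (\<Delta> x)" .
  qed
qed

lemma bilin_counit_left: "bilin H H H (\<lambda>a b. \<epsilon> a \<cdot> b)"
  and bilin_counit_right: "bilin H H H (\<lambda>a b. \<epsilon> b \<cdot> a)"
proof -
  have "(\<lambda>a. \<epsilon> a \<cdot> b) \<in> lin H H" "(\<lambda>b. \<epsilon> a \<cdot> b) \<in> lin H H" if "b \<in> carrier H" for a b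
    by (rule linI; use that in \<open>simp add: lin_add[OF algebra_hom_lin[OF counit_hom]]
        lin_smult[OF algebra_hom_lin[OF counit_hom]] H.smult_add_scalar H.smult_add H.smult_smult mult.commute\<close>)+
  then show "bilin H H H (\<lambda>a b. \<epsilon> a \<cdot> b)" "bilin H H H (\<lambda>a b. \<epsilon> b \<cdot> a)"
    by (auto intro!: bilinI)
qed

lemma
  assumes a: "a \<in> carrier H"
  shows counit_left: "tensor_lift H (\<lambda>a b. \<epsilon> a \<cdot> b) (\<Delta> a) = a"
    and counit_right: "tensor_lift H (\<lambda>a b. \<epsilon> b \<cdot> a) (\<Delta> a) = a"
proof -
  note simps = algebra_hom_one[OF counit_hom, simplified] algebra_hom_mult[OF counit_hom, simplified]
    H.smult_mult_left H.smult_mult_right H.smult_smult mult.commute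
  have l: "tensor_lift H (\<lambda>a b. \<epsilon> a \<cdot> b) \<in> algebra_hom HH H"
    by (rule tensor_lift_algebra_hom[OF UH UH UH bilin_counit_left]) (simp_all add: simps)
  have r: "tensor_lift H (\<lambda>a b. \<epsilon> b \<cdot> a) \<in> algebra_hom HH H"
    by (rule tensor_lift_algebra_hom[OF UH UH UH bilin_counit_right]) (simp_all add: simps)
  note pures = tensor_lift_pure[OF UH UH UH bilin_counit_left] tensor_lift_pure[OF UH UH UH bilin_counit_right]
    lin_add[OF algebra_hom_lin[OF l]] lin_add[OF algebra_hom_lin[OF r]] counit_gen
    algebra_hom_one[OF counit_hom, simplified]
  show "tensor_lift H (\<lambda>a b. \<epsilon> a \<cdot> b) (\<Delta> a) = a"
    by (rule A_hom_eqI[OF algebra_hom_comp[OF comult_hom l] algebra_hom_id UH a])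
      (simp_all add: comult_g comult_x pures)
  show "tensor_lift H (\<lambda>a b. \<epsilon> b \<cdot> a) (\<Delta> a) = a"
    by (rule A_hom_eqI[OF algebra_hom_comp[OF comult_hom r] algebra_hom_id UH a])
      (simp_all add: comult_g comult_x pures)
qed

subsection \<open>The antipode\<close>

fun antipode_gen where
  "antipode_gen Gen_g = g"
| "antipode_gen Gen_x = \<ominus>\<^bsub>H\<^esub> (g \<star> x)"

lemma antipode_gen_in: "antipode_gen s \<in> carrier H"
  by (cases s) simp_all

text \<open>The sign is the reason for \<open>p\<close> odd: the antipode sends \<open>x\<^sup>2\<close> to \<open>- x\<^sup>2\<close>, and
  \<open>(- x\<^sup>2)\<^sup>p = - x\<^sup>2\<^sup>p\<close> is compatible with the second relation.\<close>

lemma gxgx: "(g \<star> x) \<star> (g \<star> x) = \<ominus>\<^bsub>H\<^esub> (x \<star> x)"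
proof -
  have "(g \<star> x) \<star> (g \<star> x) = g \<star> (x \<star> g) \<star> x"
    by (simp add: H.m_assoc)
  also have "\<dots> = \<ominus>\<^bsub>H\<^esub> ((g \<star> g) \<star> (x \<star> x))"
    by (simp add: xg H.r_minus H.l_minus H.m_assoc)
  finally show ?thesis by (simp add: gg)
qed

lemma antipode_gen_rel_x:
  "antipode_gen Gen_x [^]\<^bsub>H\<^esub> (2 * p) = q ^ (p - 1) \<cdot> (antipode_gen Gen_x \<star> antipode_gen Gen_x)"
proof -
  let ?y = "x \<star> x" and ?S = "antipode_gen Gen_x"
  have S: "?S \<star> ?S = (- 1) \<cdot> ?y"
    by (simp add: H.l_minus H.r_minus gxgx H.smult_m1)
  have y: "?y [^]\<^bsub>H\<^esub> p = q ^ (p - 1) \<cdot> ?y"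
    using H.nat_pow_pow[of x 2 p] x_pow by (simp add: numeral_2_eq_2)
  have "?S [^]\<^bsub>H\<^esub> (2 * p) = (?S \<star> ?S) [^]\<^bsub>H\<^esub> p"
    using H.nat_pow_pow[OF antipode_gen_in, of Gen_x 2 p] antipode_gen_in[of Gen_x]
    by (simp add: numeral_2_eq_2 del: antipode_gen.simps)
  also have "\<dots> = (- 1) ^ p \<cdot> ?y [^]\<^bsub>H\<^esub> p"
    unfolding S by (rule H.smult_pow) simp
  also have "\<dots> = q ^ (p - 1) \<cdot> (?S \<star> ?S)"
    unfolding S using odd_p by (simp add: y H.smult_smult)
  finally show ?thesis .
qed

definition \<S> where "\<S> = (\<lambda>U. the_elem (free_lift (op_algebra H) antipode_gen ` U))"

lemma
  shows antipode_anti_hom: "\<S> \<in> algebra_hom H (op_algebra H)"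
    and antipode_gen: "\<S> (A_gen p q s) = antipode_gen s"
proof -
  have 1: "antipode_gen s \<in> carrier (op_algebra H)" for s by (simp add: antipode_gen_in)
  have 2: "antipode_gen Gen_g \<otimes>\<^bsub>op_algebra H\<^esub> antipode_gen Gen_g = \<one>\<^bsub>op_algebra H\<^esub>" by (simp add: gg)
  have 3: "antipode_gen Gen_x [^]\<^bsub>op_algebra H\<^esub> (2 * p) =
      q ^ (p - 1) \<odot>\<^bsub>op_algebra H\<^esub> (antipode_gen Gen_x \<otimes>\<^bsub>op_algebra H\<^esub> antipode_gen Gen_x)"
    by (simp add: H.pow_op_algebra[OF antipode_gen_in] antipode_gen_rel_x del: antipode_gen.simps)
  have ggx: "g \<star> (g \<star> x) = x" by (simp add: H.m_assoc[symmetric] gg)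
  have gxg: "g \<star> x \<star> g = \<ominus>\<^bsub>H\<^esub> x" by (simp add: H.m_assoc xg H.r_minus ggx)
  have 4: "antipode_gen Gen_x \<otimes>\<^bsub>op_algebra H\<^esub> antipode_gen Gen_g \<oplus>\<^bsub>op_algebra H\<^esub>
      antipode_gen Gen_g \<otimes>\<^bsub>op_algebra H\<^esub> antipode_gen Gen_x = \<zero>\<^bsub>op_algebra H\<^esub>"
    by (simp add: H.r_minus H.l_minus ggx gxg H.l_neg)
  show "\<S> \<in> algebra_hom H (op_algebra H)"
    unfolding \<S>_def by (rule A_lift_algebra_hom[OF H.unital_algebra_op 1 2 3 4])
  show "\<S> (A_gen p q s) = antipode_gen s"
    unfolding \<S>_def by (rule A_lift_gen[OF H.unital_algebra_op 1 2 3 4])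
qed

lemma antipode_lin: "\<S> \<in> lin H H"
  using algebra_hom_lin[OF antipode_anti_hom] by (simp add: lin_op_algebra)

lemma antipode_mult: "a \<in> carrier H \<Longrightarrow> b \<in> carrier H \<Longrightarrow> \<S> (a \<star> b) = \<S> b \<star> \<S> a"
  using algebra_hom_mult[OF antipode_anti_hom] by simp

lemma antipode_one: "\<S> \<one>\<^bsub>H\<^esub> = \<one>\<^bsub>H\<^esub>"
  using algebra_hom_one[OF antipode_anti_hom] by simp

lemma antipode_in [simp]: "a \<in> carrier H \<Longrightarrow> \<S> a \<in> carrier H"
  by (rule lin_closed[OF antipode_lin])

definition conv_left where "conv_left = tensor_lift H (\<lambda>a b. \<S> a \<star> b)"
definition conv_right where "conv_right = tensor_lift H (\<lambda>a b. a \<star> \<S> b)"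

lemma bilin_conv_left: "bilin H H H (\<lambda>a b. \<S> a \<star> b)"
  by (rule bilin_comp[OF bilin_mult[OF UH] antipode_lin lin_id])

lemma bilin_conv_right: "bilin H H H (\<lambda>a b. a \<star> \<S> b)"
  by (rule bilin_comp[OF bilin_mult[OF UH] lin_id antipode_lin])

lemmas conv_left_lin = tensor_lift_lin[OF UH UH UH bilin_conv_left, folded conv_left_def]
lemmas conv_right_lin = tensor_lift_lin[OF UH UH UH bilin_conv_right, folded conv_right_def]
lemmas conv_left_pure = tensor_lift_pure[OF UH UH UH bilin_conv_left, folded conv_left_def]
lemmas conv_right_pure = tensor_lift_pure[OF UH UH UH bilin_conv_right, folded conv_right_def]

text \<open>For \<open>t = a \<otimes> b\<close> the value \<open>conv_left(s t)\<close> is \<open>\<S>(a) \<cdot> conv_left(s) \<cdot> b\<close>, because \<open>\<S>\<close> reverses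
  products. So once \<open>conv_left(s)\<close> is a scalar it can be pulled out. This is the step that carries the
  antipode law from the generators to all words, although \<open>conv_left\<close> is not multiplicative.\<close>

lemma conv_left_mult:
  assumes s: "s \<in> carrier HH" and t: "t \<in> carrier HH" and "conv_left s = c \<cdot> \<one>\<^bsub>H\<^esub>"
  shows "conv_left (s \<star>\<star> t) = c \<cdot> conv_left t"
proof -
  have 1: "conv_left (s \<star>\<star> pure a b) = \<S> a \<star> conv_left s \<star> b"
    if a: "a \<in> carrier H" and b: "b \<in> carrier H" for a b
  proof (rule tensor_eqI[OF UH UH _ _ UH s, of "\<lambda>s. conv_left (s \<star>\<star> pure a b)"])
    show "(\<lambda>s. conv_left (s \<star>\<star> pure a b)) \<in> lin HH H"
      using a b by (intro lin_comp[OF lin_mult_right[OF UHH lin_id] conv_left_lin]) simp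
    show "(\<lambda>s. \<S> a \<star> conv_left s \<star> b) \<in> lin HH H"
      using a b by (intro lin_mult_right[OF UH] lin_mult_left[OF UH] conv_left_lin) simp_all
  qed (simp add: a b pure_mult conv_left_pure antipode_mult H.m_assoc)
  show ?thesis
  proof (rule tensor_eqI[OF UH UH _ _ UH t, of "\<lambda>t. conv_left (s \<star>\<star> t)"])
    show "(\<lambda>t. conv_left (s \<star>\<star> t)) \<in> lin HH H"
      by (rule lin_comp[OF lin_mult_left[OF UHH lin_id s] conv_left_lin])
    show "(\<lambda>t. c \<cdot> conv_left t) \<in> lin HH H"
      by (rule lin_smult_const[OF UH conv_left_lin])
  qed (simp add: 1 assms(3) conv_left_pure H.smult_mult_left H.smult_mult_right)
qed

lemma conv_right_mult:
  assumes s: "s \<in> carrier HH" and t: "t \<in> carrier HH" and "conv_right t = c \<cdot> \<one>\<^bsub>H\<^esub>"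
  shows "conv_right (s \<star>\<star> t) = c \<cdot> conv_right s"
proof -
  have 1: "conv_right (pure a b \<star>\<star> t) = a \<star> conv_right t \<star> \<S> b"
    if a: "a \<in> carrier H" and b: "b \<in> carrier H" for a b
  proof (rule tensor_eqI[OF UH UH _ _ UH t, of "\<lambda>t. conv_right (pure a b \<star>\<star> t)"])
    show "(\<lambda>t. conv_right (pure a b \<star>\<star> t)) \<in> lin HH H"
      using a b by (intro lin_comp[OF lin_mult_left[OF UHH lin_id] conv_right_lin]) simp
    show "(\<lambda>t. a \<star> conv_right t \<star> \<S> b) \<in> lin HH H"
      using a b by (intro lin_mult_right[OF UH] lin_mult_left[OF UH] conv_right_lin) simp_all
  qed (simp add: a b pure_mult conv_right_pure antipode_mult H.m_assoc)
  show ?thesis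
  proof (rule tensor_eqI[OF UH UH _ _ UH s, of "\<lambda>s. conv_right (s \<star>\<star> t)"])
    show "(\<lambda>s. conv_right (s \<star>\<star> t)) \<in> lin HH H"
      by (rule lin_comp[OF lin_mult_right[OF UHH lin_id t] conv_right_lin])
    show "(\<lambda>s. c \<cdot> conv_right s) \<in> lin HH H"
      by (rule lin_smult_const[OF UH conv_right_lin])
  qed (simp add: 1 assms(3) conv_right_pure H.smult_mult_left H.smult_mult_right)
qed

lemma conv_gen:
  "conv_left (\<Delta> (A_gen p q s)) = \<epsilon> (A_gen p q s) \<cdot> \<one>\<^bsub>H\<^esub>"
  "conv_right (\<Delta> (A_gen p q s)) = \<epsilon> (A_gen p q s) \<cdot> \<one>\<^bsub>H\<^esub>"
proof -
  have ggx: "g \<star> (g \<star> x) = x" by (simp add: H.m_assoc[symmetric] gg)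
  show "conv_left (\<Delta> (A_gen p q s)) = \<epsilon> (A_gen p q s) \<cdot> \<one>\<^bsub>H\<^esub>"
    "conv_right (\<Delta> (A_gen p q s)) = \<epsilon> (A_gen p q s) \<cdot> \<one>\<^bsub>H\<^esub>"
    by (cases s; simp add: comult_g comult_x lin_add[OF conv_left_lin] lin_add[OF conv_right_lin]
        conv_left_pure conv_right_pure antipode_gen antipode_one counit_gen gg ggx H.r_minus H.l_neg H.r_neg)+
qed

lemma
  assumes a: "a \<in> carrier H"
  shows antipode_left: "conv_left (\<Delta> a) = \<epsilon> a \<cdot> \<one>\<^bsub>H\<^esub>"
    and antipode_right: "conv_right (\<Delta> a) = \<epsilon> a \<cdot> \<one>\<^bsub>H\<^esub>"
proof -
  have eps: "(\<lambda>a. \<epsilon> a \<cdot> \<one>\<^bsub>H\<^esub>) \<in> lin H H"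
    by (rule bilin_left[OF bilin_counit_left]) simp
  note closed = word_prod_closed[OF UH A_gen_in] algebra_hom_closed[OF comult_hom]
    lin_closed[OF conv_left_lin] lin_closed[OF conv_right_lin]
  have w: "conv_left (\<Delta> (word_prod H (A_gen p q) w)) = \<epsilon> (word_prod H (A_gen p q) w) \<cdot> \<one>\<^bsub>H\<^esub> \<and>
      conv_right (\<Delta> (word_prod H (A_gen p q) w)) = \<epsilon> (word_prod H (A_gen p q) w) \<cdot> \<one>\<^bsub>H\<^esub>" for w
  proof (induction w)
    case Nil
    show ?case by (simp add: algebra_hom_one[OF comult_hom] algebra_hom_one[OF counit_hom]
          conv_left_pure conv_right_pure antipode_one flip: pure_one)
  next
    case (Cons s w)
    let ?w = "word_prod H (A_gen p q) w"
    have "conv_left (\<Delta> (A_gen p q s) \<star>\<star> \<Delta> ?w) = \<epsilon> (A_gen p q s) \<cdot> conv_left (\<Delta> ?w)"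
      by (rule conv_left_mult) (simp_all add: closed conv_gen)
    moreover have "conv_right (\<Delta> (A_gen p q s) \<star>\<star> \<Delta> ?w) = \<epsilon> ?w \<cdot> conv_right (\<Delta> (A_gen p q s))"
      by (rule conv_right_mult) (simp_all add: closed Cons)
    ultimately show ?case
      by (simp add: algebra_hom_mult[OF comult_hom] algebra_hom_mult[OF counit_hom] closed conv_gen Cons
          H.smult_smult mult.commute)
  qed
  show "conv_left (\<Delta> a) = \<epsilon> a \<cdot> \<one>\<^bsub>H\<^esub>"
    by (rule A_lin_eqI[OF lin_comp[OF algebra_hom_lin[OF comult_hom] conv_left_lin] eps UH a]) (simp add: w)
  show "conv_right (\<Delta> a) = \<epsilon> a \<cdot> \<one>\<^bsub>H\<^esub>"
    by (rule A_lin_eqI[OF lin_comp[OF algebra_hom_lin[OF comult_hom] conv_right_lin] eps UH a]) (simp add: w)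
qed

end

section \<open>Forgetting additional record fields\<close>

text \<open>\<open>A_hopf\<close> extends the record \<open>A_algebra\<close>. The two have different types, but the constructions on algebras
  read only the algebra fields and agree on both.\<close>

definition same_algebra ::
  "('k::field, 'a, 'm) module_scheme \<Rightarrow> ('k, 'a, 'n) module_scheme \<Rightarrow> bool" where
  "same_algebra A B \<longleftrightarrow> carrier A = carrier B \<and> mult A = mult B \<and> one A = one B \<and>
    zero A = zero B \<and> add A = add B \<and> smult A = smult B"

lemma same_algebra_refl [simp]: "same_algebra A A"
  by (simp add: same_algebra_def)

context
  fixes A :: "('k::field, 'a, 'm) module_scheme" and A' :: "('k, 'a, 'n) module_scheme"
  assumes same: "same_algebra A A'"
begin

lemma same_algebra_fields:
  "carrier A = carrier A'" "mult A = mult A'" "one A = one A'"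
  "zero A = zero A'" "add A = add A'" "smult A = smult A'"
  using same by (simp_all add: same_algebra_def)

lemma same_algebra_lin: "lin A B = lin A' B" "lin B A = lin B A'"
  by (simp_all add: LinearCombinations.module_hom_def same_algebra_fields)

lemma same_algebra_hom: "algebra_hom A B = algebra_hom A' B" "algebra_hom B A = algebra_hom B A'"
  by (simp_all add: algebra_hom_def same_algebra_lin Ring.ring_hom_def same_algebra_fields)

lemma same_algebra_unital:
  assumes "unital_algebra A'"
  shows "unital_algebra A"
proof (rule unital_algebraI)
  interpret A': unital_alg A' by (rule unital_alg.intro) fact
  show "ring A"
  proof (rule ringI)
    show "abelian_group A"
      by (rule abelian_groupI) (auto simp: same_algebra_fields A'.a_assoc intro: A'.a_comm A'.add.l_inv_ex)
    show "Group.monoid A"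
      by (rule monoidI) (auto simp: same_algebra_fields A'.m_assoc)
  qed (auto simp: same_algebra_fields A'.l_distr A'.r_distr)
qed (use assms in \<open>auto simp: same_algebra_fields unital_alg_def unital_alg.smult_add unital_alg.smult_add_scalar
    unital_alg.smult_smult unital_alg.smult_mult_left unital_alg.smult_mult_right unital_alg.smult_in unital_alg.smult_1\<close>)

lemma same_algebra_tensor_lift: "tensor_lift A \<beta> T = tensor_lift A' \<beta> T"
  by (simp add: tensor_lift_def same_algebra_fields finsum_def finprod_def)

context
  fixes B :: "('k, 'b, 'l) module_scheme" and B' :: "('k, 'b, 'o) module_scheme"
  assumes same': "same_algebra B B'"
begin

lemma same_algebra_tensor: "tensor_algebra A B = tensor_algebra A' B'"
  and same_algebra_pure: "pure_tensor A B = pure_tensor A' B'"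
proof -
  have m: "A \<times>\<times> B = A' \<times>\<times> B'"
    using same same' by (simp add: same_algebra_def DirProd_def)
  have r: "tensor_relators A B = tensor_relators A' B'"
    using same same' by (simp add: same_algebra_def tensor_relators_def)
  show "tensor_algebra A B = tensor_algebra A' B'"
    by (simp add: tensor_algebra_def tensor_subspace_def m r)
  show "pure_tensor A B = pure_tensor A' B'"
    by (intro ext) (simp add: pure_tensor_def tensor_subspace_def m r)
qed

lemma same_algebra_tensor_map: "tensor_map A B = tensor_map A' B'"
  by (intro ext) (simp add: tensor_map_def same_algebra_tensor same_algebra_pure)

end

end

lemma same_algebra_tensor_assoc:
  assumes "same_algebra A A'" "same_algebra B B'" "same_algebra C C'"
  shows "tensor_assoc A B C = tensor_assoc A' B' C'"
  unfolding tensor_assoc_def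
  by (simp add: same_algebra_tensor[OF assms(2,3)] same_algebra_pure[OF assms(2,3)]
      same_algebra_tensor[OF assms(1) same_algebra_refl] same_algebra_pure[OF assms(1) same_algebra_refl])

context hopf_datum
begin

abbreviation "K \<equiv> A_hopf p q"

lemma same_algebra_hopf: "same_algebra K H"
  by (simp add: same_algebra_def A_hopf_def module.extend_def)

lemma A_hopf_simps [simp]:
  "carrier K = carrier H" "one K = one H" "mult K = mult H" "zero K = zero H" "add K = add H" "smult K = smult H"
  "comult K = \<Delta>" "counit K = \<epsilon>"
  by (simp_all add: A_hopf_def module.extend_def coalgebra_module.fields_def \<Delta>_def \<epsilon>_def)

lemmas A_hopf_same =
  same_algebra_lin[OF same_algebra_hopf] same_algebra_hom[OF same_algebra_hopf]
  same_algebra_tensor_lift[OF same_algebra_hopf]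
  same_algebra_tensor[OF same_algebra_hopf same_algebra_hopf]
  same_algebra_tensor[OF same_algebra_hopf same_algebra_refl]
  same_algebra_tensor[OF same_algebra_refl same_algebra_hopf]
  same_algebra_tensor_map[OF same_algebra_hopf same_algebra_hopf]
  same_algebra_tensor_map[OF same_algebra_hopf same_algebra_refl]
  same_algebra_tensor_map[OF same_algebra_refl same_algebra_hopf]
  same_algebra_tensor_assoc[OF same_algebra_hopf same_algebra_hopf same_algebra_hopf]

lemma unital_algebra_hopf: "unital_algebra K"
  by (rule same_algebra_unital[OF same_algebra_hopf UH])

lemma A_hopf_is_hopf_algebra: "hopf_algebra K"
proof -
  have "bialgebra K"
    unfolding bialgebra_def A_hopf_simps A_hopf_same
    using same_algebra_unital[OF same_algebra_hopf UH] comult_hom counit_hom coassociative counit_left counit_right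
    by simp
  moreover have "is_antipode K \<S>"
    unfolding is_antipode_def A_hopf_simps A_hopf_same
    using antipode_lin antipode_left antipode_right by (simp add: conv_left_def conv_right_def)
  ultimately show ?thesis unfolding hopf_algebra_def by blast
qed

end

section \<open>A basis of \<open>A\<^sub>(\<^sub>q\<^sub>)\<close>\<close>

context unital_alg
begin

lemma lin_functional_lincomb:
  assumes c: "c \<in> lin A scalar_algebra" and S: "finite S" "S \<subseteq> carrier A"
  shows "c (vs.lincomb a S) = (\<Sum>v\<in>S. a v * c v)"
  using S
proof (induction S rule: finite_induct)
  case empty
  show ?case using lin_zero[OF c unital_algebra unital_algebra_scalar] by (simp add: vs.lincomb_def)
next
  case (insert v S)
  then have "vs.lincomb a (insert v S) = a v \<odot> v \<oplus> vs.lincomb a S"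
    unfolding vs.lincomb_def by (intro finsum_insert) auto
  moreover have "vs.lincomb a S \<in> carrier A"
    using insert by (intro vs.lincomb_closed) auto
  ultimately show ?case using insert lin_add[OF c, of "a v \<odot> v" "vs.lincomb a S"] lin_smult[OF c, of v "a v"] by auto
qed

text \<open>The functionals \<open>c i\<close> form a dual basis: applying \<open>c i\<close> to a linear relation among the \<open>e j\<close>
  isolates its \<open>i\<close>-th coefficient.\<close>

lemma dim_if_dual_basis:
  fixes e :: "'i \<Rightarrow> 'a"
  assumes I: "finite I" and e: "\<And>i. i \<in> I \<Longrightarrow> e i \<in> carrier A" and span: "lspan A (e ` I) = carrier A"
    and c: "\<And>i. i \<in> I \<Longrightarrow> c i \<in> lin A scalar_algebra"
    and ce: "\<And>i j. i \<in> I \<Longrightarrow> j \<in> I \<Longrightarrow> c i (e j) = (if i = j then 1 else 0)"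
  shows "vs.fin_dim" and "vs.dim = card I"
proof -
  have eI: "e ` I \<subseteq> carrier A" using e by blast
  have inj: "inj_on e I"
  proof (rule inj_onI)
    fix i j assume ij: "i \<in> I" "j \<in> I" "e i = e j"
    then have "c i (e j) = 1" using ce[of i i] by simp
    then show "i = j" using ce[OF ij(1,2)] by (simp split: if_splits)
  qed
  show "vs.fin_dim" unfolding vs.fin_dim_def using I eI span by blast
  have "vs.lin_indpt (e ` I)"
  proof (rule vs.finite_lin_indpt2)
    fix a assume a: "vs.lincomb a (e ` I) = \<zero>"
    have "a (e i) = 0" if i: "i \<in> I" for i
    proof -
      have "0 = c i (vs.lincomb a (e ` I))"
        using a lin_zero[OF c[OF i] unital_algebra unital_algebra_scalar] by simp
      also have "\<dots> = (\<Sum>j\<in>I. a (e j) * c i (e j))"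
        using I eI by (simp add: lin_functional_lincomb[OF c[OF i]] sum.reindex[OF inj])
      also have "\<dots> = (\<Sum>j\<in>I. if j = i then a (e j) else 0)"
        by (rule sum.cong) (use ce i in auto)
      also have "\<dots> = a (e i)" using I i by simp
      finally show ?thesis by simp
    qed
    then show "\<forall>v\<in>e ` I. a v = \<zero>\<^bsub>class_ring\<^esub>" by simp
  qed (use I eI in auto)
  then have "vs.basis (e ` I)" unfolding vs.basis_def using eI span by blast
  then show "vs.dim = card I"
    using vs.dim_basis[of "e ` I"] I card_image[OF inj] by simp
qed

text \<open>The map \<open>a \<mapsto> \<Sum>\<^sub>i c i a \<odot> e i\<close> is linear and fixes the spanning vectors, so it is the identity; hence
  an element is determined by its coordinates.\<close>

lemma eq_if_coordinates_eq:
  assumes I: "finite I" and e: "\<And>i. i \<in> I \<Longrightarrow> e i \<in> carrier A" and span: "lspan A (e ` I) = carrier A"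
    and c: "\<And>i. i \<in> I \<Longrightarrow> c i \<in> lin A scalar_algebra"
    and ce: "\<And>i j. i \<in> I \<Longrightarrow> j \<in> I \<Longrightarrow> c i (e j) = (if i = j then 1 else 0)"
    and ab: "a \<in> carrier A" "b \<in> carrier A" and eq: "\<And>i. i \<in> I \<Longrightarrow> c i a = c i b"
  shows "a = b"
proof -
  let ?E = "\<lambda>a. \<Oplus>i\<in>I. c i a \<odot> e i"
  have E: "?E \<in> lin A A"
  proof (rule linI)
    show "?E a \<in> carrier A" for a using e by (intro finsum_closed) auto
    show "?E (a \<oplus> b) = ?E a \<oplus> ?E b" if "a \<in> carrier A" "b \<in> carrier A" for a b
    proof -
      have "?E (a \<oplus> b) = (\<Oplus>i\<in>I. c i a \<odot> e i \<oplus> c i b \<odot> e i)"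
        using e that by (intro add.finprod_cong') (auto simp: lin_add[OF c] smult_add_scalar)
      then show ?thesis using e by (simp add: finsum_addf Pi_def)
    qed
    show "?E (k \<odot> a) = k \<odot> ?E a" if "a \<in> carrier A" for k a
    proof -
      have "k \<odot> (\<Oplus>i\<in>J. c i a \<odot> e i) = (\<Oplus>i\<in>J. c i (k \<odot> a) \<odot> e i)" if "finite J" "J \<subseteq> I" for J
        using that
      proof (induction J rule: finite_induct)
        case (insert i J)
        then have "e ` J \<subseteq> carrier A" "e i \<in> carrier A" using e by auto
        with insert \<open>a \<in> carrier A\<close> show ?case
          by (simp add: Pi_def image_subset_iff smult_add smult_smult lin_smult[OF c])
      qed simp
      then show ?thesis using I by simp
    qed
  qed
  have "?E a = a" if "a \<in> carrier A" for a
  proof (rule lin_eqI[OF E lin_id unital_algebra unital_algebra _ that[folded span]])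
    show "e ` I \<subseteq> carrier A" using e by blast
    fix s assume "s \<in> e ` I"
    then obtain j where j: "j \<in> I" "s = e j" by blast
    have "?E (e j) = (\<Oplus>i\<in>I. if j = i then e i else \<zero>)"
      using e j by (intro add.finprod_cong') (auto simp: ce)
    also have "\<dots> = e j" using I j e by (intro add.finprod_singleton) auto
    finally show "?E s = s" using j by simp
  qed
  moreover have "?E a = ?E b" using e by (intro add.finprod_cong') (auto simp: eq)
  ultimately show ?thesis using ab by metis
qed

end

definition pair_scale :: "'k::field \<Rightarrow> 'k poly \<times> 'k poly \<Rightarrow> 'k poly \<times> 'k poly" where
  "pair_scale c v = (Polynomial.smult c (fst v), Polynomial.smult c (snd v))"

lemma pair_scale_simps:
  "pair_scale (c + d) v = pair_scale c v + pair_scale d v"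
  "pair_scale c (v + w) = pair_scale c v + pair_scale c w"
  "pair_scale c (pair_scale d v) = pair_scale (c * d) v"
  "pair_scale 1 v = v" "pair_scale c 0 = 0"
  by (simp_all add: pair_scale_def prod_eq_iff Polynomial.smult_add_left Polynomial.smult_add_right)

definition pair_End :: "('k::field, 'k poly \<times> 'k poly \<Rightarrow> 'k poly \<times> 'k poly) module" where
  "pair_End =
    \<lparr>carrier = {F. (\<forall>v w. F (v + w) = F v + F w) \<and> (\<forall>c v. F (pair_scale c v) = pair_scale c (F v))},
     mult = (\<circ>), one = id, zero = (\<lambda>_. 0), add = (\<lambda>F F' v. F v + F' v), smult = (\<lambda>c F v. pair_scale c (F v))\<rparr>"

lemma pair_End_simps [simp]:
  "F \<in> carrier pair_End \<longleftrightarrow> (\<forall>v w. F (v + w) = F v + F w) \<and> (\<forall>c v. F (pair_scale c v) = pair_scale c (F v))"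
  "F \<otimes>\<^bsub>pair_End\<^esub> F' = F \<circ> F'" "\<one>\<^bsub>pair_End\<^esub> = id" "\<zero>\<^bsub>pair_End\<^esub> = (\<lambda>_. 0)"
  "F \<oplus>\<^bsub>pair_End\<^esub> F' = (\<lambda>v. F v + F' v)" "c \<odot>\<^bsub>pair_End\<^esub> F = (\<lambda>v. pair_scale c (F v))"
  by (simp_all add: pair_End_def)

lemma unital_algebra_pair_End: "unital_algebra (pair_End :: ('k::field, _) module)"
proof (rule unital_algebraI)
  show "ring (pair_End :: ('k::field, _) module)"
  proof (rule ringI)
    show "abelian_group (pair_End :: ('k::field, _) module)"
    proof (rule abelian_groupI)
      fix F assume "F \<in> carrier (pair_End :: ('k::field, _) module)"
      then show "\<exists>F'\<in>carrier pair_End. F' \<oplus>\<^bsub>pair_End\<^esub> F = \<zero>\<^bsub>pair_End\<^esub>"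
        by (intro bexI[of _ "\<lambda>v. - F v"]) (auto simp: pair_scale_def prod_eq_iff)
    qed (auto simp: pair_scale_simps algebra_simps)
    show "Group.monoid (pair_End :: ('k::field, _) module)"
      by (rule monoidI) (simp_all add: comp_assoc del: split_paired_All)
  qed (simp_all add: fun_eq_iff del: split_paired_All)
qed (simp_all add: pair_scale_simps fun_eq_iff mult.commute del: split_paired_All)

text \<open>Linear independence of the monomials \<open>g\<^sup>k x\<^sup>j\<close> is read off from a representation on \<open>k[X]\<^sup>2\<close>: the
  group-like \<open>g\<close> exchanges the two components, and \<open>x\<close> multiplies them by \<open>X\<close> and \<open>- X\<close>, the sign
  being forced by \<open>x g = - g x\<close>. Reducing modulo \<open>M = X\<^sup>2\<^sup>p - q\<^sup>p\<^sup>-\<^sup>1 X\<^sup>2\<close> enforces the relation between the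
  powers of \<open>x\<close>. The vector \<open>(1, 0)\<close> is sent by \<open>g\<^sup>k x\<^sup>j\<close> to \<open>X\<^sup>j\<close> in component \<open>k\<close>, and for
  \<open>j < 2 p\<close> nothing is reduced.\<close>

definition swap_pair :: "'k::field poly \<times> 'k poly \<Rightarrow> 'k poly \<times> 'k poly" where
  "swap_pair v = (snd v, fst v)"

definition mult_pair :: "'k::field poly \<Rightarrow> 'k poly \<Rightarrow> 'k poly \<times> 'k poly \<Rightarrow> 'k poly \<times> 'k poly" where
  "mult_pair M X v = ((X * fst v) mod M, (- X * snd v) mod M)"

lemma swap_pair_in: "swap_pair \<in> carrier pair_End"
  by (simp add: swap_pair_def pair_scale_def)

lemma mult_pair_in: "mult_pair M X \<in> carrier pair_End"
  by (simp add: mult_pair_def pair_scale_def distrib_left poly_mod_add_left mod_smult_left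
      poly_mod_diff_left poly_mod_minus_left)

lemma mult_pair_pow:
  "(mult_pair M X [^]\<^bsub>pair_End\<^esub> Suc n) v = ((X ^ Suc n * fst v) mod M, ((- X) ^ Suc n * snd v) mod M)"
proof (induction n arbitrary: v)
  case 0
  show ?case by (simp add: nat_pow_def mult_pair_def)
next
  case (Suc n)
  have "mult_pair M X [^]\<^bsub>pair_End\<^esub> Suc (Suc n) = mult_pair M X [^]\<^bsub>pair_End\<^esub> Suc n \<circ> mult_pair M X"
    by (simp add: nat_pow_def)
  then have "(mult_pair M X [^]\<^bsub>pair_End\<^esub> Suc (Suc n)) v =
      (mult_pair M X [^]\<^bsub>pair_End\<^esub> Suc n) (mult_pair M X v)" by simp
  also have "\<dots> = ((X ^ Suc n * (X * fst v)) mod M, ((- X) ^ Suc n * (- X * snd v)) mod M)"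
    unfolding Suc.IH by (simp only: mult_pair_def fst_conv snd_conv mod_mult_right_eq)
  also have "\<dots> = ((X ^ Suc (Suc n) * fst v) mod M, ((- X) ^ Suc (Suc n) * snd v) mod M)"
    by (simp only: power_Suc2 mult.assoc)
  finally show ?case .
qed

lemma pair_rels:
  shows "swap_pair \<otimes>\<^bsub>pair_End\<^esub> swap_pair = \<one>\<^bsub>pair_End\<^esub>"
    and "mult_pair M X \<otimes>\<^bsub>pair_End\<^esub> swap_pair \<oplus>\<^bsub>pair_End\<^esub>
      swap_pair \<otimes>\<^bsub>pair_End\<^esub> mult_pair M X = \<zero>\<^bsub>pair_End\<^esub>"
  by (simp_all add: fun_eq_iff swap_pair_def mult_pair_def prod_eq_iff poly_mod_minus_left)

lemma mult_pair_rel: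
  assumes "p > 0" and X: "X ^ (2 * p) = Polynomial.smult c (X ^ 2) + M"
  shows "mult_pair M X [^]\<^bsub>pair_End\<^esub> (2 * p) = c \<odot>\<^bsub>pair_End\<^esub> (mult_pair M X \<otimes>\<^bsub>pair_End\<^esub> mult_pair M X)"
proof
  fix v
  have *: "(X ^ (2 * p) * u) mod M = Polynomial.smult c ((X ^ 2 * u) mod M)" for u
    by (simp add: X distrib_right mod_smult_left)
  obtain n where n: "2 * p = Suc n" using assms(1) by (cases "2 * p") auto
  have "(mult_pair M X [^]\<^bsub>pair_End\<^esub> (2 * p)) v = ((X ^ (2 * p) * fst v) mod M, ((- X) ^ (2 * p) * snd v) mod M)"
    unfolding n by (rule mult_pair_pow)
  also have "\<dots> = pair_scale c ((X ^ 2 * fst v) mod M, ((- X) ^ 2 * snd v) mod M)"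
    by (simp add: * pair_scale_def)
  also have "((X ^ 2 * fst v) mod M, ((- X) ^ 2 * snd v) mod M) = (mult_pair M X [^]\<^bsub>pair_End\<^esub> Suc 1) v"
    unfolding mult_pair_pow by (simp only: numeral_2_eq_2 One_nat_def)
  also have "mult_pair M X [^]\<^bsub>pair_End\<^esub> Suc 1 = mult_pair M X \<otimes>\<^bsub>pair_End\<^esub> mult_pair M X"
    by (simp add: nat_pow_def)
  finally show "(mult_pair M X [^]\<^bsub>pair_End\<^esub> (2 * p)) v =
      (c \<odot>\<^bsub>pair_End\<^esub> (mult_pair M X \<otimes>\<^bsub>pair_End\<^esub> mult_pair M X)) v" by simp
qed

definition modulus :: "nat \<Rightarrow> 'k::field \<Rightarrow> 'k poly" where
  "modulus p q = Polynomial.monom 1 (2 * p) - Polynomial.monom (q ^ (p - 1)) 2"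

fun pair_action :: "nat \<Rightarrow> 'k::field \<Rightarrow> generator \<Rightarrow> 'k poly \<times> 'k poly \<Rightarrow> 'k poly \<times> 'k poly" where
  "pair_action p q Gen_g = swap_pair"
| "pair_action p q Gen_x = mult_pair (modulus p q) (Polynomial.monom 1 1)"

lemma pair_action_in: "pair_action p q s \<in> carrier pair_End"
  by (cases s) (simp_all add: swap_pair_in mult_pair_in del: pair_End_simps)

lemma pair_action_rels:
  assumes "p > 0"
  shows "pair_action p q Gen_g \<otimes>\<^bsub>pair_End\<^esub> pair_action p q Gen_g = \<one>\<^bsub>pair_End\<^esub>"
    and "pair_action p q Gen_x [^]\<^bsub>pair_End\<^esub> (2 * p) =
      q ^ (p - 1) \<odot>\<^bsub>pair_End\<^esub> (pair_action p q Gen_x \<otimes>\<^bsub>pair_End\<^esub> pair_action p q Gen_x)"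
    and "pair_action p q Gen_x \<otimes>\<^bsub>pair_End\<^esub> pair_action p q Gen_g \<oplus>\<^bsub>pair_End\<^esub>
      pair_action p q Gen_g \<otimes>\<^bsub>pair_End\<^esub> pair_action p q Gen_x = \<zero>\<^bsub>pair_End\<^esub>"
proof -
  have "Polynomial.monom (1::'a) 1 ^ (2 * p) =
      Polynomial.smult (q ^ (p - 1)) (Polynomial.monom 1 1 ^ 2) + modulus p q"
    by (simp add: modulus_def Polynomial.monom_power Polynomial.smult_monom)
  from mult_pair_rel[OF assms this]
  show "pair_action p q Gen_x [^]\<^bsub>pair_End\<^esub> (2 * p) =
      q ^ (p - 1) \<odot>\<^bsub>pair_End\<^esub> (pair_action p q Gen_x \<otimes>\<^bsub>pair_End\<^esub> pair_action p q Gen_x)"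
    by (simp del: pair_End_simps)
qed (simp_all add: pair_rels del: pair_End_simps)

context hopf_datum
begin

definition \<rho> where "\<rho> = (\<lambda>U. the_elem (free_lift pair_End (pair_action p q) ` U))"

lemma rho_hom: "\<rho> \<in> algebra_hom H pair_End"
  and rho_gen: "\<rho> (A_gen p q s) = pair_action p q s"
  unfolding \<rho>_def
  by (rule A_lift_algebra_hom[OF unital_algebra_pair_End pair_action_in pair_action_rels[OF p_pos]]
      A_lift_gen[OF unital_algebra_pair_End pair_action_in pair_action_rels[OF p_pos]])+

text \<open>The coordinate at \<open>g\<^sup>k x\<^sup>j\<close>, where the index \<open>i\<close> is the pair \<open>(k, j)\<close>.\<close>

definition coord :: "nat \<times> nat \<Rightarrow> _ \<Rightarrow> 'k" where
  "coord i a = Polynomial.coeff ((if fst i = 0 then fst else snd) (\<rho> a (1, 0))) (snd i)"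

definition e :: "nat \<times> nat \<Rightarrow> _" where
  "e i = g [^]\<^bsub>H\<^esub> fst i \<star> x [^]\<^bsub>H\<^esub> snd i"

definition Idx :: "(nat \<times> nat) set" where "Idx = {..<2} \<times> {..<2 * p}"

lemma e_in [simp]: "e i \<in> carrier H"
  by (simp add: e_def)

lemma coord_lin: "coord i \<in> lin H scalar_algebra"
  by (rule linI) (simp_all add: coord_def lin_add[OF algebra_hom_lin[OF rho_hom]]
      lin_smult[OF algebra_hom_lin[OF rho_hom]] pair_scale_def)

lemma degree_modulus: "Polynomial.degree (modulus p q) = 2 * p"
proof -
  have p: "2 < 2 * p" using prime_p odd_p prime_gt_1_nat by force
  have "Polynomial.degree (Polynomial.monom (q ^ (p - 1)) 2) < Polynomial.degree (Polynomial.monom (1::'k) (2 * p))"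
    using le_less_trans[OF Polynomial.degree_monom_le p] by (simp add: Polynomial.degree_monom_eq)
  then show ?thesis
    unfolding modulus_def diff_conv_add_uminus
    by (subst Polynomial.degree_add_eq_left) (simp_all add: Polynomial.degree_monom_eq)
qed

lemma rho_e: "snd i < 2 * p \<Longrightarrow> fst i < 2 \<Longrightarrow>
    \<rho> (e i) (1, 0) = (if fst i = 0 then (Polynomial.monom 1 (snd i), 0) else (0, Polynomial.monom 1 (snd i)))"
proof -
  assume i: "snd i < 2 * p" "fst i < 2"
  have "(pair_action p q Gen_x [^]\<^bsub>pair_End\<^esub> j) (1, 0) = (Polynomial.monom 1 j, 0)" if "j < 2 * p" for j
  proof (cases j)
    case 0
    then show ?thesis by (simp add: nat_pow_def)
  next
    case (Suc n)
    have "Polynomial.monom 1 (Suc n) mod modulus p q = Polynomial.monom 1 (Suc n)"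
      using that Suc by (intro mod_poly_less) (simp add: degree_modulus Polynomial.degree_monom_eq)
    moreover have "Polynomial.monom (1::'k) 1 ^ Suc n = Polynomial.monom 1 (Suc n)"
      by (simp only: Polynomial.monom_power power_one mult_1)
    ultimately show ?thesis
      unfolding Suc pair_action.simps mult_pair_pow by (simp del: power_Suc)
  qed
  moreover have "\<rho> (e i) = pair_action p q Gen_g [^]\<^bsub>pair_End\<^esub> fst i \<circ> pair_action p q Gen_x [^]\<^bsub>pair_End\<^esub> snd i"
    by (simp add: e_def algebra_hom_mult[OF rho_hom] algebra_hom_pow[OF rho_hom UH] rho_gen)
  moreover have "fst i = 0 \<or> fst i = 1" using i by auto
  ultimately show ?thesis using i by (auto simp: nat_pow_def swap_pair_def)
qed

lemma coord_e:
  assumes "i \<in> Idx" "j \<in> Idx"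
  shows "coord i (e j) = (if i = j then 1 else 0)"
  using assms by (auto simp: coord_def rho_e Idx_def prod_eq_iff less_2_cases_iff)

lemma x_e:
  assumes "k < 2"
  shows "x \<star> e (k, j) = (- 1) ^ k \<cdot> e (k, Suc j)"
proof -
  have x: "x \<star> x [^]\<^bsub>H\<^esub> j = x [^]\<^bsub>H\<^esub> Suc j" by (simp only: H.nat_pow_Suc2 A_gen_in)
  have "k = 0 \<or> k = 1" using assms by auto
  then show ?thesis
  proof
    assume "k = 1"
    have "x \<star> (g \<star> x [^]\<^bsub>H\<^esub> j) = (x \<star> g) \<star> x [^]\<^bsub>H\<^esub> j"
      by (simp add: H.m_assoc)
    also have "\<dots> = \<ominus>\<^bsub>H\<^esub> (g \<star> (x \<star> x [^]\<^bsub>H\<^esub> j))"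
      by (simp add: xg H.l_minus H.m_assoc)
    finally show ?thesis using \<open>k = 1\<close> x by (simp add: e_def H.smult_m1 del: H.nat_pow_Suc)
  qed (simp add: e_def x)
qed

lemma g_e:
  assumes "k < 2"
  shows "g \<star> e (k, j) = e (1 - k, j)"
proof -
  have "g \<star> (g \<star> x [^]\<^bsub>H\<^esub> j) = x [^]\<^bsub>H\<^esub> j" by (simp add: H.m_assoc[symmetric] gg)
  moreover have "k = 0 \<or> k = 1" using assms by auto
  ultimately show ?thesis by (auto simp: e_def)
qed

lemma e_wrap: "e (k, 2 * p) = q ^ (p - 1) \<cdot> e (k, 2)"
proof -
  have "x [^]\<^bsub>H\<^esub> (2::nat) = x \<star> x" by (simp add: numeral_2_eq_2)
  then show ?thesis by (simp add: e_def x_pow H.smult_mult_right)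
qed

text \<open>The span contains \<open>1\<close> and is stable under left multiplication by the generators: these send monomials to
  multiples of monomials, where \<open>x\<^sup>2\<^sup>p\<close> is rewritten to a multiple of \<open>x\<^sup>2\<close>.\<close>

lemma e_span: "lspan H (e ` Idx) = carrier H"
proof
  have sub: "e ` Idx \<subseteq> carrier H" by auto
  note L = H.lspan_zero[OF sub] H.lspan_add[OF sub] H.lspan_smult[OF sub] H.lspan_gen[OF sub]
  show "lspan H (e ` Idx) \<subseteq> carrier H" by (rule H.lspan_closed[OF sub])
  have gen: "A_gen p q s \<star> e (k, j) \<in> lspan H (e ` Idx)" if "(k, j) \<in> Idx" for s k j
  proof (cases s)
    case Gen_g
    then show ?thesis using that L(4) by (auto simp: g_e Idx_def)
  next
    case Gen_x
    have "e (k, Suc j) \<in> lspan H (e ` Idx)"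
    proof (cases "Suc j = 2 * p")
      case True
      have "(k, 2) \<in> Idx" using that prime_gt_1_nat[OF prime_p] by (auto simp: Idx_def)
      then show ?thesis unfolding True e_wrap using L(3,4) by auto
    next
      case False
      then show ?thesis using that L(4) by (auto simp: Idx_def)
    qed
    then show ?thesis using Gen_x that L(3) by (auto simp: x_e Idx_def)
  qed
  have mult: "A_gen p q s \<star> a \<in> lspan H (e ` Idx)" if "a \<in> lspan H (e ` Idx)" for s a
    using that sub
    by (induction rule: H.lspan_induct) (auto simp: L H.r_distr H.smult_mult_right gen)
  have "word_prod H (A_gen p q) w \<in> lspan H (e ` Idx)" for w
  proof (induction w)
    case Nil
    have "(0, 0) \<in> Idx" using p_pos by (simp add: Idx_def)
    then have "e (0, 0) \<in> lspan H (e ` Idx)" using L(4) by blast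
    then show ?case by (simp add: e_def)
  qed (simp add: mult)
  then have w: "range (word_prod H (A_gen p q)) \<subseteq> lspan H (e ` Idx)" by blast
  have "LinearCombinations.submodule class_ring (lspan H (e ` Idx)) H"
    by (rule H.vs.span_is_submodule[OF sub])
  from H.vs.span_is_subset[OF w this] show "carrier H \<subseteq> lspan H (e ` Idx)"
    by (simp add: A_lspan_words)
qed

lemma finite_Idx: "finite Idx"
  by (simp add: Idx_def)

lemmas coord_eqI = H.eq_if_coordinates_eq[OF finite_Idx e_in e_span coord_lin coord_e]

lemma A_hopf_dim:
  "vectorspace.fin_dim class_ring K" "vectorspace.dim class_ring K = 4 * p"
proof -
  interpret K: unital_alg K by (rule unital_alg.intro) (rule unital_algebra_hopf)
  have sub: "e ` Idx \<subseteq> carrier H" by auto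
  have "lspan K (e ` Idx) = carrier K"
  proof
    show "lspan K (e ` Idx) \<subseteq> carrier K" by (rule K.lspan_closed) auto
    have "(\<lambda>a. a) \<in> lin H K" unfolding A_hopf_same by (rule lin_id)
    from lin_image_lspan[OF this UH unital_algebra_hopf sub] show "carrier K \<subseteq> lspan K (e ` Idx)"
      by (auto simp: e_span)
  qed
  moreover have "coord i \<in> lin K scalar_algebra" for i
    unfolding A_hopf_same by (rule coord_lin)
  ultimately have *: "K.vs.fin_dim" "K.vs.dim = card Idx"
    using K.dim_if_dual_basis[of Idx e coord] finite_Idx coord_e by auto
  show "vectorspace.fin_dim class_ring K" "vectorspace.dim class_ring K = 4 * p"
    using * by (simp_all add: Idx_def)
qed

end

section \<open>Group-likes and skew-primitives of \<open>A\<^sub>(\<^sub>q\<^sub>)\<close>\<close>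

lemma lin_finsum:
  assumes f: "f \<in> lin A B" and A: "unital_algebra A" and B: "unital_algebra B"
    and "finite I" "\<And>i. i \<in> I \<Longrightarrow> h i \<in> carrier A"
  shows "f (\<Oplus>\<^bsub>A\<^esub>i\<in>I. h i) = (\<Oplus>\<^bsub>B\<^esub>i\<in>I. f (h i))"
proof -
  interpret A: unital_alg A by (rule unital_alg.intro) fact
  interpret B: unital_alg B by (rule unital_alg.intro) fact
  show ?thesis using assms(4,5)
  proof (induction I rule: finite_induct)
    case (insert i I)
    then show ?case by (simp add: Pi_def lin_add[OF f] lin_closed[OF f])
  qed (simp add: lin_zero[OF f A B])
qed

lemma of_nat_neq_0_if_less_prime_char:
  assumes "prime p" "of_nat p = (0::'k::field)" "0 < n" "n < p"
  shows "of_nat n \<noteq> (0::'k)"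
proof
  assume "of_nat n = (0::'k)"
  then have "CHAR('k) dvd n" "CHAR('k) dvd p" using assms(2) by (simp_all add: of_nat_eq_0_iff_char_dvd)
  then show False using assms(1,3,4) CHAR_not_1'[where 'a = 'k] by (metis One_nat_def dvd_imp_le leD prime_nat_iff)
qed

context hopf_datum
begin

abbreviation "y \<equiv> x \<star> x"

lemma y_pow_g: "y [^]\<^bsub>H\<^esub> (m::nat) \<star> g = g \<star> y [^]\<^bsub>H\<^esub> m"
proof (induction m)
  case (Suc m)
  have "y [^]\<^bsub>H\<^esub> Suc m \<star> g = y [^]\<^bsub>H\<^esub> m \<star> (y \<star> g)"
    by (simp add: H.m_assoc)
  also have "\<dots> = (y [^]\<^bsub>H\<^esub> m \<star> g) \<star> y"
    by (subst square_x_central) (simp add: H.m_assoc)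
  also have "\<dots> = g \<star> y [^]\<^bsub>H\<^esub> Suc m"
    unfolding Suc by (simp add: H.m_assoc)
  finally show ?case .
qed simp

lemma y_pow: "y [^]\<^bsub>H\<^esub> (m::nat) = x [^]\<^bsub>H\<^esub> (2 * m)"
  using H.nat_pow_pow[of x 2 m] by (simp add: numeral_2_eq_2)

lemma
  shows e_even: "g [^]\<^bsub>H\<^esub> k \<star> y [^]\<^bsub>H\<^esub> m = e (k, 2 * m)"
    and e_odd: "g [^]\<^bsub>H\<^esub> k \<star> (y [^]\<^bsub>H\<^esub> m \<star> x) = e (k, Suc (2 * m))"
  by (simp_all add: e_def y_pow)

lemma e_even_g: "k < 2 \<Longrightarrow> g [^]\<^bsub>H\<^esub> k \<star> (y [^]\<^bsub>H\<^esub> m \<star> g) = e (1 - k, 2 * m)"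
proof -
  assume "k < 2"
  then have "k = 0 \<or> k = 1" by auto
  moreover have "g \<star> (g \<star> y [^]\<^bsub>H\<^esub> m) = y [^]\<^bsub>H\<^esub> m" by (simp add: H.m_assoc[symmetric] gg)
  ultimately show ?thesis by (auto simp: y_pow_g simp flip: e_even)
qed

lemma comult_y_pow:
  "\<Delta> (y [^]\<^bsub>H\<^esub> m) = (\<Oplus>\<^bsub>HH\<^esub>i\<in>{..m}. of_nat (m choose i) \<odot>\<^bsub>HH\<^esub> pure (y [^]\<^bsub>H\<^esub> i) (y [^]\<^bsub>H\<^esub> (m - i)))"
proof -
  have "\<Delta> (y [^]\<^bsub>H\<^esub> m) = (pure y \<one>\<^bsub>H\<^esub> \<oplus>\<^bsub>HH\<^esub> pure \<one>\<^bsub>H\<^esub> y) [^]\<^bsub>HH\<^esub> m"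
    by (simp add: algebra_hom_pow[OF comult_hom UH] algebra_hom_mult[OF comult_hom] comult_gen
        A_comult_gen_x_square del: A_comult_gen.simps)
  also have "\<dots> = (\<Oplus>\<^bsub>HH\<^esub>i\<in>{..m}. of_nat (m choose i) \<odot>\<^bsub>HH\<^esub>
      (pure y \<one>\<^bsub>H\<^esub> [^]\<^bsub>HH\<^esub> i \<star>\<star> pure \<one>\<^bsub>H\<^esub> y [^]\<^bsub>HH\<^esub> (m - i)))"
    by (rule HH.binomial_commuting) (simp_all add: pure_mult)
  finally show ?thesis by (simp add: pure_pow pure_mult)
qed

text \<open>Used with maps that kill all summands of the binomial expansion of \<open>\<Delta>(y\<^sup>m)\<close> but the \<open>n\<close>-th. For \<open>n > m\<close> no summand survives, in accordance with \<open>m choose n = 0\<close>.\<close>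

lemma lin_comult_y_pow:
  assumes F: "F \<in> lin HH H" and b: "b \<in> carrier H"
    and pick: "\<And>i. i \<le> m \<Longrightarrow> F (pure (y [^]\<^bsub>H\<^esub> i) (y [^]\<^bsub>H\<^esub> (m - i))) = (if i = n then b else \<zero>\<^bsub>H\<^esub>)"
  shows "F (\<Delta> (y [^]\<^bsub>H\<^esub> m)) = of_nat (m choose n) \<cdot> b"
proof -
  have "F (\<Delta> (y [^]\<^bsub>H\<^esub> m)) =
      (\<Oplus>\<^bsub>H\<^esub>i\<in>{..m}. F (of_nat (m choose i) \<odot>\<^bsub>HH\<^esub> pure (y [^]\<^bsub>H\<^esub> i) (y [^]\<^bsub>H\<^esub> (m - i))))"
    unfolding comult_y_pow by (rule lin_finsum[OF F UHH UH]) simp_all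
  also have "\<dots> = (\<Oplus>\<^bsub>H\<^esub>i\<in>{..m}. if n = i then of_nat (m choose i) \<cdot> b else \<zero>\<^bsub>H\<^esub>)"
    by (rule H.add.finprod_cong') (use b in \<open>auto simp: lin_smult[OF F] pick\<close>)
  also have "\<dots> = of_nat (m choose n) \<cdot> b"
  proof (cases "n \<le> m")
    case True
    then show ?thesis using b by (intro H.add.finprod_singleton) auto
  next
    case False
    have "(\<Oplus>\<^bsub>H\<^esub>i\<in>{..m}. if n = i then of_nat (m choose i) \<cdot> b else \<zero>\<^bsub>H\<^esub>) = (\<Oplus>\<^bsub>H\<^esub>i\<in>{..m}. \<zero>\<^bsub>H\<^esub>)"
      by (rule H.add.finprod_cong') (use False in auto)
    then show ?thesis using False b by (simp add: binomial_eq_0)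
  qed
  finally show ?thesis .
qed

text \<open>The coefficient of \<open>x\<^sup>j\<close> after substituting \<open>g = 1\<close>. Contracting the left leg of \<open>\<Delta>\<close> with it gives an
  operator \<open>slice j\<close> which, for \<open>j = 1\<close>, lowers odd powers of \<open>x\<close> and kills even ones, and which for \<open>j = 2\<close>
  differentiates with respect to \<open>y = x\<^sup>2\<close>. These two nilpotent operators are all that is used of the
  comultiplication to find the group-like and skew-primitive elements.\<close>

definition xcoeff :: "nat \<Rightarrow> _ \<Rightarrow> 'k" where
  "xcoeff j a = coord (0, j) a + coord (1, j) a"

definition slice where
  "slice j a = tensor_lift H (\<lambda>a b. xcoeff j a \<cdot> b) (\<Delta> a)"

lemma xcoeff_lin: "xcoeff j \<in> lin H scalar_algebra"
  by (rule linI) (simp_all add: xcoeff_def lin_add[OF coord_lin] lin_smult[OF coord_lin] algebra_simps)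

lemma xcoeff_e: "k < 2 \<Longrightarrow> l < 2 * p \<Longrightarrow> j < 2 * p \<Longrightarrow> xcoeff j (e (k, l)) = (if l = j then 1 else 0)"
  by (auto simp: xcoeff_def coord_e Idx_def less_2_cases_iff)

lemma bilin_xcoeff: "bilin H H H (\<lambda>a b. xcoeff j a \<cdot> b)"
proof -
  have "(\<lambda>a. xcoeff j a \<cdot> b) \<in> lin H H" "(\<lambda>b. xcoeff j a \<cdot> b) \<in> lin H H" if "b \<in> carrier H" for a b
    by (rule linI; use that in \<open>simp add: lin_add[OF xcoeff_lin] lin_smult[OF xcoeff_lin]
        H.smult_add_scalar H.smult_add H.smult_smult mult.commute\<close>)+
  then show ?thesis by (auto intro!: bilinI)
qed

lemmas xcoeff_tensor_lin = tensor_lift_lin[OF UH UH UH bilin_xcoeff]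
lemmas xcoeff_tensor_pure = tensor_lift_pure[OF UH UH UH bilin_xcoeff]

lemma slice_lin: "slice j \<in> lin H H"
  unfolding slice_def[abs_def] by (rule lin_comp[OF algebra_hom_lin[OF comult_hom] xcoeff_tensor_lin])

lemma slice_even:
  assumes "k < 2" "m < p" "j < 2 * p"
  shows "slice j (e (k, 2 * m)) = (if even j then of_nat (m choose (j div 2)) \<cdot> e (k, 2 * m - j) else \<zero>\<^bsub>H\<^esub>)"
proof -
  let ?L = "tensor_lift H (\<lambda>a b. xcoeff j a \<cdot> b)" and ?g = "g [^]\<^bsub>H\<^esub> k"
  have F: "(\<lambda>t. ?L (pure ?g ?g \<star>\<star> t)) \<in> lin HH H"
    by (rule lin_comp[OF lin_mult_left[OF UHH lin_id] xcoeff_tensor_lin]) simp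
  have "slice j (e (k, 2 * m)) = ?L (pure ?g ?g \<star>\<star> \<Delta> (y [^]\<^bsub>H\<^esub> m))"
    by (simp add: slice_def algebra_hom_mult[OF comult_hom] algebra_hom_pow[OF comult_hom UH] comult_g
        pure_pow flip: e_even)
  also have "\<dots> = of_nat (m choose (if even j then j div 2 else Suc m)) \<cdot> e (k, 2 * m - j)"
  proof (rule lin_comult_y_pow[OF F])
    fix i assume "i \<le> m"
    then show "?L (pure ?g ?g \<star>\<star> pure (y [^]\<^bsub>H\<^esub> i) (y [^]\<^bsub>H\<^esub> (m - i))) =
        (if i = (if even j then j div 2 else Suc m) then e (k, 2 * m - j) else \<zero>\<^bsub>H\<^esub>)"
      using assms by (auto simp: pure_mult xcoeff_tensor_pure e_even xcoeff_e diff_mult_distrib2)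
  qed simp
  finally show ?thesis by (auto simp: binomial_eq_0)
qed

lemma slice_odd:
  assumes "k < 2" "m < p" "j < 2 * p"
  shows "slice j (e (k, Suc (2 * m))) = of_nat (m choose (j div 2)) \<cdot> e (k, Suc (2 * m) - j)"
proof -
  let ?L = "tensor_lift H (\<lambda>a b. xcoeff j a \<cdot> b)" and ?g = "g [^]\<^bsub>H\<^esub> k"
  have F: "(\<lambda>t. ?L (pure ?g ?g \<star>\<star> (t \<star>\<star> \<Delta> x))) \<in> lin HH H"
    by (rule lin_comp[OF lin_comp[OF lin_mult_right[OF UHH lin_id] lin_mult_left[OF UHH lin_id]] xcoeff_tensor_lin])
      (simp_all add: comult_x)
  have "slice j (e (k, Suc (2 * m))) = ?L (pure ?g ?g \<star>\<star> (\<Delta> (y [^]\<^bsub>H\<^esub> m) \<star>\<star> \<Delta> x))"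
    by (simp add: slice_def algebra_hom_mult[OF comult_hom] algebra_hom_pow[OF comult_hom UH] comult_g
        pure_pow flip: e_odd)
  also have "\<dots> = of_nat (m choose (j div 2)) \<cdot> e (k, Suc (2 * m) - j)"
  proof (rule lin_comult_y_pow[OF F])
    fix i assume i: "i \<le> m"
    let ?a = "y [^]\<^bsub>H\<^esub> i" and ?b = "y [^]\<^bsub>H\<^esub> (m - i)"
    have "?L (pure ?g ?g \<star>\<star> (pure ?a ?b \<star>\<star> \<Delta> x)) =
        xcoeff j (e (k, Suc (2 * i))) \<cdot> e (k, 2 * (m - i)) \<oplus>\<^bsub>H\<^esub>
        xcoeff j (e (1 - k, 2 * i)) \<cdot> e (k, Suc (2 * (m - i)))"
      using assms(1) by (simp add: comult_x HH.r_distr pure_mult lin_add[OF xcoeff_tensor_lin] xcoeff_tensor_pure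
          e_even e_odd e_even_g)
    also have "\<dots> = (if i = j div 2 then e (k, Suc (2 * m) - j) else \<zero>\<^bsub>H\<^esub>)"
    proof -
      have "Suc (2 * i) < 2 * p" "2 * i < 2 * p" using i assms(2) by auto
      then have 1: "xcoeff j (e (k, Suc (2 * i))) = (if Suc (2 * i) = j then 1 else 0)"
        and 2: "xcoeff j (e (1 - k, 2 * i)) = (if 2 * i = j then 1 else 0)"
        using assms(1,3) by (simp_all add: xcoeff_e)
      consider l where "j = 2 * l" | l where "j = Suc (2 * l)" by (metis evenE oddE Suc_eq_plus1)
      then show ?thesis
      proof cases
        case 1
        then have "Suc (2 * i) \<noteq> j" by presburger
        moreover have "Suc (2 * (m - i)) = Suc (2 * m) - 2 * i" using i by simp
        ultimately show ?thesis using 1 2 \<open>xcoeff j (e (k, Suc (2 * i))) = _\<close> by auto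
      next
        case 2
        then have "2 * i \<noteq> j" by presburger
        moreover have "2 * (m - i) = Suc (2 * m) - Suc (2 * i)" using i by simp
        ultimately show ?thesis using 2 1 \<open>xcoeff j (e (1 - k, 2 * i)) = _\<close> by auto
      qed
    qed
    finally show "?L (pure ?g ?g \<star>\<star> (pure ?a ?b \<star>\<star> \<Delta> x)) =
        (if i = j div 2 then e (k, Suc (2 * m) - j) else \<zero>\<^bsub>H\<^esub>)" .
  qed simp
  finally show ?thesis .
qed

lemma p_ge_3: "p \<ge> 3"
  using prime_ge_2_nat[OF prime_p] odd_p by (cases "p = 2") auto

lemma slice_1_e: "(k, j) \<in> Idx \<Longrightarrow> slice 1 (e (k, j)) = (if odd j then e (k, j - 1) else \<zero>\<^bsub>H\<^esub>)"
  using slice_even[of k "j div 2" 1] slice_odd[of k "j div 2" 1] p_ge_3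
  by (cases "even j") (auto simp: Idx_def elim!: evenE oddE)

lemma slice_2_e: "(k, j) \<in> Idx \<Longrightarrow> slice 2 (e (k, j)) = of_nat (j div 2) \<cdot> e (k, j - 2)"
  using slice_even[of k "j div 2" 2] slice_odd[of k "j div 2" 2] p_ge_3
  by (cases "even j") (auto simp: Idx_def elim!: evenE oddE)

lemma lin_functional_eqI:
  assumes "\<phi> \<in> lin H scalar_algebra" "\<psi> \<in> lin H scalar_algebra" "a \<in> carrier H"
    and "\<And>i. i \<in> Idx \<Longrightarrow> \<phi> (e i) = \<psi> (e i)"
  shows "\<phi> a = \<psi> a"
  by (rule lin_eqI[OF assms(1,2) UH unital_algebra_scalar _ assms(3)[folded e_span]]) (use assms(4) in auto)

lemma coord_slice_1:
  assumes "a \<in> carrier H" "(k, j) \<in> Idx"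
  shows "coord (k, j) (slice 1 a) = (if even j then coord (k, Suc j) a else 0)"
proof (rule lin_functional_eqI[OF lin_comp[OF slice_lin coord_lin] _ assms(1)])
  show "(\<lambda>a. if even j then coord (k, Suc j) a else 0) \<in> lin H scalar_algebra"
    by (rule linI) (simp_all add: lin_add[OF coord_lin] lin_smult[OF coord_lin])
  fix i assume i: "i \<in> Idx"
  obtain k' j' where kj: "i = (k', j')" by (cases i)
  have 1: "even j \<Longrightarrow> (k, Suc j) \<in> Idx" and 2: "(k', j' - 1) \<in> Idx"
    using assms(2) i kj by (auto simp: Idx_def elim!: evenE)
  show "coord (k, j) (slice 1 (e i)) = (if even j then coord (k, Suc j) (e i) else 0)"
    using i 1 2 assms(2) unfolding kj
    by (cases "odd j'") (auto simp: slice_1_e coord_e lin_zero[OF coord_lin UH unital_algebra_scalar, simplified]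
        simp del: One_nat_def elim!: oddE)
qed

lemma coord_slice_2:
  assumes "a \<in> carrier H" "(k, j) \<in> Idx"
  shows "coord (k, j) (slice 2 a) = of_nat (Suc (j div 2)) * (if j + 2 < 2 * p then coord (k, j + 2) a else 0)"
proof (rule lin_functional_eqI[OF lin_comp[OF slice_lin coord_lin] _ assms(1)])
  show "(\<lambda>a. of_nat (Suc (j div 2)) * (if j + 2 < 2 * p then coord (k, j + 2) a else 0)) \<in> lin H scalar_algebra"
    by (rule linI) (simp_all add: lin_add[OF coord_lin] lin_smult[OF coord_lin] algebra_simps)
  fix i assume i: "i \<in> Idx"
  obtain k' j' where kj: "i = (k', j')" by (cases i)
  have 1: "j + 2 < 2 * p \<Longrightarrow> (k, j + 2) \<in> Idx" and 2: "(k', j' - 2) \<in> Idx"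
    using assms(2) i kj by (auto simp: Idx_def)
  have "coord (k, j) (slice 2 (e i)) = of_nat (j' div 2) * (if k = k' \<and> j = j' - 2 then 1 else 0)"
    using i 2 assms(2) unfolding kj by (simp add: slice_2_e lin_smult[OF coord_lin] coord_e)
  also have "\<dots> = of_nat (Suc (j div 2)) * (if j + 2 < 2 * p \<and> k = k' \<and> j + 2 = j' then 1 else 0)"
  proof (cases "j' < 2")
    case False
    then have "j = j' - 2 \<longleftrightarrow> j + 2 = j'" and "j + 2 = j' \<Longrightarrow> j' div 2 = Suc (j div 2)" by auto
    then show ?thesis using i kj by (auto simp: Idx_def)
  qed auto
  also have "\<dots> = of_nat (Suc (j div 2)) * (if j + 2 < 2 * p then coord (k, j + 2) (e i) else 0)"
    using i 1 unfolding kj by (auto simp: coord_e)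
  finally show "coord (k, j) (slice 2 (e i)) =
      of_nat (Suc (j div 2)) * (if j + 2 < 2 * p then coord (k, j + 2) (e i) else 0)" .
qed

lemma of_nat_index_neq_0:
  assumes "j + 2 < 2 * p"
  shows "of_nat (Suc (j div 2)) \<noteq> (0::'k)"
  by (rule of_nat_neq_0_if_less_prime_char[OF prime_p char_p]) (use assms in auto)

lemma two_neq_0: "(2::'k) \<noteq> 0"
  using of_nat_neq_0_if_less_prime_char[OF prime_p char_p, of 2] p_ge_3 by simp

lemma coord_zero: "coord i \<zero>\<^bsub>H\<^esub> = 0"
  using lin_zero[OF coord_lin UH unital_algebra_scalar] by simp

text \<open>A group-like element \<open>G\<close> is an eigenvector of \<open>slice 1\<close> and \<open>slice 2\<close>. Both lower the degree in \<open>x\<close>, so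
  the eigenvalues vanish, and the common kernel is spanned by \<open>1\<close> and \<open>g\<close>: the coefficients \<open>1, \<dots>, p - 1\<close>
  produced by differentiation are invertible in characteristic \<open>p\<close>.\<close>

lemma grouplike_span:
  assumes G: "G \<in> carrier H" "G \<noteq> \<zero>\<^bsub>H\<^esub>" and comult: "\<Delta> G = pure G G"
  shows "G = coord (0, 0) G \<cdot> \<one>\<^bsub>H\<^esub> \<oplus>\<^bsub>H\<^esub> coord (1, 0) G \<cdot> g"
proof -
  let ?c = "\<lambda>k j. coord (k, j) G"
  have slice: "slice j G = xcoeff j G \<cdot> G" for j
    using G by (simp add: slice_def comult xcoeff_tensor_pure)
  have s1: "(if even j then ?c k (Suc j) else 0) = xcoeff 1 G * ?c k j" if "(k, j) \<in> Idx" for k j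
    using coord_slice_1[OF G(1) that] G by (simp add: slice lin_smult[OF coord_lin])
  have s2: "of_nat (Suc (j div 2)) * (if j + 2 < 2 * p then ?c k (j + 2) else 0) = xcoeff 2 G * ?c k j"
    if "(k, j) \<in> Idx" for k j
    using coord_slice_2[OF G(1) that] G by (simp add: slice lin_smult[OF coord_lin])
  have nonzero: "\<exists>(k, j)\<in>Idx. ?c k j \<noteq> 0"
  proof (rule ccontr)
    assume "\<not> ?thesis"
    then have "G = \<zero>\<^bsub>H\<^esub>" using G by (intro coord_eqI) (auto simp: coord_zero)
    then show False using G by simp
  qed
  have h: "xcoeff 2 G = 0"
  proof (rule ccontr)
    assume h: "xcoeff 2 G \<noteq> 0"
    have "?c k j = 0" if "(k, j) \<in> Idx" for k j
      using that
    proof (induction "2 * p - j" arbitrary: j rule: less_induct)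
      case less
      have "(if j + 2 < 2 * p then ?c k (j + 2) else 0) = 0"
        using less by (auto simp: Idx_def)
      then show ?case using s2[OF less(2)] h by (auto split: if_splits)
    qed
    then show False using nonzero by auto
  qed
  have c2: "?c k j = 0" if "(k, j) \<in> Idx" "j \<ge> 2" for k j
  proof -
    obtain l where l: "j = l + 2" using \<open>j \<ge> 2\<close> by (metis le_add_diff_inverse2)
    then show ?thesis using s2[of k l] that h of_nat_index_neq_0[of l] by (auto simp: Idx_def)
  qed
  have p: "2 * p > 1" using p_ge_3 by simp
  have d: "xcoeff 1 G = 0"
  proof (rule ccontr)
    assume d: "xcoeff 1 G \<noteq> 0"
    have "?c k 0 = 0" "?c k 1 = 0" if "k < 2" for k
      using s1[of k 0] s1[of k 1] d that p by (auto simp: Idx_def)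
    then have "?c k j = 0" if "(k, j) \<in> Idx" for k j
      using that c2[OF that] by (cases "j = 0 \<or> j = 1") (auto simp: Idx_def)
    then show False using nonzero by auto
  qed
  have c1: "?c k 1 = 0" if "k < 2" for k
    using s1[of k 0] d that p by (auto simp: Idx_def)
  have "G = coord (0, 0) G \<cdot> e (0, 0) \<oplus>\<^bsub>H\<^esub> coord (1, 0) G \<cdot> e (1, 0)"
  proof (rule coord_eqI)
    fix i assume i: "i \<in> Idx"
    obtain k j where kj: "i = (k, j)" by (cases i)
    have "(0, 0) \<in> Idx" "(1, 0) \<in> Idx" using p_pos by (auto simp: Idx_def)
    moreover have "j = 0 \<or> ?c k j = 0"
      using c1[of k] c2[of k j] i kj by (cases "j = 0 \<or> j = 1") (auto simp: Idx_def)
    ultimately show "coord i G = coord i (coord (0, 0) G \<cdot> e (0, 0) \<oplus>\<^bsub>H\<^esub> coord (1, 0) G \<cdot> e (1, 0))"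
      using i unfolding kj
      by (auto simp: lin_add[OF coord_lin] lin_smult[OF coord_lin] coord_e Idx_def less_2_cases_iff)
  qed (use G in auto)
  then show ?thesis by (simp add: e_def)
qed

text \<open>With \<open>G = a + b g\<close> the conditions read \<open>a + b = 1\<close> and, comparing the coefficients of \<open>g\<close> in
  \<open>G\<^sup>2 = 1\<close>, \<open>2 a b = 0\<close>.\<close>

lemma grouplike_cases:
  assumes G: "G \<in> carrier H" and comult: "\<Delta> G = pure G G" and counit: "\<epsilon> G = 1"
    and square: "G \<star> G = \<one>\<^bsub>H\<^esub>"
  shows "G = \<one>\<^bsub>H\<^esub> \<or> G = g"
proof -
  let ?a = "coord (0, 0) G" and ?b = "coord (1, 0) G"
  have "G \<noteq> \<zero>\<^bsub>H\<^esub>" using counit lin_zero[OF algebra_hom_lin[OF counit_hom] UH unital_algebra_scalar] by auto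
  from grouplike_span[OF G this comult]
  have G': "G = ?a \<cdot> \<one>\<^bsub>H\<^esub> \<oplus>\<^bsub>H\<^esub> ?b \<cdot> g" .
  have "\<epsilon> (?a \<cdot> \<one>\<^bsub>H\<^esub> \<oplus>\<^bsub>H\<^esub> ?b \<cdot> g) = ?a + ?b"
    by (simp add: lin_add[OF algebra_hom_lin[OF counit_hom]] lin_smult[OF algebra_hom_lin[OF counit_hom]]
        counit_gen algebra_hom_one[OF counit_hom, simplified])
  then have ab: "?a + ?b = 1" using counit G' by metis
  have e01: "e (0, 0) = \<one>\<^bsub>H\<^esub>" "e (1, 0) = g" by (simp_all add: e_def)
  have idx: "(0, 0) \<in> Idx" "(1, 0) \<in> Idx" using p_pos by (auto simp: Idx_def)
  have "coord (1, 0) ((?a \<cdot> \<one>\<^bsub>H\<^esub> \<oplus>\<^bsub>H\<^esub> ?b \<cdot> g) \<star> (?a \<cdot> \<one>\<^bsub>H\<^esub> \<oplus>\<^bsub>H\<^esub> ?b \<cdot> g)) = 2 * (?a * ?b)"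
    using coord_e[OF idx(2,1)] coord_e[OF idx(2,2)]
    by (simp add: H.l_distr H.r_distr H.smult_mult_left H.smult_mult_right H.smult_smult gg
        lin_add[OF coord_lin] lin_smult[OF coord_lin] e01 del: One_nat_def)
  moreover have "coord (1, 0) (G \<star> G) = 0" using coord_e[OF idx(2,1)] by (simp add: square e01 del: One_nat_def)
  ultimately have "2 * (?a * ?b) = 0" using G' by metis
  then have "?a = 0 \<and> ?b = 1 \<or> ?a = 1 \<and> ?b = 0" using two_neq_0 ab by auto
  then have "?a \<cdot> \<one>\<^bsub>H\<^esub> \<oplus>\<^bsub>H\<^esub> ?b \<cdot> g = \<one>\<^bsub>H\<^esub> \<or> ?a \<cdot> \<one>\<^bsub>H\<^esub> \<oplus>\<^bsub>H\<^esub> ?b \<cdot> g = g"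
    by (elim disjE conjE) simp_all
  then show ?thesis using G' by metis
qed

text \<open>Here \<open>slice 1\<close> and \<open>slice 2\<close> map \<open>Y\<close> to scalars, which leaves \<open>Y = a + b g + c x + d x\<^sup>2\<close>. As \<open>1\<close>, \<open>g\<close> and
  \<open>x\<^sup>2\<close> commute with \<open>g\<close> and \<open>2\<close> is invertible, anticommutation with \<open>g\<close> removes all terms but \<open>c x\<close>.\<close>

lemma anticommuting_skew_primitive:
  assumes Y: "Y \<in> carrier H" and comult: "\<Delta> Y = pure Y \<one>\<^bsub>H\<^esub> \<oplus>\<^bsub>HH\<^esub> pure g Y"
    and anti: "Y \<star> g = \<ominus>\<^bsub>H\<^esub> (g \<star> Y)"
  shows "Y = coord (0, 1) Y \<cdot> x"
proof -
  let ?c = "\<lambda>k j. coord (k, j) Y"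
  have p: "2 * p > 2" "2 * p > 1" using p_ge_3 by simp_all
  have idx: "(0, 0) \<in> Idx" "(1, 0) \<in> Idx" "(0, 1) \<in> Idx" "(0, 2) \<in> Idx" "(1, 1) \<in> Idx" "(1, 2) \<in> Idx"
    using p by (auto simp: Idx_def)
  have es: "e (0, 0) = \<one>\<^bsub>H\<^esub>" "e (1, 0) = g" "e (0, 1) = x" "e (0, 2) = y"
    by (simp_all add: e_def numeral_2_eq_2)
  have "xcoeff j g = 0" if "0 < j" "j < 2 * p" for j
    using xcoeff_e[of 1 0 j] that es by simp
  then have slice: "slice j Y = xcoeff j Y \<cdot> \<one>\<^bsub>H\<^esub>" if "0 < j" "j < 2 * p" for j
    using Y that by (simp add: slice_def comult lin_add[OF xcoeff_tensor_lin] xcoeff_tensor_pure)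
  have coord_one: "coord (k, j) \<one>\<^bsub>H\<^esub> = (if k = 0 \<and> j = 0 then 1 else 0)" if "(k, j) \<in> Idx" for k j
    using coord_e[OF that idx(1)] es by auto
  have s1: "(if even j then ?c k (Suc j) else 0) = xcoeff 1 Y * (if k = 0 \<and> j = 0 then 1 else 0)"
    if "(k, j) \<in> Idx" for k j
    using coord_slice_1[OF Y that] slice[of 1] p by (simp add: lin_smult[OF coord_lin] coord_one[OF that])
  have s2: "of_nat (Suc (j div 2)) * (if j + 2 < 2 * p then ?c k (j + 2) else 0) =
      xcoeff 2 Y * (if k = 0 \<and> j = 0 then 1 else 0)" if "(k, j) \<in> Idx" for k j
    using coord_slice_2[OF Y that] slice[of 2] p by (simp add: lin_smult[OF coord_lin] coord_one[OF that])
  have c11: "?c 1 1 = 0" using s1[OF idx(2)] by simp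
  have c2: "?c k j = 0" if "(k, j) \<in> Idx" "j \<ge> 2" "(k, j) \<noteq> (0, 2)" for k j
  proof -
    obtain l where l: "j = l + 2" using \<open>j \<ge> 2\<close> by (metis le_add_diff_inverse2)
    have "(k, l) \<in> Idx" "l + 2 < 2 * p" using that l by (auto simp: Idx_def)
    moreover have "\<not> (k = 0 \<and> l = 0)" using that l by auto
    ultimately show ?thesis using s2[of k l] of_nat_index_neq_0[of l] l by auto
  qed
  have Y': "Y = ?c 0 0 \<cdot> e (0, 0) \<oplus>\<^bsub>H\<^esub> ?c 1 0 \<cdot> e (1, 0) \<oplus>\<^bsub>H\<^esub> ?c 0 1 \<cdot> e (0, 1) \<oplus>\<^bsub>H\<^esub> ?c 0 2 \<cdot> e (0, 2)"
    (is "_ = ?R")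
  proof (rule coord_eqI)
    fix i assume i: "i \<in> Idx"
    obtain k j where kj: "i = (k, j)" by (cases i)
    have coordR: "coord i ?R = ?c 0 0 * (if i = (0, 0) then 1 else 0) + ?c 1 0 * (if i = (1, 0) then 1 else 0) +
        ?c 0 1 * (if i = (0, 1) then 1 else 0) + ?c 0 2 * (if i = (0, 2) then 1 else 0)"
      using coord_e[OF i idx(1)] coord_e[OF i idx(2)] coord_e[OF i idx(3)] coord_e[OF i idx(4)]
      by (simp add: lin_add[OF coord_lin] lin_smult[OF coord_lin])
    have k: "k = 0 \<or> k = 1" using i kj by (auto simp: Idx_def)
    consider "i = (0, 0)" | "i = (1, 0)" | "i = (0, 1)" | "i = (1, 1)" | "i = (0, 2)" | "j \<ge> 2" "i \<noteq> (0, 2)"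
      using k kj by (cases "j = 0 \<or> j = 1") auto
    then show "coord i Y = coord i ?R"
      unfolding coordR using c11 c2[of k j] i kj by cases auto
  qed (use Y in auto)
  have yg: "e (0, 2) \<star> g = e (1, 2)" using e_even_g[of 0 1] by (simp add: es flip: numeral_2_eq_2)
  have xg': "e (0, 1) \<star> g = \<ominus>\<^bsub>H\<^esub> e (1, 1)" by (simp add: e_def xg)
  have eg: "e (0, 0) \<star> g = e (1, 0)" "e (1, 0) \<star> g = e (0, 0)" by (simp_all add: e_def gg)
  have ge: "g \<star> e (0, j) = e (1, j)" "g \<star> e (1, j) = e (0, j)" for j using g_e by simp_all
  have Yg: "?R \<star> g = ?c 0 0 \<cdot> e (1, 0) \<oplus>\<^bsub>H\<^esub> ?c 1 0 \<cdot> e (0, 0) \<oplus>\<^bsub>H\<^esub> (- ?c 0 1) \<cdot> e (1, 1) \<oplus>\<^bsub>H\<^esub> ?c 0 2 \<cdot> e (1, 2)"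
    by (simp add: H.l_distr H.smult_mult_left yg xg' eg H.smult_minus H.neg_smult del: One_nat_def)
  have gY: "g \<star> ?R = ?c 0 0 \<cdot> e (1, 0) \<oplus>\<^bsub>H\<^esub> ?c 1 0 \<cdot> e (0, 0) \<oplus>\<^bsub>H\<^esub> ?c 0 1 \<cdot> e (1, 1) \<oplus>\<^bsub>H\<^esub> ?c 0 2 \<cdot> e (1, 2)"
    by (simp add: H.r_distr H.smult_mult_right ge del: One_nat_def)
  have anti': "coord i (Y \<star> g) = - coord i (g \<star> Y)" for i
    using lin_smult[OF coord_lin, of "g \<star> Y" i "- 1"] Y by (simp add: anti H.smult_m1)
  have "coord i (Y \<star> g) = coord i (?R \<star> g)" "coord i (g \<star> Y) = coord i (g \<star> ?R)" for i
    using Y' by metis+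
  with anti' have "coord i (?R \<star> g) = - coord i (g \<star> ?R)" for i by metis
  note anti'' = this[unfolded Yg gY]
  have double: "c = 0" if "c = - c" for c :: 'k using that two_neq_0 by (metis add.right_inverse mult_2 mult_eq_0_iff)
  have "?c 0 0 = 0" "?c 1 0 = 0" "?c 0 2 = 0"
    by (rule double, use anti''[of "(1, 0)"] anti''[of "(0, 0)"] anti''[of "(1, 2)"] in
      \<open>simp add: lin_add[OF coord_lin] lin_smult[OF coord_lin] coord_e idx del: One_nat_def\<close>)+
  then have "?R = coord (0, 1) Y \<cdot> x" by (simp add: es del: One_nat_def)
  then show ?thesis using Y' by metis
qed

end

section \<open>Isomorphisms between the \<open>A\<^sub>(\<^sub>q\<^sub>)\<close>\<close>

text \<open>An isomorphism sends \<open>g\<close> to \<open>g\<close>, the only group-like other than \<open>1\<close> whose square is \<open>1\<close>, and hence sends \<open>x\<close> to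
  an anticommuting skew-primitive element \<open>s x\<close>. Comparing the images of both sides of
  \<open>x\<^sup>2\<^sup>p = q\<^sup>p\<^sup>-\<^sup>1 x\<^sup>2\<close> yields \<open>s\<^sup>2\<^sup>p r\<^sup>p\<^sup>-\<^sup>1 = q\<^sup>p\<^sup>-\<^sup>1 s\<^sup>2\<close>.\<close>

lemma A_hopf_isomorphic_imp_power_eq:
  fixes q r :: "'k::field"
  assumes "prime p" "odd p" "of_nat p = (0::'k)"
    and iso: "hopf_isomorphic (A_hopf p q) (A_hopf p r)"
  shows "\<exists>s. s \<noteq> 0 \<and> (s ^ 2 * r) ^ (p - 1) = q ^ (p - 1)"
proof -
  interpret Q: hopf_datum p q by (rule hopf_datum.intro) fact+
  interpret R: hopf_datum p r by (rule hopf_datum.intro) fact+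
  obtain f where f: "f \<in> hopf_hom Q.K R.K" and bij: "bij_betw f (carrier Q.K) (carrier R.K)"
    using iso unfolding hopf_isomorphic_def by blast
  have hom: "f \<in> algebra_hom Q.H R.H"
    using f unfolding hopf_hom_def Q.A_hopf_same R.A_hopf_same by blast
  have inj: "inj_on f (carrier Q.H)" using bij by (simp add: bij_betw_def)
  have comult: "R.\<Delta> (f a) = tensor_map R.H R.H f f (Q.\<Delta> a)" and counit: "R.\<epsilon> (f a) = Q.\<epsilon> a"
    if "a \<in> carrier Q.H" for a
    using f that unfolding hopf_hom_def Q.A_hopf_same R.A_hopf_same by simp_all
  note l = algebra_hom_lin[OF hom]
  note map_lin = tensor_map_lin[OF Q.UH Q.UH R.UH R.UH l l]
    and map_pure = tensor_map_pure[OF Q.UH Q.UH R.UH R.UH l l]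
  note hom_simps = algebra_hom_one[OF hom] algebra_hom_mult[OF hom] algebra_hom_closed[OF hom]
  have "f Q.g = \<one>\<^bsub>R.H\<^esub> \<or> f Q.g = R.g"
  proof (rule R.grouplike_cases)
    show "R.\<Delta> (f Q.g) = R.pure (f Q.g) (f Q.g)" by (simp add: comult Q.comult_g map_pure)
    show "R.\<epsilon> (f Q.g) = 1" by (simp add: counit Q.counit_gen)
    show "f Q.g \<otimes>\<^bsub>R.H\<^esub> f Q.g = \<one>\<^bsub>R.H\<^esub>" using hom_simps(2)[of Q.g Q.g] by (simp add: Q.gg hom_simps)
  qed (simp add: hom_simps)
  moreover have "f Q.g \<noteq> \<one>\<^bsub>R.H\<^esub>"
  proof
    assume "f Q.g = \<one>\<^bsub>R.H\<^esub>"
    then have "f Q.g = f \<one>\<^bsub>Q.H\<^esub>" by (simp add: hom_simps)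
    then have "Q.g = \<one>\<^bsub>Q.H\<^esub>" using inj by (auto dest: inj_onD)
    then have "Q.e (0, 0) = Q.e (1, 0)" by (simp add: Q.e_def)
    then show False using Q.coord_e[of "(0, 0)" "(0, 0)"] Q.coord_e[of "(0, 0)" "(1, 0)"] Q.p_pos
      by (simp add: Q.Idx_def)
  qed
  ultimately have fg: "f Q.g = R.g" by simp
  define s where "s = R.coord (0, 1) (f Q.x)"
  have fx: "f Q.x = s \<odot>\<^bsub>R.H\<^esub> R.x"
    unfolding s_def
  proof (rule R.anticommuting_skew_primitive)
    show "R.\<Delta> (f Q.x) = R.pure (f Q.x) \<one>\<^bsub>R.H\<^esub> \<oplus>\<^bsub>R.HH\<^esub> R.pure R.g (f Q.x)"
      by (simp add: comult Q.comult_x lin_add[OF map_lin] map_pure fg hom_simps)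
    show "f Q.x \<otimes>\<^bsub>R.H\<^esub> R.g = \<ominus>\<^bsub>R.H\<^esub> (R.g \<otimes>\<^bsub>R.H\<^esub> f Q.x)"
      using hom_simps(2)[of Q.x Q.g] by (simp add: Q.xg lin_neg[OF l Q.UH R.UH] hom_simps fg)
  qed (simp add: hom_simps)
  have s: "s \<noteq> 0"
  proof
    assume "s = 0"
    then have "f Q.x = f \<zero>\<^bsub>Q.H\<^esub>" using fx by (simp add: lin_zero[OF l Q.UH R.UH])
    then have "Q.x = \<zero>\<^bsub>Q.H\<^esub>" using inj by (auto dest: inj_onD)
    then have "Q.e (0, 1) = \<zero>\<^bsub>Q.H\<^esub>" by (simp add: Q.e_def)
    then show False using Q.coord_e[of "(0, 1)" "(0, 1)"] Q.coord_zero[of "(0, 1)"] Q.p_ge_3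
      by (simp add: Q.Idx_def)
  qed
  have "f (Q.x [^]\<^bsub>Q.H\<^esub> (2 * p)) = f (q ^ (p - 1) \<odot>\<^bsub>Q.H\<^esub> (Q.x \<otimes>\<^bsub>Q.H\<^esub> Q.x))"
    by (simp only: Q.x_pow)
  then have "s ^ (2 * p) \<odot>\<^bsub>R.H\<^esub> R.x [^]\<^bsub>R.H\<^esub> (2 * p) = (q ^ (p - 1) * s ^ 2) \<odot>\<^bsub>R.H\<^esub> (R.x \<otimes>\<^bsub>R.H\<^esub> R.x)"
    by (simp add: algebra_hom_pow[OF hom Q.UH] lin_smult[OF l] hom_simps fx R.H.smult_pow
        R.H.smult_mult_left R.H.smult_mult_right R.H.smult_smult power2_eq_square mult.assoc)
  moreover have e02: "R.e (0, 2) = R.y" by (simp add: R.e_def numeral_2_eq_2)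
  ultimately have "(s ^ (2 * p) * r ^ (p - 1)) \<odot>\<^bsub>R.H\<^esub> R.e (0, 2) = (q ^ (p - 1) * s ^ 2) \<odot>\<^bsub>R.H\<^esub> R.e (0, 2)"
    by (simp add: R.x_pow R.H.smult_smult e02)
  then have "R.coord (0, 2) ((s ^ (2 * p) * r ^ (p - 1)) \<odot>\<^bsub>R.H\<^esub> R.e (0, 2)) =
      R.coord (0, 2) ((q ^ (p - 1) * s ^ 2) \<odot>\<^bsub>R.H\<^esub> R.e (0, 2))" by simp
  moreover have "R.coord (0, 2) (R.e (0, 2)) = 1"
    using R.coord_e[of "(0, 2)" "(0, 2)"] R.p_ge_3 by (simp add: R.Idx_def)
  ultimately have *: "s ^ (2 * p) * r ^ (p - 1) = q ^ (p - 1) * s ^ 2"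
    by (simp add: lin_smult[OF R.coord_lin])
  have "s ^ (2 * p) = (s ^ 2) ^ (p - 1) * s ^ 2"
    unfolding power_mult by (rule power_minus_mult[OF Q.p_pos, symmetric])
  then have "((s ^ 2) ^ (p - 1) * r ^ (p - 1)) * s ^ 2 = q ^ (p - 1) * s ^ 2"
    using * by (metis mult.assoc mult.commute)
  moreover have "s ^ 2 \<noteq> 0" using s by simp
  ultimately have "(s ^ 2) ^ (p - 1) * r ^ (p - 1) = q ^ (p - 1)"
    by (rule mult_right_cancel[THEN iffD1, rotated])
  then have "(s ^ 2 * r) ^ (p - 1) = q ^ (p - 1)" by (simp only: power_mult_distrib)
  then show ?thesis using s by blast
qed

section \<open>The field of rational functions\<close>

definition lead_monom :: "('m::linorder \<Rightarrow>\<^sub>0 'c::zero) \<Rightarrow> 'm" where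
  "lead_monom f = Max (msupp f)"

lemma lead_monom_single: "c \<noteq> 0 \<Longrightarrow> lead_monom (msingle u c) = u"
  by (simp add: lead_monom_def)

text \<open>The product of the leading terms is the only contribution to its exponent, since addition of exponents
  is strictly monotone; the coefficients multiply to a non-zero element.\<close>

lemma lead_monom_mult:
  fixes f h :: "'m::{ordered_cancel_comm_monoid_add, linorder} \<Rightarrow>\<^sub>0 'c::idom"
  assumes "f \<noteq> 0" "h \<noteq> 0"
  shows "lead_monom (f * h) = lead_monom f + lead_monom h"
proof -
  let ?u = "lead_monom f" and ?v = "lead_monom h"
  have u: "?u \<in> msupp f" and v: "?v \<in> msupp h"
    using assms by (simp_all add: lead_monom_def)
  have le: "a \<le> ?u" if "a \<in> msupp f" for a using that by (simp add: lead_monom_def)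
  have le': "b \<le> ?v" if "b \<in> msupp h" for b using that by (simp add: lead_monom_def)
  have uniq: "a = ?u \<and> b = ?v"
    if "a \<in> msupp f" "b \<in> msupp h" "a + b = ?u + ?v" for a b
  proof (rule ccontr)
    assume "\<not> (a = ?u \<and> b = ?v)"
    then have "a < ?u \<or> b < ?v" using le[OF that(1)] le'[OF that(2)] by auto
    then have "a + b < ?u + ?v"
      using le[OF that(1)] le'[OF that(2)] by (auto intro: add_less_le_mono add_le_less_mono)
    then show False using that(3) by simp
  qed
  have "mcoeff (f * h) (?u + ?v) =
      (\<Sum>a\<in>msupp f. mcoeff f a *
        (\<Sum>b\<in>msupp h. mcoeff h b when ?u + ?v = a + b))"
    unfolding times_poly_mapping.rep_eq prod_fun_def
    by (subst Sum_any.expand_superset[of "msupp f"], simp, force simp: in_keys_iff)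
      (intro sum.cong refl arg_cong2[where f = "(*)"] Sum_any.expand_superset, auto simp: in_keys_iff)
  also have "\<dots> = (\<Sum>a\<in>msupp f. if a = ?u then mcoeff f ?u * mcoeff h ?v else 0)"
  proof (rule sum.cong[OF refl])
    fix a assume a: "a \<in> msupp f"
    have "(\<Sum>b\<in>msupp h. mcoeff h b when ?u + ?v = a + b) =
        (\<Sum>b\<in>msupp h. if b = ?v then (if a = ?u then mcoeff h ?v else 0) else 0)"
      by (rule sum.cong[OF refl]) (use uniq[OF a] in \<open>auto simp: when_def\<close>)
    then show "mcoeff f a * (\<Sum>b\<in>msupp h. mcoeff h b when ?u + ?v = a + b) =
        (if a = ?u then mcoeff f ?u * mcoeff h ?v else 0)"
      using v by simp
  qed
  also have "\<dots> = mcoeff f ?u * mcoeff h ?v" using u by simp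
  finally have "mcoeff (f * h) (?u + ?v) \<noteq> 0" using u v by (simp add: in_keys_iff)
  then have "?u + ?v \<in> msupp (f * h)" by (simp add: in_keys_iff)
  moreover have "c \<le> ?u + ?v" if "c \<in> msupp (f * h)" for c
    using that keys_mult[of f h] le le' by (auto intro: add_mono)
  ultimately show ?thesis unfolding lead_monom_def by (intro Max_eqI) auto
qed

lemma lead_monom_power_lookup:
  fixes f :: "('i::linorder \<Rightarrow>\<^sub>0 nat) \<Rightarrow>\<^sub>0 'c::idom"
  assumes "f \<noteq> 0"
  shows "mcoeff (lead_monom (f ^ n)) i = n * mcoeff (lead_monom f) i"
proof (induction n)
  case 0
  have "lead_monom (1 :: ('i \<Rightarrow>\<^sub>0 nat) \<Rightarrow>\<^sub>0 'c) = 0" by (simp add: lead_monom_def)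
  then show ?case by simp
next
  case (Suc n)
  then show ?case using assms by (simp add: lead_monom_mult lookup_add)
qed

text \<open>In \<open>(s\<^sup>2 X\<^sub>j)\<^sup>m = X\<^sub>i\<^sup>m\<close> the exponent of \<open>X\<^sub>j\<close> would be an odd multiple of \<open>m\<close> on the left and an even
  one on the right.\<close>

lemma indet_not_power_square_multiple:
  fixes s :: "'p::prime_card rat_funs"
  assumes ij: "i \<ge> 1" "j \<ge> 1" "i \<noteq> j" and m: "m > 0"
  shows "(s ^ 2 * indet j) ^ m \<noteq> indet i ^ m"
proof
  assume eq: "(s ^ 2 * indet j) ^ m = indet i ^ m"
  let ?X = "\<lambda>i. msingle (msingle (i - 1) 1) 1 :: (nat \<Rightarrow>\<^sub>0 nat) \<Rightarrow>\<^sub>0 'p mod_ring"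
  obtain a b where s: "s = Fract a b" and b: "b \<noteq> 0" by (cases s) auto
  have pow: "Fract c d ^ n = Fract (c ^ n) (d ^ n)" for c d :: "(nat \<Rightarrow>\<^sub>0 nat) \<Rightarrow>\<^sub>0 'p mod_ring" and n
    by (induction n) (simp_all add: One_fract_def)
  have X0: "?X l \<noteq> 0" for l by (metis lookup_single_eq lookup_zero one_neq_zero)
  have "Fract ((a ^ 2 * ?X j) ^ m) ((b ^ 2) ^ m) = Fract (?X i ^ m) 1"
    using eq by (simp add: s indet_def pow)
  then have eq': "(a ^ 2 * ?X j) ^ m = ?X i ^ m * (b ^ 2) ^ m"
    using b by (simp add: eq_fract)
  have bm: "(b ^ 2) ^ m \<noteq> 0" "?X i ^ m \<noteq> 0" using b X0 by simp_all
  then have "(a ^ 2 * ?X j) ^ m \<noteq> 0" unfolding eq' by simp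
  then have "a \<noteq> 0" using m by (auto simp: zero_power)
  then have aj: "a ^ 2 * ?X j \<noteq> 0" using X0 by simp
  have "j - 1 \<noteq> i - 1" using ij by simp
  then have Xi: "mcoeff (lead_monom (?X i)) (j - 1) = 0"
    and Xj: "mcoeff (lead_monom (?X j)) (j - 1) = 1"
    by (simp_all add: lead_monom_single lookup_single)
  let ?l = "\<lambda>f. mcoeff (lead_monom f) (j - 1)"
  have "?l ((a ^ 2 * ?X j) ^ m) = m * (2 * ?l a + 1)"
    unfolding lead_monom_power_lookup[OF aj]
    using \<open>a \<noteq> 0\<close> X0 Xj by (simp add: lead_monom_mult lookup_add lead_monom_power_lookup)
  moreover have "?l (?X i ^ m * (b ^ 2) ^ m) = m * (2 * ?l b)"
    unfolding lead_monom_mult[OF bm(2,1)] lookup_add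
    using b X0 Xi by (simp add: lead_monom_power_lookup)
  ultimately have "m * (2 * ?l a + 1) = m * (2 * ?l b)" using eq' by simp
  then have "2 * ?l a + 1 = 2 * ?l b" using m unfolding mult_cancel1 by simp
  then show False by presburger
qed

lemma of_nat_card_rat_funs: "of_nat CARD('p::prime_card) = (0 :: 'p rat_funs)"
proof -
  have "(of_nat CARD('p) :: (nat \<Rightarrow>\<^sub>0 nat) \<Rightarrow>\<^sub>0 'p mod_ring) = msingle 0 (of_nat CARD('p))"
    by (rule single_of_nat[symmetric])
  also have "\<dots> = 0" by (simp only: of_nat_card_eq_0 single_zero)
  finally show ?thesis by (simp only: of_nat_fract Zero_fract_def)
qed

theorem corollary4p7:
  fixes p :: nat
  assumes "prime p" and "p \<ge> 3" and "CARD('p::prime_card) = p"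
  shows "(\<forall>i\<ge>1. hopf_algebra (A_hopf p (indet i :: 'p rat_funs)) \<and>
            vectorspace.fin_dim class_ring (A_hopf p (indet i :: 'p rat_funs)) \<and>
            vectorspace.dim class_ring (A_hopf p (indet i :: 'p rat_funs)) = 4 * p) \<and>
         (\<forall>i\<ge>1. \<forall>j\<ge>1. i \<noteq> j \<longrightarrow>
            \<not> hopf_isomorphic (A_hopf p (indet i :: 'p rat_funs)) (A_hopf p (indet j)))"
proof -
  have odd: "odd p" using assms(1,2) prime_odd_nat by auto
  have char: "of_nat p = (0 :: 'p rat_funs)" using of_nat_card_rat_funs[where 'p = 'p] assms(3) by simp
  have "hopf_algebra (A_hopf p (indet i :: 'p rat_funs)) \<and>
      vectorspace.fin_dim class_ring (A_hopf p (indet i :: 'p rat_funs)) \<and>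
      vectorspace.dim class_ring (A_hopf p (indet i :: 'p rat_funs)) = 4 * p" for i
  proof -
    interpret hopf_datum p "indet i :: 'p rat_funs"
      by (rule hopf_datum.intro[OF assms(1) odd char])
    show ?thesis using A_hopf_is_hopf_algebra A_hopf_dim by blast
  qed
  moreover have "\<not> hopf_isomorphic (A_hopf p (indet i :: 'p rat_funs)) (A_hopf p (indet j))"
    if "i \<ge> 1" "j \<ge> 1" "i \<noteq> j" for i j
  proof
    assume "hopf_isomorphic (A_hopf p (indet i :: 'p rat_funs)) (A_hopf p (indet j))"
    from A_hopf_isomorphic_imp_power_eq[OF assms(1) odd char this]
    obtain s :: "'p rat_funs" where "(s ^ 2 * indet j) ^ (p - 1) = indet i ^ (p - 1)" by blast
    moreover have "p - 1 > 0" using assms(2) by simp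
    ultimately show False using indet_not_power_square_multiple[OF that] by blast
  qed
  ultimately show ?thesis by blast
qed

end
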